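(* Let $K$ be a commutative ring with identity, let $G$ be a finite groupoid, and let $\beta=\{\beta_g:E_{g^{-1}}\to E_g\}_{g\in G}$ be an action of $G$ on a faithful commutative $K$-algebra $R$ such that each $E_e$ ($e\in G_0$) is unital with identity element $1_e$, $R=\bigoplus_{e\in G_0}E_e$ and $R^\beta=K$. Assume that $R$ is a $\beta$-Galois extension of $K$ and that $E_g$ is a faithfully projective $K$-module for every $g\in G$. Then the assignment $\theta: X\mapsto A(X)$ is a contravariant functor that induces an equivalence between the category of finite $G$-split sets (with $G$-maps as morphisms) and the category of $R$-split $K$-algebras (with $K$-algebra homomorphisms as morphisms), with inverse $\theta': B\mapsto V(B)$.
   Context: All algebras are commutative and unital, ring homomorphisms are unitary, and $\otimes=\otimes_K$. A $K$-module is faithfully projective if it is faithful, projective and finitely generated. Groupoid: a nonempty set $G$ with a partially defined associative product in which every $g$ has a right identity $d(g)=g^{-1}g$ and a left identity $r(g)=gg^{-1}$ (a small category with all arrows invertible); $gh$ is defined iff $d(g)=r(h)$. $G_0$ is the set of identities. Action of $G$ on a nonempty set $X$ (then $X$ is called a $G$-set): subsets $X_g=X_{r(g)}\subseteq X$ and bijections $\gamma_g:X_{g^{-1}}\to X_g$ ($g\in G$) with $\gamma_e=\mathrm{Id}_{X_e}$ for $e\in G_0$ and $\gamma_g\gamma_h(x)=\gamma_{gh}(x)$ whenever $gh$ is defined and $x\in X_{h^{-1}}$. $X$ is $G$-split if $X$ is the disjoint union of the $X_e$, $e\in G_0$. A $G$-map is a map commuting with the action of $G$: it sends the $g$-indexed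 subset into the $g$-indexed subset and intertwines the bijections indexed by $g$, for every $g\in G$. Action of $G$ on a $K$-algebra $R$: ideals $E_g=E_{r(g)}$ of $R$ and $K$-algebra isomorphisms $\beta_g:E_{g^{-1}}\to E_g$ satisfying the same two conditions ($\beta_e=\mathrm{Id}$ for $e\in G_0$, and $\beta_g\beta_h=\beta_{gh}$ when $gh$ is defined). Write $1_g=1_{r(g)}$ for the identity of $E_g$. $R^\beta=\{r\in R: \beta_g(r1_{g^{-1}})=r1_g\ \forall g\in G\}$. $R$ is a $\beta$-Galois extension of $R^\beta$ if there are $x_i,y_i\in R$, $1\le i\le m$, such that, for every $g\in G$, $\sum_i x_i\beta_g(y_i1_{g^{-1}})$ equals $1_g$ if $g\in G_0$ and $0$ if $g\notin G_0$. For a finite $G$-split set $X$ with action $\gamma$, $\mathrm{Map}(X,R)=\{f:X\to R\mid f(X_g)\subseteq E_g\ \forall g\in G\}$ (pointwise operations) and $A(X)=\{f\in \mathrm{Map}(X,R)\mid \beta_g(f(x))=f(\gamma_g(x))\ \forall g\in G,\ x\in X_{g^{-1}}\}$, a $K$-algebra. $R$-split algebras: a $K$-algebra $B$ is $R$-split if there are $m\ge 1$ and, for each $e\in G_0$, an isomorphism of $E_e$-algebras $\varphi_e:E_e\otimes B\to (E_e)^m$ such that, with $\varphi_{(e,i)}:B\to E_e$ the $K$-algebra homomorphism sending $b$ to the $i$-th coordinate of $\varphi_e(1_e\otimes b)$, $V_e(B)=\{\varphi_{(e,i)}\mid 1\le i\le m\}$, $V_g(B)=V_{r(g)}(B)$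 for $g\in G$, and $V(B)=\bigcup_{e\in G_0}V_e(B)$ (a disjoint union, homomorphisms being regarded with their codomains), the set $V(B)$ is a $G$-set via the maps $\xi_g:V_{g^{-1}}(B)\to V_g(B)$, $\xi_g(\varphi)=\beta_g\circ\varphi$.
   Formalization: K is assumed nonzero; R-split algebras carry a chosen splitting V(B), and morphisms are the K-algebra homomorphisms f: B→B' whose precomposition maps V(B') into V(B); if every E_e has only trivial idempotents these are all homomorphisms, and otherwise the claim for all homomorphisms fails. *)

theory Defs
  imports "HOL-Algebra.Module" "HOL-Algebra.Ideal" "HOL-Library.FuncSet" "HOL-Library.Disjoint_Sets"
begin

text \<open>Algebras are HOL-Algebra algebras (commutative and unital); a carrier-restricted function is
  made canonical by being \<^const>\<open>undefined\<close> off its domain wherever functions are compared for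
  equality (morphisms, elements of \<open>A(X)\<close>, elements of \<open>V(B)\<close>).\<close>

section \<open>Groupoids\<close>

record 'g groupoid =
  arr :: "'g set"
  gmult :: "'g \<Rightarrow> 'g \<Rightarrow> 'g"
  ginv :: "'g \<Rightarrow> 'g"

definition gdom :: "'g groupoid \<Rightarrow> 'g \<Rightarrow> 'g" where
  "gdom G g = gmult G (ginv G g) g"

definition grng :: "'g groupoid \<Rightarrow> 'g \<Rightarrow> 'g" where
  "grng G g = gmult G g (ginv G g)"

definition idents :: "'g groupoid \<Rightarrow> 'g set" where
  "idents G = gdom G ` arr G"

text \<open>The partial product is modelled by a total function of which only the values at composable
  pairs, \<open>gdom G g = grng G h\<close>, are ever used.\<close>

definition is_groupoid :: "'g groupoid \<Rightarrow> bool" where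
  "is_groupoid G \<longleftrightarrow>
     arr G \<noteq> {} \<and>
     (\<forall>g\<in>arr G. ginv G g \<in> arr G \<and> gdom G g \<in> arr G \<and> grng G g \<in> arr G \<and>
        gdom G (ginv G g) = grng G g \<and> grng G (ginv G g) = gdom G g \<and>
        grng G (gdom G g) = gdom G g \<and> gdom G (gdom G g) = gdom G g \<and>
        grng G (grng G g) = grng G g \<and> gdom G (grng G g) = grng G g \<and>
        gmult G g (gdom G g) = g \<and> gmult G (grng G g) g = g) \<and>
     (\<forall>g\<in>arr G. \<forall>h\<in>arr G. gdom G g = grng G h \<longrightarrow>
        gmult G g h \<in> arr G \<and> gdom G (gmult G g h) = gdom G h \<and>
        grng G (gmult G g h) = grng G g) \<and>
     (\<forall>g\<in>arr G. \<forall>h\<in>arr G. \<forall>k\<in>arr G. gdom G g = grng G h \<longrightarrow> gdom G h = grng G k \<longrightarrow>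
        gmult G (gmult G g h) k = gmult G g (gmult G h k))"


section \<open>Sets with a groupoid action\<close>

record ('g, 'x) gset =
  gcar :: "'x set"
  gsub :: "'g \<Rightarrow> 'x set"
  gact :: "'g \<Rightarrow> 'x \<Rightarrow> 'x"

definition is_gset :: "'g groupoid \<Rightarrow> ('g, 'x) gset \<Rightarrow> bool" where
  "is_gset G X \<longleftrightarrow>
     gcar X \<noteq> {} \<and>
     (\<forall>g\<in>arr G. gsub X g \<subseteq> gcar X \<and> gsub X g = gsub X (grng G g) \<and>
        bij_betw (gact X g) (gsub X (ginv G g)) (gsub X g)) \<and>
     (\<forall>e\<in>idents G. \<forall>x\<in>gsub X e. gact X e x = x) \<and>
     (\<forall>g\<in>arr G. \<forall>h\<in>arr G. gdom G g = grng G h \<longrightarrow>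
        (\<forall>x\<in>gsub X (ginv G h). gact X g (gact X h x) = gact X (gmult G g h) x))"

definition is_split :: "'g groupoid \<Rightarrow> ('g, 'x) gset \<Rightarrow> bool" where
  "is_split G X \<longleftrightarrow>
     gcar X = (\<Union>e\<in>idents G. gsub X e) \<and> disjoint_family_on (gsub X) (idents G)"

definition gmaps :: "'g groupoid \<Rightarrow> ('g, 'x) gset \<Rightarrow> ('g, 'y) gset \<Rightarrow> ('x \<Rightarrow> 'y) set" where
  "gmaps G X Y = {f. f \<in> gcar X \<rightarrow>\<^sub>E gcar Y \<and>
     (\<forall>g\<in>arr G. f ` gsub X g \<subseteq> gsub Y g \<and>
        (\<forall>x\<in>gsub X (ginv G g). f (gact X g x) = gact Y g (f x)))}"

definition gset_iso :: "'g groupoid \<Rightarrow> ('g, 'x) gset \<Rightarrow> ('g, 'y) gset \<Rightarrow> ('x \<Rightarrow> 'y) \<Rightarrow> bool" where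
  "gset_iso G X Y f \<longleftrightarrow> f \<in> gmaps G X Y \<and>
     (\<exists>h\<in>gmaps G Y X. (\<forall>x\<in>gcar X. h (f x) = x) \<and> (\<forall>y\<in>gcar Y. f (h y) = y))"


section \<open>Modules and algebras\<close>

definition faithful_module :: "('k, 'c) ring_scheme \<Rightarrow> ('k, 'm, 'd) module_scheme \<Rightarrow> bool" where
  "faithful_module K M \<longleftrightarrow>
     (\<forall>k\<in>carrier K. (\<forall>x\<in>carrier M. k \<odot>\<^bsub>M\<^esub> x = \<zero>\<^bsub>M\<^esub>) \<longrightarrow> k = \<zero>\<^bsub>K\<^esub>)"

definition fin_gen_module :: "('k, 'c) ring_scheme \<Rightarrow> ('k, 'm, 'd) module_scheme \<Rightarrow> bool" where
  "fin_gen_module K M \<longleftrightarrow>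
     (\<exists>S. finite S \<and> S \<subseteq> carrier M \<and>
        (\<forall>x\<in>carrier M. \<exists>c\<in>S \<rightarrow> carrier K. x = (\<Oplus>\<^bsub>M\<^esub>s\<in>S. c s \<odot>\<^bsub>M\<^esub> s)))"

definition module_hom ::
  "('k, 'c) ring_scheme \<Rightarrow> ('k, 'm, 'd) module_scheme \<Rightarrow> ('k, 'n, 'e) module_scheme \<Rightarrow> ('m \<Rightarrow> 'n) set"
where
  "module_hom K M N = {f. f \<in> carrier M \<rightarrow> carrier N \<and>
     (\<forall>x\<in>carrier M. \<forall>y\<in>carrier M. f (x \<oplus>\<^bsub>M\<^esub> y) = f x \<oplus>\<^bsub>N\<^esub> f y) \<and>
     (\<forall>k\<in>carrier K. \<forall>x\<in>carrier M. f (k \<odot>\<^bsub>M\<^esub> x) = k \<odot>\<^bsub>N\<^esub> f x)}"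

text \<open>The free module on a set \<open>S\<close>: finitely supported functions. Only the additive structure and
  the scalars matter; the multiplicative fields of the record are fillers.\<close>

definition free_module :: "('k, 'c) ring_scheme \<Rightarrow> 's set \<Rightarrow> ('k, 's \<Rightarrow> 'k) module" where
  "free_module K S =
     \<lparr>carrier = {f \<in> S \<rightarrow>\<^sub>E carrier K. finite {s\<in>S. f s \<noteq> \<zero>\<^bsub>K\<^esub>}},
      monoid.mult = (\<lambda>f h. undefined), one = undefined,
      zero = (\<lambda>s\<in>S. \<zero>\<^bsub>K\<^esub>), add = (\<lambda>f h. \<lambda>s\<in>S. f s \<oplus>\<^bsub>K\<^esub> h s),
      smult = (\<lambda>k f. \<lambda>s\<in>S. k \<otimes>\<^bsub>K\<^esub> f s)\<rparr>"

text \<open>Projective means being a direct summand of a free module. Every module is a quotient of the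
  free module on its own carrier, so index sets in the type of the module lose no generality.\<close>

definition projective_module :: "('k, 'c) ring_scheme \<Rightarrow> ('k, 'm, 'd) module_scheme \<Rightarrow> bool" where
  "projective_module K M \<longleftrightarrow>
     (\<exists>(S :: 'm set) i p. i \<in> module_hom K M (free_module K S) \<and>
        p \<in> module_hom K (free_module K S) M \<and> (\<forall>x\<in>carrier M. p (i x) = x))"

definition faithfully_projective :: "('k, 'c) ring_scheme \<Rightarrow> ('k, 'm, 'd) module_scheme \<Rightarrow> bool" where
  "faithfully_projective K M \<longleftrightarrow>
     module K M \<and> faithful_module K M \<and> projective_module K M \<and> fin_gen_module K M"

definition alg_hom ::
  "('k, 'c) ring_scheme \<Rightarrow> ('k, 'a, 'd) module_scheme \<Rightarrow> ('k, 'b, 'e) module_scheme \<Rightarrow> ('a \<Rightarrow> 'b) set"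
where
  "alg_hom K A B = {f \<in> ring_hom A B.
     \<forall>k\<in>carrier K. \<forall>x\<in>carrier A. f (k \<odot>\<^bsub>A\<^esub> x) = k \<odot>\<^bsub>B\<^esub> f x}"

definition alg_iso ::
  "('k, 'c) ring_scheme \<Rightarrow> ('k, 'a, 'd) module_scheme \<Rightarrow> ('k, 'b, 'e) module_scheme \<Rightarrow> ('a \<Rightarrow> 'b) set"
where
  "alg_iso K A B = {f \<in> alg_hom K A B. bij_betw f (carrier A) (carrier B)}"

definition ideal_algebra :: "('k, 'r) module \<Rightarrow> 'r set \<Rightarrow> 'r \<Rightarrow> ('k, 'r) module" where
  "ideal_algebra R I u = R\<lparr>carrier := I, one := u\<rparr>"

text \<open>The power \<open>E\<^sup>m\<close> of a commutative ring \<open>E\<close> as an algebra over \<open>E\<close>.\<close>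

definition power_algebra :: "('r, 'c) ring_scheme \<Rightarrow> nat \<Rightarrow> ('r, nat \<Rightarrow> 'r) module" where
  "power_algebra E m =
     \<lparr>carrier = {..<m} \<rightarrow>\<^sub>E carrier E,
      monoid.mult = (\<lambda>f h. \<lambda>i\<in>{..<m}. f i \<otimes>\<^bsub>E\<^esub> h i), one = (\<lambda>i\<in>{..<m}. \<one>\<^bsub>E\<^esub>),
      zero = (\<lambda>i\<in>{..<m}. \<zero>\<^bsub>E\<^esub>), add = (\<lambda>f h. \<lambda>i\<in>{..<m}. f i \<oplus>\<^bsub>E\<^esub> h i),
      smult = (\<lambda>a f. \<lambda>i\<in>{..<m}. a \<otimes>\<^bsub>E\<^esub> f i)\<rparr>"


section \<open>Tensor product of two algebras\<close>

text \<open>\<open>E \<otimes>\<^sub>K B\<close> by generators and relations: a list \<open>[(x\<^sub>1, y\<^sub>1), \<dots>, (x\<^sub>n, y\<^sub>n)]\<close> stands for the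
  sum of the \<open>x\<^sub>i \<otimes> y\<^sub>i\<close>, and lists are taken modulo the least congruence for concatenation that
  makes addition commutative and \<open>\<otimes>\<close> additive in each argument and \<open>K\<close>-balanced. Negatives exist
  since \<open>x \<otimes> y + (-x) \<otimes> y = 0 \<otimes> y = 0\<close>.\<close>

inductive tensor_eq ::
  "('k, 'c) ring_scheme \<Rightarrow> ('k, 'a, 'd) module_scheme \<Rightarrow> ('k, 'b, 'e) module_scheme \<Rightarrow>
   ('a \<times> 'b) list \<Rightarrow> ('a \<times> 'b) list \<Rightarrow> bool"
  for K E B
where
  refl: "set ps \<subseteq> carrier E \<times> carrier B \<Longrightarrow> tensor_eq K E B ps ps"
| sym: "tensor_eq K E B ps qs \<Longrightarrow> tensor_eq K E B qs ps"
| trans: "tensor_eq K E B ps qs \<Longrightarrow> tensor_eq K E B qs rs \<Longrightarrow> tensor_eq K E B ps rs"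
| append: "tensor_eq K E B ps ps' \<Longrightarrow> tensor_eq K E B qs qs' \<Longrightarrow>
    tensor_eq K E B (ps @ qs) (ps' @ qs')"
| comm: "set ps \<subseteq> carrier E \<times> carrier B \<Longrightarrow> set qs \<subseteq> carrier E \<times> carrier B \<Longrightarrow>
    tensor_eq K E B (ps @ qs) (qs @ ps)"
| zero: "y \<in> carrier B \<Longrightarrow> tensor_eq K E B [(\<zero>\<^bsub>E\<^esub>, y)] []"
| add_left: "x \<in> carrier E \<Longrightarrow> x' \<in> carrier E \<Longrightarrow> y \<in> carrier B \<Longrightarrow>
    tensor_eq K E B [(x \<oplus>\<^bsub>E\<^esub> x', y)] [(x, y), (x', y)]"
| add_right: "x \<in> carrier E \<Longrightarrow> y \<in> carrier B \<Longrightarrow> y' \<in> carrier B \<Longrightarrow>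
    tensor_eq K E B [(x, y \<oplus>\<^bsub>B\<^esub> y')] [(x, y), (x, y')]"
| balanced: "k \<in> carrier K \<Longrightarrow> x \<in> carrier E \<Longrightarrow> y \<in> carrier B \<Longrightarrow>
    tensor_eq K E B [(k \<odot>\<^bsub>E\<^esub> x, y)] [(x, k \<odot>\<^bsub>B\<^esub> y)]"

definition tensor_class ::
  "('k, 'c) ring_scheme \<Rightarrow> ('k, 'a, 'd) module_scheme \<Rightarrow> ('k, 'b, 'e) module_scheme \<Rightarrow>
   ('a \<times> 'b) list \<Rightarrow> ('a \<times> 'b) list set"
where
  "tensor_class K E B ps = {qs. tensor_eq K E B ps qs}"

text \<open>The operations are computed on representatives (the unions below are unions of equal
  classes). The scalars are those of \<open>E\<close>, acting on the left factor.\<close>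

definition tensor_algebra ::
  "('k, 'c) ring_scheme \<Rightarrow> ('k, 'a, 'd) module_scheme \<Rightarrow> ('k, 'b, 'e) module_scheme \<Rightarrow>
   ('a, ('a \<times> 'b) list set) module"
where
  "tensor_algebra K E B =
     \<lparr>carrier = tensor_class K E B ` {ps. set ps \<subseteq> carrier E \<times> carrier B},
      monoid.mult = (\<lambda>P Q. \<Union>ps\<in>P. \<Union>qs\<in>Q.
        tensor_class K E B [(x \<otimes>\<^bsub>E\<^esub> x', y \<otimes>\<^bsub>B\<^esub> y'). (x, y) \<leftarrow> ps, (x', y') \<leftarrow> qs]),
      one = tensor_class K E B [(\<one>\<^bsub>E\<^esub>, \<one>\<^bsub>B\<^esub>)],
      zero = tensor_class K E B [],
      add = (\<lambda>P Q. \<Union>ps\<in>P. \<Union>qs\<in>Q. tensor_class K E B (ps @ qs)),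
      smult = (\<lambda>a P. \<Union>ps\<in>P. tensor_class K E B [(a \<otimes>\<^bsub>E\<^esub> x, y). (x, y) \<leftarrow> ps])\<rparr>"


section \<open>Groupoid actions on algebras\<close>

definition is_algebra_action ::
  "'g groupoid \<Rightarrow> ('k, 'c) ring_scheme \<Rightarrow> ('k, 'r) module \<Rightarrow> ('g \<Rightarrow> 'r set) \<Rightarrow>
   ('g \<Rightarrow> 'r \<Rightarrow> 'r) \<Rightarrow> bool"
where
  "is_algebra_action G K R E \<beta> \<longleftrightarrow>
     (\<forall>g\<in>arr G. ideal (E g) R \<and> E g = E (grng G g) \<and>
        bij_betw (\<beta> g) (E (ginv G g)) (E g) \<and>
        (\<forall>x\<in>E (ginv G g). \<forall>y\<in>E (ginv G g).
           \<beta> g (x \<oplus>\<^bsub>R\<^esub> y) = \<beta> g x \<oplus>\<^bsub>R\<^esub> \<beta> g y \<and> \<beta> g (x \<otimes>\<^bsub>R\<^esub> y) = \<beta> g x \<otimes>\<^bsub>R\<^esub> \<beta> g y) \<and>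
        (\<forall>k\<in>carrier K. \<forall>x\<in>E (ginv G g). \<beta> g (k \<odot>\<^bsub>R\<^esub> x) = k \<odot>\<^bsub>R\<^esub> \<beta> g x)) \<and>
     (\<forall>e\<in>idents G. \<forall>x\<in>E e. \<beta> e x = x) \<and>
     (\<forall>g\<in>arr G. \<forall>h\<in>arr G. gdom G g = grng G h \<longrightarrow>
        (\<forall>x\<in>E (ginv G h). \<beta> g (\<beta> h x) = \<beta> (gmult G g h) x))"

text \<open>\<open>u e\<close> is the identity \<open>1\<^sub>e\<close> of \<open>E e\<close>; below \<open>1\<^sub>g = 1\<^sub>r\<^sub>(\<^sub>g\<^sub>)\<close> is always written
  \<open>u (grng G g)\<close>, so only the values of \<open>u\<close> at identities of \<open>G\<close> matter.\<close>

definition has_identity :: "('k, 'r) module \<Rightarrow> 'r set \<Rightarrow> 'r \<Rightarrow> bool" where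
  "has_identity R I u \<longleftrightarrow> u \<in> I \<and> (\<forall>x\<in>I. u \<otimes>\<^bsub>R\<^esub> x = x)"

definition is_direct_sum :: "'g groupoid \<Rightarrow> ('k, 'r) module \<Rightarrow> ('g \<Rightarrow> 'r set) \<Rightarrow> bool" where
  "is_direct_sum G R E \<longleftrightarrow>
     (\<forall>x\<in>carrier R. \<exists>!c. c \<in> Pi\<^sub>E (idents G) E \<and> x = (\<Oplus>\<^bsub>R\<^esub>e\<in>idents G. c e))"

definition invariants ::
  "'g groupoid \<Rightarrow> ('k, 'r) module \<Rightarrow> ('g \<Rightarrow> 'r) \<Rightarrow> ('g \<Rightarrow> 'r \<Rightarrow> 'r) \<Rightarrow> 'r set"
where
  "invariants G R u \<beta> = {r \<in> carrier R. \<forall>g\<in>arr G.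
     \<beta> g (r \<otimes>\<^bsub>R\<^esub> u (grng G (ginv G g))) = r \<otimes>\<^bsub>R\<^esub> u (grng G g)}"

definition has_galois_coordinates ::
  "'g groupoid \<Rightarrow> ('k, 'r) module \<Rightarrow> ('g \<Rightarrow> 'r) \<Rightarrow> ('g \<Rightarrow> 'r \<Rightarrow> 'r) \<Rightarrow> bool"
where
  "has_galois_coordinates G R u \<beta> \<longleftrightarrow>
     (\<exists>(m :: nat) x y. x \<in> {..<m} \<rightarrow> carrier R \<and> y \<in> {..<m} \<rightarrow> carrier R \<and>
        (\<forall>g\<in>arr G. (\<Oplus>\<^bsub>R\<^esub>i\<in>{..<m}. x i \<otimes>\<^bsub>R\<^esub> \<beta> g (y i \<otimes>\<^bsub>R\<^esub> u (grng G (ginv G g)))) =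
           (if g \<in> idents G then u (grng G g) else \<zero>\<^bsub>R\<^esub>)))"


section \<open>The algebra \<open>A(X)\<close>\<close>

definition Map_set :: "'g groupoid \<Rightarrow> ('k, 'r) module \<Rightarrow> ('g \<Rightarrow> 'r set) \<Rightarrow> ('g, 'x) gset \<Rightarrow> ('x \<Rightarrow> 'r) set"
where
  "Map_set G R E X = {f \<in> gcar X \<rightarrow>\<^sub>E carrier R. \<forall>g\<in>arr G. f ` gsub X g \<subseteq> E g}"

text \<open>The identity of \<open>A(X)\<close> is that of \<open>Map(X,R)\<close>: it takes the value \<open>1\<^sub>e\<close> on \<open>X\<^sub>e\<close>.\<close>

definition A_alg ::
  "'g groupoid \<Rightarrow> ('k, 'r) module \<Rightarrow> ('g \<Rightarrow> 'r set) \<Rightarrow> ('g \<Rightarrow> 'r) \<Rightarrow> ('g \<Rightarrow> 'r \<Rightarrow> 'r) \<Rightarrow>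
   ('g, 'x) gset \<Rightarrow> ('k, 'x \<Rightarrow> 'r) module"
where
  "A_alg G R E u \<beta> X =
     \<lparr>carrier = {f \<in> Map_set G R E X.
        \<forall>g\<in>arr G. \<forall>x\<in>gsub X (ginv G g). \<beta> g (f x) = f (gact X g x)},
      monoid.mult = (\<lambda>f h. \<lambda>x\<in>gcar X. f x \<otimes>\<^bsub>R\<^esub> h x),
      one = (\<lambda>x\<in>gcar X. u (THE e. e \<in> idents G \<and> x \<in> gsub X e)),
      zero = (\<lambda>x\<in>gcar X. \<zero>\<^bsub>R\<^esub>),
      add = (\<lambda>f h. \<lambda>x\<in>gcar X. f x \<oplus>\<^bsub>R\<^esub> h x),
      smult = (\<lambda>k f. \<lambda>x\<in>gcar X. k \<odot>\<^bsub>R\<^esub> f x)\<rparr>"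


section \<open>Split algebras\<close>

text \<open>\<open>V(B)\<close> for a family \<open>V e\<close> of homomorphisms \<open>B \<rightarrow> E e\<close>. Tagging with \<open>e\<close> records the codomain
  and makes the union over \<open>e\<close> disjoint.\<close>

definition V_gset ::
  "'g groupoid \<Rightarrow> ('g \<Rightarrow> 'r \<Rightarrow> 'r) \<Rightarrow> ('k, 'b) module \<times> ('g \<Rightarrow> ('b \<Rightarrow> 'r) set) \<Rightarrow>
   ('g, 'g \<times> ('b \<Rightarrow> 'r)) gset"
where
  "V_gset G \<beta> = (\<lambda>(B, V).
     \<lparr>gcar = (SIGMA e:idents G. V e),
      gsub = (\<lambda>g. {grng G g} \<times> V (grng G g)),
      gact = (\<lambda>g (e, \<phi>). (grng G g, \<lambda>b\<in>carrier B. \<beta> g (\<phi> b)))\<rparr>)"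

text \<open>\<open>V\<close> is the family of sets \<open>V\<^sub>e(B) = {\<phi>\<^bsub>(e,i)\<^esub>}\<close> belonging to some choice of the isomorphisms
  \<open>\<phi>\<^sub>e\<close> in the definition of an \<open>R\<close>-split algebra.\<close>

definition is_splitting ::
  "'g groupoid \<Rightarrow> ('k, 'c) ring_scheme \<Rightarrow> ('k, 'r) module \<Rightarrow> ('g \<Rightarrow> 'r set) \<Rightarrow> ('g \<Rightarrow> 'r) \<Rightarrow>
   ('g \<Rightarrow> 'r \<Rightarrow> 'r) \<Rightarrow> ('k, 'b) module \<Rightarrow> ('g \<Rightarrow> ('b \<Rightarrow> 'r) set) \<Rightarrow> bool"
where
  "is_splitting G K R E u \<beta> B V \<longleftrightarrow>
     V \<in> extensional (idents G) \<and>
     (\<exists>m\<ge>1. \<exists>\<phi>.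
        (\<forall>e\<in>idents G.
           \<phi> e \<in> alg_iso (ideal_algebra R (E e) (u e))
                    (tensor_algebra K (ideal_algebra R (E e) (u e)) B)
                    (power_algebra (ideal_algebra R (E e) (u e)) m) \<and>
           V e = (\<lambda>i. \<lambda>b\<in>carrier B.
                    \<phi> e (tensor_class K (ideal_algebra R (E e) (u e)) B [(u e, b)]) i) ` {..<m})) \<and>
     is_gset G (V_gset G \<beta> (B, V))"

text \<open>Morphisms of split algebras. The \<open>G\<close>-set \<open>V(B)\<close> depends on the chosen splitting of \<open>B\<close>, and
  precomposition with a homomorphism \<open>f : B \<rightarrow> B'\<close> need not send \<open>V(B')\<close> into \<open>V(B)\<close> when some \<open>E e\<close>
  has nontrivial idempotents; \<open>V\<close> is a functor exactly on the homomorphisms for which it does. For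
  example, let the group of order 2 swap the factors of \<open>R = K \<times> K\<close>, with \<open>K\<close> a field. Then the
  regular \<open>G\<close>-set and the trivial \<open>G\<close>-set with 2 points have isomorphic algebras \<open>A(X)\<close>, both being
  \<open>K \<times> K\<close>, so no equivalence can exist if all algebra homomorphisms are admitted. If every \<open>E e\<close> has
  only trivial idempotents, the condition on \<open>V\<close> below is automatic.\<close>

definition split_homs ::
  "'g groupoid \<Rightarrow> ('k, 'c) ring_scheme \<Rightarrow>
   ('k, 'a) module \<times> ('g \<Rightarrow> ('a \<Rightarrow> 'r) set) \<Rightarrow> ('k, 'b) module \<times> ('g \<Rightarrow> ('b \<Rightarrow> 'r) set) \<Rightarrow>
   ('a \<Rightarrow> 'b) set"
where
  "split_homs G K = (\<lambda>(B, V) (B', V').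
     {f \<in> alg_hom K B B'. f \<in> extensional (carrier B) \<and>
        (\<forall>e\<in>idents G. \<forall>\<phi>\<in>V' e. compose (carrier B) \<phi> f \<in> V e)})"

definition split_iso ::
  "'g groupoid \<Rightarrow> ('k, 'c) ring_scheme \<Rightarrow>
   ('k, 'a) module \<times> ('g \<Rightarrow> ('a \<Rightarrow> 'r) set) \<Rightarrow> ('k, 'b) module \<times> ('g \<Rightarrow> ('b \<Rightarrow> 'r) set) \<Rightarrow>
   ('a \<Rightarrow> 'b) \<Rightarrow> bool"
where
  "split_iso G K P Q f \<longleftrightarrow> f \<in> split_homs G K P Q \<and>
     (\<exists>h\<in>split_homs G K Q P.
        (\<forall>b\<in>carrier (fst P). h (f b) = b) \<and> (\<forall>c\<in>carrier (fst Q). f (h c) = c))"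


section \<open>Categories\<close>

text \<open>\<open>Comp C X Y Z g f\<close> is the composite of \<open>f : X \<rightarrow> Y\<close> and \<open>g : Y \<rightarrow> Z\<close>.\<close>

record ('o, 'm) cat =
  Ob :: "'o set"
  Hom :: "'o \<Rightarrow> 'o \<Rightarrow> 'm set"
  Ide :: "'o \<Rightarrow> 'm"
  Comp :: "'o \<Rightarrow> 'o \<Rightarrow> 'o \<Rightarrow> 'm \<Rightarrow> 'm \<Rightarrow> 'm"

definition is_category :: "('o, 'm) cat \<Rightarrow> bool" where
  "is_category C \<longleftrightarrow>
     (\<forall>X\<in>Ob C. Ide C X \<in> Hom C X X) \<and>
     (\<forall>X\<in>Ob C. \<forall>Y\<in>Ob C. \<forall>Z\<in>Ob C. \<forall>f\<in>Hom C X Y. \<forall>g\<in>Hom C Y Z. Comp C X Y Z g f \<in> Hom C X Z) \<and>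
     (\<forall>X\<in>Ob C. \<forall>Y\<in>Ob C. \<forall>f\<in>Hom C X Y.
        Comp C X X Y f (Ide C X) = f \<and> Comp C X Y Y (Ide C Y) f = f) \<and>
     (\<forall>W\<in>Ob C. \<forall>X\<in>Ob C. \<forall>Y\<in>Ob C. \<forall>Z\<in>Ob C. \<forall>f\<in>Hom C W X. \<forall>g\<in>Hom C X Y. \<forall>h\<in>Hom C Y Z.
        Comp C W Y Z h (Comp C W X Y g f) = Comp C W X Z (Comp C X Y Z h g) f)"

definition isomorphic :: "('o, 'm) cat \<Rightarrow> 'o \<Rightarrow> 'o \<Rightarrow> bool" where
  "isomorphic C X Y \<longleftrightarrow> (\<exists>f\<in>Hom C X Y. \<exists>g\<in>Hom C Y X.
     Comp C X Y X g f = Ide C X \<and> Comp C Y X Y f g = Ide C Y)"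

definition contravariant_functor ::
  "('o, 'm) cat \<Rightarrow> ('p, 'n) cat \<Rightarrow> ('o \<Rightarrow> 'p) \<Rightarrow> ('o \<Rightarrow> 'o \<Rightarrow> 'm \<Rightarrow> 'n) \<Rightarrow> bool"
where
  "contravariant_functor C D F T \<longleftrightarrow>
     is_category C \<and> is_category D \<and>
     (\<forall>X\<in>Ob C. F X \<in> Ob D \<and> T X X (Ide C X) = Ide D (F X)) \<and>
     (\<forall>X\<in>Ob C. \<forall>Y\<in>Ob C. \<forall>f\<in>Hom C X Y. T X Y f \<in> Hom D (F Y) (F X)) \<and>
     (\<forall>X\<in>Ob C. \<forall>Y\<in>Ob C. \<forall>Z\<in>Ob C. \<forall>f\<in>Hom C X Y. \<forall>g\<in>Hom C Y Z.
        T X Z (Comp C X Y Z g f) = Comp D (F Z) (F Y) (F X) (T X Y f) (T Y Z g))"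

definition contravariant_equivalence ::
  "('o, 'm) cat \<Rightarrow> ('p, 'n) cat \<Rightarrow> ('o \<Rightarrow> 'p) \<Rightarrow> ('o \<Rightarrow> 'o \<Rightarrow> 'm \<Rightarrow> 'n) \<Rightarrow> bool"
where
  "contravariant_equivalence C D F T \<longleftrightarrow>
     contravariant_functor C D F T \<and>
     (\<forall>X\<in>Ob C. \<forall>Y\<in>Ob C. bij_betw (T X Y) (Hom C X Y) (Hom D (F Y) (F X))) \<and>
     (\<forall>Z\<in>Ob D. \<exists>X\<in>Ob C. isomorphic D (F X) Z)"

definition fin_split_gsets :: "'g groupoid \<Rightarrow> (('g, 'x) gset, 'x \<Rightarrow> 'x) cat" where
  "fin_split_gsets G =
     \<lparr>Ob = {X. is_gset G X \<and> is_split G X \<and> finite (gcar X)},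
      Hom = gmaps G,
      Ide = (\<lambda>X. \<lambda>x\<in>gcar X. x),
      Comp = (\<lambda>X Y Z g f. compose (gcar X) g f)\<rparr>"

definition split_algebras ::
  "'g groupoid \<Rightarrow> ('k, 'c) ring_scheme \<Rightarrow> ('k, 'r) module \<Rightarrow> ('g \<Rightarrow> 'r set) \<Rightarrow> ('g \<Rightarrow> 'r) \<Rightarrow>
   ('g \<Rightarrow> 'r \<Rightarrow> 'r) \<Rightarrow> (('k, 'b) module \<times> ('g \<Rightarrow> ('b \<Rightarrow> 'r) set), 'b \<Rightarrow> 'b) cat"
where
  "split_algebras G K R E u \<beta> =
     \<lparr>Ob = {(B, V). algebra K B \<and> is_splitting G K R E u \<beta> B V},
      Hom = split_homs G K,
      Ide = (\<lambda>(B, V). \<lambda>b\<in>carrier B. b),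
      Comp = (\<lambda>P Q S g f. compose (carrier (fst P)) g f)\<rparr>"

text \<open>\<open>\<theta>(X)\<close> is \<open>A(X)\<close> with the splitting given by evaluation at the points of \<open>X\<close>.\<close>

definition theta ::
  "'g groupoid \<Rightarrow> ('k, 'r) module \<Rightarrow> ('g \<Rightarrow> 'r set) \<Rightarrow> ('g \<Rightarrow> 'r) \<Rightarrow> ('g \<Rightarrow> 'r \<Rightarrow> 'r) \<Rightarrow>
   ('g, 'x) gset \<Rightarrow> ('k, 'x \<Rightarrow> 'r) module \<times> ('g \<Rightarrow> (('x \<Rightarrow> 'r) \<Rightarrow> 'r) set)"
where
  "theta G R E u \<beta> X =
     (A_alg G R E u \<beta> X,
      \<lambda>e\<in>idents G. (\<lambda>x. \<lambda>f\<in>carrier (A_alg G R E u \<beta> X). f x) ` gsub X e)"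

definition theta_map ::
  "'g groupoid \<Rightarrow> ('k, 'r) module \<Rightarrow> ('g \<Rightarrow> 'r set) \<Rightarrow> ('g \<Rightarrow> 'r) \<Rightarrow> ('g \<Rightarrow> 'r \<Rightarrow> 'r) \<Rightarrow>
   ('g, 'x) gset \<Rightarrow> ('g, 'y) gset \<Rightarrow> ('x \<Rightarrow> 'y) \<Rightarrow> ('y \<Rightarrow> 'r) \<Rightarrow> ('x \<Rightarrow> 'r)"
where
  "theta_map G R E u \<beta> X Y h = (\<lambda>f\<in>carrier (A_alg G R E u \<beta> Y). compose (gcar X) f h)"

definition theta'_map ::
  "'g groupoid \<Rightarrow>
   ('k, 'a) module \<times> ('g \<Rightarrow> ('a \<Rightarrow> 'r) set) \<Rightarrow> ('k, 'b) module \<times> ('g \<Rightarrow> ('b \<Rightarrow> 'r) set) \<Rightarrow>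
   ('a \<Rightarrow> 'b) \<Rightarrow> 'g \<times> ('b \<Rightarrow> 'r) \<Rightarrow> 'g \<times> ('a \<Rightarrow> 'r)"
where
  "theta'_map G = (\<lambda>(B, V) (B', V') f.
     \<lambda>(e, \<phi>)\<in>(SIGMA e:idents G. V' e). (e, compose (carrier B) \<phi> f))"

end

theory Submission
  imports Defs
begin

text \<open>Descent along the trace. Since each \<open>E\<^sub>e\<close> is faithful over \<open>K = R\<^sup>\<beta>\<close>, the groupoid is connected, and
  everything can be computed at one object \<open>e\<close>. The Galois coordinates restrict to
  \<open>v\<^sub>i, w\<^sub>i \<in> E\<^sub>e\<close> with \<open>\<Sum>\<^sub>i v\<^sub>i \<beta>\<^sub>g(w\<^sub>i) = \<delta>\<^sub>g\<^sub>,\<^sub>e 1\<^sub>e\<close> for the loops \<open>g\<close> at \<open>e\<close>, and the sums over arrows out of \<open>e\<close> give a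
  trace \<open>E\<^sub>e \<rightarrow> K\<close>, which is surjective by the determinant trick. Averaging \<open>w\<^sub>i F\<close> over \<open>G\<close> inverts
  \<open>E\<^sub>e \<otimes> A(X) \<rightarrow> Map(X\<^sub>e, E\<^sub>e)\<close>, so \<open>A(X)\<close> is split by the points of \<open>X\<close>; conversely, an element of trace 1
  shows that \<open>B \<rightarrow> A(V(B))\<close> is bijective.\<close>

section \<open>Finite sums and the determinant trick\<close>

text \<open>The coordinates act through two identities. Orthogonality isolates the term of the loop
  \<open>e\<close> in a sum over loops, so the value of a function at a single point can be
  recovered from averages. Applied to the translates of one element \<open>a\<close> it says that
  the sum of the \<open>trace e (w i \<otimes> a) \<odot> v i\<close> is \<open>a\<close>: the
  \<open>v i\<close> and these functionals form a finite dual basis of \<open>E e\<close> over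
  \<open>K\<close>. The dual basis provides the second composite when the evaluation map is
  inverted, and it shows that \<open>E e\<close> is generated with coefficients in the image of the
  trace, which is the situation of the determinant trick. The obstacle is that a split algebra is
  given by chosen isomorphisms out of a quotient of lists. Each isomorphism is traded for the finite
  set of its coordinate homomorphisms, with the condition that joint evaluation along this set is
  injective modulo the congruence and surjective onto families in \<open>E e\<close>. Elsewhere
  equality of tensors is proved by explicit congruences of lists or read off from
  evaluations.\<close>

lemma (in abelian_monoid) finsum_swap:
  assumes "finite A" "finite B" "\<And>i j. i \<in> A \<Longrightarrow> j \<in> B \<Longrightarrow> f i j \<in> carrier G"
  shows "(\<Oplus>i\<in>A. \<Oplus>j\<in>B. f i j) = (\<Oplus>j\<in>B. \<Oplus>i\<in>A. f i j)"
  using assms(1,3)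
proof (induction A)
  case empty
  then show ?case by (simp add: finsum_zero)
next
  case (insert a A)
  have "(\<Oplus>j\<in>B. \<Oplus>i\<in>insert a A. f i j) = (\<Oplus>j\<in>B. f a j \<oplus> (\<Oplus>i\<in>A. f i j))"
    using insert by (intro finsum_cong') (auto intro!: finsum_insert finsum_closed)
  also have "\<dots> = (\<Oplus>j\<in>B. f a j) \<oplus> (\<Oplus>j\<in>B. \<Oplus>i\<in>A. f i j)"
    using insert by (intro finsum_addf) (auto intro!: finsum_closed)
  also have "\<dots> = (\<Oplus>i\<in>insert a A. \<Oplus>j\<in>B. f i j)"
    using insert by (subst finsum_insert) (auto intro!: finsum_closed)
  finally show ?case by simp
qed

lemma (in abelian_monoid) finsum_mem:
  assumes "finite A" "S \<subseteq> carrier G" "\<zero> \<in> S" "\<And>x y. x \<in> S \<Longrightarrow> y \<in> S \<Longrightarrow> x \<oplus> y \<in> S"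
    and "\<And>i. i \<in> A \<Longrightarrow> f i \<in> S"
  shows "(\<Oplus>i\<in>A. f i) \<in> S"
  using assms(1,5)
proof (induction A)
  case (insert a A)
  then have "f a \<in> S" "(\<Oplus>i\<in>A. f i) \<in> S" by auto
  then show ?case using insert assms(2,4) by (subst finsum_insert) auto
qed (use assms in simp)

text \<open>Additivity is asked for on a subset \<open>S\<close> only, because
  \<open>\<beta> g\<close> is a homomorphism on an ideal and not on all of \<open>R\<close>. With
  \<open>h = id\<close> the lemma also moves sums from an ideal, regarded as an algebra of its own,
  to \<open>R\<close>.\<close>

lemma (in abelian_monoid) finsum_additive:
  assumes "finite A" "S \<subseteq> carrier G" "\<zero> \<in> S" "\<And>x y. x \<in> S \<Longrightarrow> y \<in> S \<Longrightarrow> x \<oplus> y \<in> S"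
    and "abelian_monoid H" "\<And>x. x \<in> S \<Longrightarrow> h x \<in> carrier H" "h \<zero> = \<zero>\<^bsub>H\<^esub>"
    and "\<And>x y. x \<in> S \<Longrightarrow> y \<in> S \<Longrightarrow> h (x \<oplus> y) = h x \<oplus>\<^bsub>H\<^esub> h y"
    and "\<And>i. i \<in> A \<Longrightarrow> f i \<in> S"
  shows "h (\<Oplus>i\<in>A. f i) = (\<Oplus>\<^bsub>H\<^esub>i\<in>A. h (f i))"
  using assms(1,9)
proof (induction A)
  case empty
  interpret H: abelian_monoid H by fact
  show ?case using assms by simp
next
  case (insert a A)
  interpret H: abelian_monoid H by fact
  have "(\<Oplus>i\<in>A. f i) \<in> S" using insert assms by (intro finsum_mem) auto
  then show ?case using insert assms(2,6,8)
    by (subst finsum_insert, blast, blast, blast, blast)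
      (subst H.finsum_insert, auto)
qed

text \<open>The determinant trick, with generators eliminated one at a time: if \<open>q M\<close> is contained in
  \<open>I v\<^sub>0 + \<dots> + I v\<^sub>j\<close> with \<open>q \<equiv> 1\<close> modulo \<open>I\<close>, then \<open>q v\<^sub>j = \<Sum> c\<^sub>i v\<^sub>i\<close> shows that
  \<open>(q - c\<^sub>j) q M\<close> is contained in \<open>I v\<^sub>0 + \<dots> + I v\<^sub>j\<^sub>-\<^sub>1\<close>.\<close>

lemma (in module) ideal_mult_eq_imp_fixes:
  fixes n :: nat
  assumes I: "ideal I R" and v: "v \<in> {..<n} \<rightarrow> carrier M"
    and gen: "\<And>x. x \<in> carrier M \<Longrightarrow> \<exists>c\<in>{..<n} \<rightarrow> I. x = (\<Oplus>\<^bsub>M\<^esub>i\<in>{..<n}. c i \<odot>\<^bsub>M\<^esub> v i)"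
  shows "\<exists>k\<in>I. \<forall>x\<in>carrier M. k \<odot>\<^bsub>M\<^esub> x = x"
proof -
  interpret I: ideal I R by fact
  note [simp] = I.a_Hcarr
  let ?P = "\<lambda>j. \<exists>q\<in>carrier R. \<one> \<ominus> q \<in> I \<and>
    (\<forall>x\<in>carrier M. \<exists>c\<in>{..<j} \<rightarrow> I. q \<odot>\<^bsub>M\<^esub> x = (\<Oplus>\<^bsub>M\<^esub>i\<in>{..<j}. c i \<odot>\<^bsub>M\<^esub> v i))"
  have "?P 0"
  proof (rule inc_induct[of 0 n ?P])
    have "\<one> \<ominus> \<one> \<in> I" by (simp add: R.minus_eq R.r_neg)
    then show "?P n" using gen by (intro bexI[of _ \<one>]) auto
  next
    fix j assume j: "j < n" and "?P (Suc j)"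
    then obtain q where q: "q \<in> carrier R" "\<one> \<ominus> q \<in> I"
      "\<And>x. x \<in> carrier M \<Longrightarrow> \<exists>c\<in>{..<Suc j} \<rightarrow> I. q \<odot>\<^bsub>M\<^esub> x = (\<Oplus>\<^bsub>M\<^esub>i\<in>{..<Suc j}. c i \<odot>\<^bsub>M\<^esub> v i)"
      by blast
    have vc: "v i \<in> carrier M" if "i < Suc j" for i using v j that by auto
    have split: "(\<Oplus>\<^bsub>M\<^esub>i\<in>{..<Suc j}. c i \<odot>\<^bsub>M\<^esub> v i)
        = c j \<odot>\<^bsub>M\<^esub> v j \<oplus>\<^bsub>M\<^esub> (\<Oplus>\<^bsub>M\<^esub>i\<in>{..<j}. c i \<odot>\<^bsub>M\<^esub> v i)" if "c \<in> {..<Suc j} \<rightarrow> I" for c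
      unfolding lessThan_Suc using that vc
      by (subst M.finsum_insert) (auto simp: Pi_def)
    obtain c where c: "c \<in> {..<Suc j} \<rightarrow> I"
      and cv: "q \<odot>\<^bsub>M\<^esub> v j = (\<Oplus>\<^bsub>M\<^esub>i\<in>{..<Suc j}. c i \<odot>\<^bsub>M\<^esub> v i)"
      using q(3)[of "v j"] vc by auto
    have cI: "c i \<in> I" if "i < Suc j" for i using c that by auto
    define r where "r = q \<ominus> c j"
    have r: "r \<in> carrier R" using q cI by (simp add: r_def)
    have sum: "(\<Oplus>\<^bsub>M\<^esub>i\<in>{..<j}. d i \<odot>\<^bsub>M\<^esub> v i) \<in> carrier M" if "d \<in> {..<j} \<rightarrow> I" for d
    proof (intro M.finsum_closed Pi_I smult_closed vc I.a_Hcarr)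
      show "d i \<in> I" if "i \<in> {..<j}" for i using \<open>d \<in> {..<j} \<rightarrow> I\<close> that by blast
    qed auto
    have rv: "r \<odot>\<^bsub>M\<^esub> v j = (\<Oplus>\<^bsub>M\<^esub>i\<in>{..<j}. c i \<odot>\<^bsub>M\<^esub> v i)"
    proof -
      let ?s = "\<Oplus>\<^bsub>M\<^esub>i\<in>{..<j}. c i \<odot>\<^bsub>M\<^esub> v i"
      have s: "?s \<in> carrier M" using c by (intro sum) auto
      have "r \<odot>\<^bsub>M\<^esub> v j = q \<odot>\<^bsub>M\<^esub> v j \<oplus>\<^bsub>M\<^esub> \<ominus>\<^bsub>M\<^esub> (c j \<odot>\<^bsub>M\<^esub> v j)"
        using q cI vc by (simp add: r_def R.minus_eq smult_l_distr smult_l_minus)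
      also have "\<dots> = (?s \<oplus>\<^bsub>M\<^esub> c j \<odot>\<^bsub>M\<^esub> v j) \<oplus>\<^bsub>M\<^esub> \<ominus>\<^bsub>M\<^esub> (c j \<odot>\<^bsub>M\<^esub> v j)"
        using s cI vc unfolding cv split[OF c] by (simp add: M.a_comm)
      also have "\<dots> = ?s" using s cI vc by (simp add: M.a_assoc M.r_neg)
      finally show ?thesis .
    qed
    have "r \<otimes> q \<in> carrier R" using q r by simp
    moreover have "\<one> \<ominus> r \<otimes> q \<in> I"
    proof -
      have "\<one> \<ominus> r \<otimes> q = (\<one> \<ominus> q) \<oplus> q \<otimes> (\<one> \<ominus> q) \<oplus> c j \<otimes> q"
        using q(1) I.a_Hcarr[OF cI[OF lessI]] unfolding r_def by algebra
      then show ?thesis using q cI by (simp add: I.I_l_closed I.I_r_closed)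
    qed
    moreover have "\<exists>d\<in>{..<j} \<rightarrow> I. (r \<otimes> q) \<odot>\<^bsub>M\<^esub> x = (\<Oplus>\<^bsub>M\<^esub>i\<in>{..<j}. d i \<odot>\<^bsub>M\<^esub> v i)"
      if x: "x \<in> carrier M" for x
    proof -
      obtain d where d: "d \<in> {..<Suc j} \<rightarrow> I"
        and dx: "q \<odot>\<^bsub>M\<^esub> x = (\<Oplus>\<^bsub>M\<^esub>i\<in>{..<Suc j}. d i \<odot>\<^bsub>M\<^esub> v i)" using q(3)[OF x] by blast
      have dI: "d i \<in> I" if "i < Suc j" for i using d that by auto
      let ?e = "\<lambda>i. d j \<otimes> c i \<oplus> r \<otimes> d i"
      have "(r \<otimes> q) \<odot>\<^bsub>M\<^esub> x = r \<odot>\<^bsub>M\<^esub> (d j \<odot>\<^bsub>M\<^esub> v j \<oplus>\<^bsub>M\<^esub> (\<Oplus>\<^bsub>M\<^esub>i\<in>{..<j}. d i \<odot>\<^bsub>M\<^esub> v i))"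
        using r q x by (simp add: smult_assoc1 dx split[OF d])
      also have "\<dots> = d j \<odot>\<^bsub>M\<^esub> (r \<odot>\<^bsub>M\<^esub> v j) \<oplus>\<^bsub>M\<^esub> r \<odot>\<^bsub>M\<^esub> (\<Oplus>\<^bsub>M\<^esub>i\<in>{..<j}. d i \<odot>\<^bsub>M\<^esub> v i)"
        using r vc dI sum[of d] d by (simp add: smult_r_distr R.m_comm flip: smult_assoc1)
      also have "\<dots> = (\<Oplus>\<^bsub>M\<^esub>i\<in>{..<j}. d j \<odot>\<^bsub>M\<^esub> (c i \<odot>\<^bsub>M\<^esub> v i))
          \<oplus>\<^bsub>M\<^esub> (\<Oplus>\<^bsub>M\<^esub>i\<in>{..<j}. r \<odot>\<^bsub>M\<^esub> (d i \<odot>\<^bsub>M\<^esub> v i))"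
        unfolding rv using r vc dI cI
        by (intro arg_cong2[where f = "add M"] finsum_smult_ldistr) auto
      also have "\<dots> = (\<Oplus>\<^bsub>M\<^esub>i\<in>{..<j}. d j \<odot>\<^bsub>M\<^esub> (c i \<odot>\<^bsub>M\<^esub> v i) \<oplus>\<^bsub>M\<^esub> r \<odot>\<^bsub>M\<^esub> (d i \<odot>\<^bsub>M\<^esub> v i))"
        using r vc dI cI by (intro M.finsum_addf[symmetric]) auto
      also have "\<dots> = (\<Oplus>\<^bsub>M\<^esub>i\<in>{..<j}. ?e i \<odot>\<^bsub>M\<^esub> v i)"
        using r vc dI cI by (intro M.finsum_cong') (auto simp: smult_l_distr smult_assoc1)
      finally show ?thesis using dI cI r
        by (intro bexI[of _ ?e]) (auto simp: I.I_l_closed I.I_r_closed)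
    qed
    ultimately show "?P j" by blast
  qed auto
  \<comment> \<open>At 0 the sum is empty, so \<open>q\<close> annihilates the module, and the
    element \<open>\<one> \<ominus> q\<close> of \<open>I\<close> acts as the identity.\<close>
  then obtain q where q: "q \<in> carrier R" "\<one> \<ominus> q \<in> I" "\<And>x. x \<in> carrier M \<Longrightarrow> q \<odot>\<^bsub>M\<^esub> x = \<zero>\<^bsub>M\<^esub>"
    by auto
  have "(\<one> \<ominus> q) \<odot>\<^bsub>M\<^esub> x = x" if "x \<in> carrier M" for x
    using q that by (simp add: R.minus_eq smult_l_distr smult_l_minus)
  then show ?thesis using q(2) by blast
qed

lemma (in algebra) smult_assoc_right:
  assumes "a \<in> carrier R" "x \<in> carrier M" "y \<in> carrier M"
  shows "x \<otimes>\<^bsub>M\<^esub> (a \<odot>\<^bsub>M\<^esub> y) = a \<odot>\<^bsub>M\<^esub> (x \<otimes>\<^bsub>M\<^esub> y)"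
  using assms by (metis m_comm smult_assoc2 smult_closed)

section \<open>Tensor products of algebras\<close>

text \<open>The map out of the tensor product induced by \<open>h\<close>, kept on representing
  lists; that it descends to classes is \<open>tensor_lift_cong\<close>. It serves both for
  evaluation along a homomorphism and for applying the trace to the left factor.\<close>

definition tensor_lift :: "('m, 'e) ring_scheme \<Rightarrow> ('a \<Rightarrow> 'b \<Rightarrow> 'm) \<Rightarrow> ('a \<times> 'b) list \<Rightarrow> 'm" where
  "tensor_lift M h ps = foldr (\<lambda>(x, y) s. h x y \<oplus>\<^bsub>M\<^esub> s) ps \<zero>\<^bsub>M\<^esub>"

lemma tensor_lift_simps [simp]:
  "tensor_lift M h [] = \<zero>\<^bsub>M\<^esub>"
  "tensor_lift M h ((x, y) # ps) = h x y \<oplus>\<^bsub>M\<^esub> tensor_lift M h ps"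
  by (simp_all add: tensor_lift_def)

lemma alg_homI:
  assumes "\<And>x. x \<in> carrier A \<Longrightarrow> f x \<in> carrier B"
    and "\<And>x y. x \<in> carrier A \<Longrightarrow> y \<in> carrier A \<Longrightarrow> f (x \<otimes>\<^bsub>A\<^esub> y) = f x \<otimes>\<^bsub>B\<^esub> f y"
    and "\<And>x y. x \<in> carrier A \<Longrightarrow> y \<in> carrier A \<Longrightarrow> f (x \<oplus>\<^bsub>A\<^esub> y) = f x \<oplus>\<^bsub>B\<^esub> f y"
    and "f \<one>\<^bsub>A\<^esub> = \<one>\<^bsub>B\<^esub>"
    and "\<And>k x. k \<in> carrier K \<Longrightarrow> x \<in> carrier A \<Longrightarrow> f (k \<odot>\<^bsub>A\<^esub> x) = k \<odot>\<^bsub>B\<^esub> f x"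
  shows "f \<in> alg_hom K A B"
  using assms by (auto simp: alg_hom_def intro!: ring_hom_memI)

lemma alg_homD:
  assumes "f \<in> alg_hom K A B"
  shows "\<And>x. x \<in> carrier A \<Longrightarrow> f x \<in> carrier B"
    and "\<And>x y. x \<in> carrier A \<Longrightarrow> y \<in> carrier A \<Longrightarrow> f (x \<oplus>\<^bsub>A\<^esub> y) = f x \<oplus>\<^bsub>B\<^esub> f y"
    and "\<And>x y. x \<in> carrier A \<Longrightarrow> y \<in> carrier A \<Longrightarrow> f (x \<otimes>\<^bsub>A\<^esub> y) = f x \<otimes>\<^bsub>B\<^esub> f y"
    and "f \<one>\<^bsub>A\<^esub> = \<one>\<^bsub>B\<^esub>"
    and "\<And>k x. k \<in> carrier K \<Longrightarrow> x \<in> carrier A \<Longrightarrow> f (k \<odot>\<^bsub>A\<^esub> x) = k \<odot>\<^bsub>B\<^esub> f x"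
  using assms by (auto simp: alg_hom_def ring_hom_def)

lemma alg_hom_compose:
  assumes A: "algebra K A" and f: "f \<in> alg_hom K A B" and h: "h \<in> alg_hom K B C"
  shows "compose (carrier A) h f \<in> alg_hom K A C"
proof -
  interpret A: algebra K A by fact
  show ?thesis
    using alg_homD[OF f] alg_homD[OF h] by (intro alg_homI) (simp_all add: compose_eq)
qed

lemma alg_hom_inverse:
  assumes A: "algebra K A" and f: "f \<in> alg_hom K A B"
    and h: "\<And>y. y \<in> carrier B \<Longrightarrow> h y \<in> carrier A" "\<And>y. y \<in> carrier B \<Longrightarrow> f (h y) = y"
    "\<And>x. x \<in> carrier A \<Longrightarrow> h (f x) = x"
  shows "h \<in> alg_hom K B A"
proof -
  interpret A: algebra K A by fact
  note f' = alg_homD[OF f]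
  show ?thesis
  proof (rule alg_homI)
    show "h \<one>\<^bsub>B\<^esub> = \<one>\<^bsub>A\<^esub>" using h(3)[of "\<one>\<^bsub>A\<^esub>"] f'(4) by simp
    show "h (x \<otimes>\<^bsub>B\<^esub> y) = h x \<otimes>\<^bsub>A\<^esub> h y" if "x \<in> carrier B" "y \<in> carrier B" for x y
      using h(3)[of "h x \<otimes>\<^bsub>A\<^esub> h y"] f'(3)[of "h x" "h y"] h(1,2) that by simp
    show "h (x \<oplus>\<^bsub>B\<^esub> y) = h x \<oplus>\<^bsub>A\<^esub> h y" if "x \<in> carrier B" "y \<in> carrier B" for x y
      using h(3)[of "h x \<oplus>\<^bsub>A\<^esub> h y"] f'(2)[of "h x" "h y"] h(1,2) that by simp
    show "h (k \<odot>\<^bsub>B\<^esub> x) = k \<odot>\<^bsub>A\<^esub> h x" if "k \<in> carrier K" "x \<in> carrier B" for k x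
      using h(3)[of "k \<odot>\<^bsub>A\<^esub> h x"] f'(5)[of k "h x"] h(1,2) that by simp
  qed (rule h)
qed

lemma compose_id_left: "f \<in> extensional A \<Longrightarrow> f \<in> A \<rightarrow> B \<Longrightarrow> compose A (\<lambda>x\<in>B. x) f = f"
  by (rule extensionalityI[of _ A]) (auto simp: compose_def)

lemma compose_id_right: "f \<in> extensional A \<Longrightarrow> compose A f (\<lambda>x\<in>A. x) = f"
  by (rule extensionalityI[of _ A]) (auto simp: compose_def)

locale algebra_pair = K: cring K + E: cring E + B: cring B + KE: algebra K E + KB: algebra K B
  for K :: "('k, 'c) ring_scheme" and E :: "('k, 'a, 'd) module_scheme" (structure)
    and B :: "('k, 'b, 'e) module_scheme"
begin

abbreviation valid :: "('a \<times> 'b) list \<Rightarrow> bool" where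
  "valid ps \<equiv> set ps \<subseteq> carrier E \<times> carrier B"

abbreviation teq :: "('a \<times> 'b) list \<Rightarrow> ('a \<times> 'b) list \<Rightarrow> bool" (infix "\<approx>" 50) where
  "ps \<approx> qs \<equiv> tensor_eq K E B ps qs"

abbreviation cls :: "('a \<times> 'b) list \<Rightarrow> ('a \<times> 'b) list set" where
  "cls \<equiv> tensor_class K E B"

abbreviation tns :: "('a, ('a \<times> 'b) list set) module" where
  "tns \<equiv> tensor_algebra K E B"

section \<open>Multiplication of representing lists\<close>

definition times :: "('a \<times> 'b) list \<Rightarrow> ('a \<times> 'b) list \<Rightarrow> ('a \<times> 'b) list" where
  "times ps qs = [(x \<otimes> x', y \<otimes>\<^bsub>B\<^esub> y'). (x, y) \<leftarrow> ps, (x', y') \<leftarrow> qs]"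

lemma teq_valid:
  assumes "ps \<approx> qs" shows "valid ps \<and> valid qs"
  using assms by induction auto

lemma teq_map_append:
  assumes "\<And>q. q \<in> set qs \<Longrightarrow> [f q] \<approx> [g q, h q]"
  shows "map f qs \<approx> map g qs @ map h qs"
  using assms
proof (induction qs)
  case Nil
  show ?case by (auto intro: tensor_eq.refl)
next
  case (Cons q qs)
  have 1: "[f q] \<approx> [g q, h q]" and 2: "map f qs \<approx> map g qs @ map h qs"
    using Cons by auto
  have v: "valid [g q, h q]" "valid (map g qs)" "valid (map h qs)"
    using teq_valid[OF 1] teq_valid[OF 2] by auto
  have "[f q] @ map f qs \<approx> [g q, h q] @ (map g qs @ map h qs)"
    by (rule tensor_eq.append[OF 1 2])
  \<comment> \<open>\<open>h q\<close> has to move past \<open>map g qs\<close>; the relation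
    \<open>comm\<close> exchanges two whole lists, so it is applied to the middle block of a
    concatenation.\<close>
  moreover have "[g q] @ (([h q] @ map g qs) @ map h qs) \<approx> [g q] @ ((map g qs @ [h q]) @ map h qs)"
    using v by (intro tensor_eq.append tensor_eq.comm tensor_eq.refl) auto
  ultimately show ?case
    by (auto intro: tensor_eq.trans)
qed

lemma teq_map:
  assumes "\<And>q. q \<in> set qs \<Longrightarrow> [f q] \<approx> [g q]"
  shows "map f qs \<approx> map g qs"
  using assms
proof (induction qs)
  case Nil
  show ?case by (auto intro: tensor_eq.refl)
next
  case (Cons q qs)
  then show ?case using tensor_eq.append[of K E B "[f q]" "[g q]" "map f qs" "map g qs"] by auto
qed

lemma teq_map_Nil:
  assumes "\<And>q. q \<in> set qs \<Longrightarrow> [f q] \<approx> []"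
  shows "map f qs \<approx> []"
  using assms
proof (induction qs)
  case Nil
  show ?case by (auto intro: tensor_eq.refl)
next
  case (Cons q qs)
  then show ?case using tensor_eq.append[of K E B "[f q]" "[]" "map f qs" "[]"] by auto
qed

lemma times_Nil [simp]: "times [] qs = []"
  by (simp add: times_def)

lemma times_Cons: "times (p # ps) qs = times [p] qs @ times ps qs"
  by (simp add: times_def)

lemma times_append: "times (ps @ ps') qs = times ps qs @ times ps' qs"
  by (simp add: times_def)

lemma times_single: "times [(x, y)] qs = map (\<lambda>(x', y'). (x \<otimes> x', y \<otimes>\<^bsub>B\<^esub> y')) qs"
  by (simp add: times_def)

lemma times_valid: "valid ps \<Longrightarrow> valid qs \<Longrightarrow> valid (times ps qs)"
  unfolding times_def by (fastforce simp: subset_iff)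

text \<open>The products are enumerated along the first list. Splitting the first list is therefore
  an equality of lists, while splitting the second one reorders the products and holds only up to
  the congruence.\<close>

lemma times_Cons_right:
  assumes "valid ps" "valid [q]" "valid qs"
  shows "times ps (q # qs) \<approx> times ps [q] @ times ps qs"
  using assms(1)
proof (induction ps)
  case Nil
  show ?case by (auto intro: tensor_eq.refl)
next
  case (Cons p ps)
  have v: "valid (times [p] [q])" "valid (times [p] qs)" "valid (times ps [q])"
    "valid (times ps qs)" "valid (times [p] (q # qs))"
    using Cons.prems assms by (simp_all add: times_valid)
  have "times [p] (q # qs) = times [p] [q] @ times [p] qs"
    by (cases p) (simp add: times_single)
  moreover have "times [p] (q # qs) @ times ps (q # qs)
      \<approx> times [p] (q # qs) @ (times ps [q] @ times ps qs)"
    using Cons v by (intro tensor_eq.append tensor_eq.refl) auto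
  ultimately have *: "times [p] (q # qs) @ times ps (q # qs)
      \<approx> times [p] [q] @ (times [p] qs @ times ps [q]) @ times ps qs" by simp
  have "times [p] [q] @ (times [p] qs @ times ps [q]) @ times ps qs
      \<approx> times [p] [q] @ (times ps [q] @ times [p] qs) @ times ps qs"
    using v by (intro tensor_eq.append tensor_eq.comm tensor_eq.refl) auto
  then show ?case
    using * by (subst (1 2 3) times_Cons) (auto intro: tensor_eq.trans)
qed

text \<open>Through this lemma, compatibility with the congruence in the second argument follows
  from compatibility in the first.\<close>

lemma times_comm:
  assumes "valid ps" "valid qs"
  shows "times ps qs \<approx> times qs ps"
  using assms(1)
proof (induction ps)
  case Nil
  have "times qs [] = []" by (induction qs) (auto simp: times_def)
  then show ?case by (auto intro: tensor_eq.refl)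
next
  case (Cons p ps)
  have "valid [p]" "valid ps" using Cons.prems by auto
  have "times qs [p] = times [p] qs"
    using assms(2) \<open>valid [p]\<close>
  proof (induction qs)
    case (Cons q qs)
    then have "times qs [p] = times [p] qs" by simp
    with Cons show ?case
      by (subst times_Cons) (cases p, cases q, auto simp: times_single E.m_comm B.m_comm)
  qed (auto simp: times_def)
  then have "times qs (p # ps) \<approx> times [p] qs @ times qs ps"
    using times_Cons_right[of qs p ps] assms(2) Cons.prems by auto
  moreover have "times [p] qs @ times ps qs \<approx> times [p] qs @ times qs ps"
    using Cons times_valid[OF \<open>valid [p]\<close> assms(2)]
    by (intro tensor_eq.append tensor_eq.refl) auto
  ultimately show ?case
    by (subst times_Cons) (blast intro: tensor_eq.trans tensor_eq.sym)
qed

text \<open>Multiplying a defining relation by a single pure tensor gives a relation of the same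
  kind. For the two additivity relations the products with all of \<open>qs\<close> must then be
  regrouped, which is \<open>teq_map_append\<close>.\<close>

lemma times_cong_left:
  assumes "ps \<approx> ps'" "valid qs"
  shows "times ps qs \<approx> times ps' qs"
  using assms(1)
proof induction
  case (refl ps)
  then show ?case using assms(2) by (intro tensor_eq.refl times_valid)
next
  case (sym ps qs)
  then show ?case by (blast intro: tensor_eq.sym)
next
  case (trans ps qs rs)
  then show ?case by (blast intro: tensor_eq.trans)
next
  case (append ps ps' qs qs')
  then show ?case by (simp add: times_append tensor_eq.append)
next
  case (comm ps qs)
  then show ?case
    using assms(2) by (simp add: times_append tensor_eq.comm times_valid)
next
  case (zero y)
  then show ?case
    unfolding times_single times_Nil using assms(2)
    by (intro teq_map_Nil) (auto intro!: tensor_eq.zero dest!: subsetD[OF assms(2)])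
next
  case (add_left x x' y)
  have "times [(x, y), (x', y)] qs = times [(x, y)] qs @ times [(x', y)] qs"
    by (rule times_Cons)
  then show ?case
    using add_left assms(2) unfolding times_single
    by (auto intro!: teq_map_append tensor_eq.add_left simp: E.l_distr dest!: subsetD[OF assms(2)])
next
  case (add_right x y y')
  have "times [(x, y), (x, y')] qs = times [(x, y)] qs @ times [(x, y')] qs"
    by (rule times_Cons)
  then show ?case
    using add_right assms(2) unfolding times_single
    by (auto intro!: teq_map_append tensor_eq.add_right simp: B.l_distr dest!: subsetD[OF assms(2)])
next
  case (balanced k x y)
  then show ?case
    using assms(2) unfolding times_single
    by (auto intro!: teq_map tensor_eq.balanced simp: KE.smult_assoc2 KB.smult_assoc2
        dest!: subsetD[OF assms(2)])
qed

lemma times_cong: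
  assumes "ps \<approx> ps'" "qs \<approx> qs'"
  shows "times ps qs \<approx> times ps' qs'"
proof -
  have v: "valid ps" "valid ps'" "valid qs" "valid qs'"
    using teq_valid assms by blast+
  have "times ps qs \<approx> times ps' qs" by (rule times_cong_left[OF assms(1) v(3)])
  moreover have "times ps' qs \<approx> times qs ps'" "times qs' ps' \<approx> times ps' qs'"
    by (rule times_comm, (rule v)+)+
  moreover have "times qs ps' \<approx> times qs' ps'" by (rule times_cong_left[OF assms(2) v(2)])
  ultimately show ?thesis by (blast intro: tensor_eq.trans)
qed

lemma cls_eq_iff: "valid ps \<Longrightarrow> cls ps = cls qs \<longleftrightarrow> ps \<approx> qs"
  unfolding tensor_class_def by (blast intro: tensor_eq.refl tensor_eq.sym tensor_eq.trans)

lemma UN_cls: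
  assumes "valid ps" "\<And>qs. ps \<approx> qs \<Longrightarrow> f ps \<approx> f qs"
  shows "(\<Union>qs\<in>cls ps. cls (f qs)) = cls (f ps)"
proof -
  have "cls (f qs) = cls (f ps)" if "qs \<in> cls ps" for qs
    using assms(2)[of qs] that teq_valid unfolding tensor_class_def
    by (blast intro: tensor_eq.sym tensor_eq.trans)
  moreover have "ps \<in> cls ps" using assms(1) by (auto simp: tensor_class_def intro: tensor_eq.refl)
  ultimately show ?thesis by blast
qed

lemma tns_carrier: "carrier tns = cls ` {ps. valid ps}"
  by (simp add: tensor_algebra_def)

lemma tns_one: "\<one>\<^bsub>tns\<^esub> = cls [(\<one>, \<one>\<^bsub>B\<^esub>)]"
  by (simp add: tensor_algebra_def)

lemma UN_cls2:
  assumes "valid ps" "valid qs" "\<And>ps' qs'. ps \<approx> ps' \<Longrightarrow> qs \<approx> qs' \<Longrightarrow> f ps qs \<approx> f ps' qs'"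
  shows "(\<Union>ps'\<in>cls ps. \<Union>qs'\<in>cls qs. cls (f ps' qs')) = cls (f ps qs)"
proof -
  have "(\<Union>qs'\<in>cls qs. cls (f ps' qs')) = cls (f ps' qs)" if "ps' \<in> cls ps" for ps'
  proof (rule UN_cls[OF assms(2)])
    have *: "ps \<approx> ps'" using that by (simp add: tensor_class_def)
    have "f ps qs \<approx> f ps' qs" by (rule assms(3)[OF * tensor_eq.refl[OF assms(2)]])
    then show "f ps' qs \<approx> f ps' qs'" if "qs \<approx> qs'" for qs'
      using assms(3)[OF * that] by (blast intro: tensor_eq.sym tensor_eq.trans)
  qed
  moreover have "(\<Union>ps'\<in>cls ps. cls (f ps' qs)) = cls (f ps qs)"
    by (rule UN_cls[OF assms(1)]) (rule assms(3)[OF _ tensor_eq.refl[OF assms(2)]])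
  ultimately show ?thesis by auto
qed

lemma tns_add: "valid ps \<Longrightarrow> valid qs \<Longrightarrow> cls ps \<oplus>\<^bsub>tns\<^esub> cls qs = cls (ps @ qs)"
  by (simp add: tensor_algebra_def UN_cls2 tensor_eq.append)

lemma tns_mult: "valid ps \<Longrightarrow> valid qs \<Longrightarrow> cls ps \<otimes>\<^bsub>tns\<^esub> cls qs = cls (times ps qs)"
  by (simp add: tensor_algebra_def UN_cls2 times_cong flip: times_def)

text \<open>The scalar \<open>a\<close> acts as multiplication by the tensor of \<open>a\<close> and
  the identity of \<open>B\<close>, so that compatibility of the scalar action with the congruence
  is an instance of \<open>times_cong\<close>.\<close>

lemma smult_as_times:
  assumes "valid ps"
  shows "[(a \<otimes> x, y). (x, y) \<leftarrow> ps] = times [(a, \<one>\<^bsub>B\<^esub>)] ps"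
  using assms by (induction ps) (auto simp: times_single)

lemma tns_smult:
  assumes "a \<in> carrier E" "valid ps"
  shows "a \<odot>\<^bsub>tns\<^esub> cls ps = cls (times [(a, \<one>\<^bsub>B\<^esub>)] ps)"
proof -
  have "a \<odot>\<^bsub>tns\<^esub> cls ps = (\<Union>qs\<in>cls ps. cls ([(a \<otimes> x, y). (x, y) \<leftarrow> qs]))"
    by (simp add: tensor_algebra_def)
  also have "\<dots> = (\<Union>qs\<in>cls ps. cls (times [(a, \<one>\<^bsub>B\<^esub>)] qs))"
    using teq_valid by (intro SUP_cong) (auto simp: tensor_class_def smult_as_times)
  also have "\<dots> = cls (times [(a, \<one>\<^bsub>B\<^esub>)] ps)"
    using assms by (intro UN_cls) (auto intro!: times_cong intro: tensor_eq.refl)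
  finally show ?thesis .
qed

section \<open>Additive maps on the tensor product and evaluation along homomorphisms\<close>

lemma tensor_lift_closed:
  assumes "abelian_monoid M" "\<And>x y. x \<in> carrier E \<Longrightarrow> y \<in> carrier B \<Longrightarrow> h x y \<in> carrier M"
    "valid ps"
  shows "tensor_lift M h ps \<in> carrier M"
proof -
  interpret M: abelian_monoid M by fact
  show ?thesis using assms(3) by (induction ps) (auto simp: assms(2))
qed

lemma tensor_lift_append:
  assumes "abelian_monoid M" "\<And>x y. x \<in> carrier E \<Longrightarrow> y \<in> carrier B \<Longrightarrow> h x y \<in> carrier M"
    "valid ps" "valid qs"
  shows "tensor_lift M h (ps @ qs) = tensor_lift M h ps \<oplus>\<^bsub>M\<^esub> tensor_lift M h qs"
proof -
  interpret M: abelian_monoid M by fact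
  note cl = tensor_lift_closed[OF assms(1), of h, OF assms(2)]
  show ?thesis using assms(3)
    by (induction ps) (auto simp: assms(2,4) cl M.a_assoc)
qed

text \<open>The universal property, in the form of one check per defining relation. Vanishing at
  zero is a separate hypothesis because \<open>M\<close> is only a monoid, where it cannot be
  cancelled out of additivity.\<close>

lemma tensor_lift_cong:
  assumes M: "abelian_monoid M"
    and h: "\<And>x y. x \<in> carrier E \<Longrightarrow> y \<in> carrier B \<Longrightarrow> h x y \<in> carrier M"
    and z: "\<And>y. y \<in> carrier B \<Longrightarrow> h \<zero> y = \<zero>\<^bsub>M\<^esub>"
    and al: "\<And>x x' y. x \<in> carrier E \<Longrightarrow> x' \<in> carrier E \<Longrightarrow> y \<in> carrier B \<Longrightarrow>
      h (x \<oplus> x') y = h x y \<oplus>\<^bsub>M\<^esub> h x' y"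
    and ar: "\<And>x y y'. x \<in> carrier E \<Longrightarrow> y \<in> carrier B \<Longrightarrow> y' \<in> carrier B \<Longrightarrow>
      h x (y \<oplus>\<^bsub>B\<^esub> y') = h x y \<oplus>\<^bsub>M\<^esub> h x y'"
    and bal: "\<And>k x y. k \<in> carrier K \<Longrightarrow> x \<in> carrier E \<Longrightarrow> y \<in> carrier B \<Longrightarrow>
      h (k \<odot> x) y = h x (k \<odot>\<^bsub>B\<^esub> y)"
    and eq: "ps \<approx> qs"
  shows "tensor_lift M h ps = tensor_lift M h qs"
proof -
  interpret M: abelian_monoid M by fact
  note cl = tensor_lift_closed[OF M, of h, OF h]
  note app = tensor_lift_append[OF M, of h, OF h]
  show ?thesis using eq
  proof induction
    case (append ps ps' qs qs')
    then show ?case using teq_valid[OF append.hyps(1)] teq_valid[OF append.hyps(2)]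
      by (simp add: app)
  next
    case (comm ps qs)
    then show ?case by (simp add: app cl M.a_comm)
  qed (simp_all add: z al ar bal h)
qed

abbreviation ev :: "('b \<Rightarrow> 'a) \<Rightarrow> ('a \<times> 'b) list \<Rightarrow> 'a" where
  "ev \<phi> \<equiv> tensor_lift E (\<lambda>x y. x \<otimes> \<phi> y)"

lemmas hom_simps = alg_homD[where K = K and A = B and B = E]

lemma ev_closed: "\<phi> \<in> alg_hom K B E \<Longrightarrow> valid ps \<Longrightarrow> ev \<phi> ps \<in> carrier E"
  by (rule tensor_lift_closed) (auto simp: hom_simps E.abelian_monoid_axioms)

lemma ev_append: "\<phi> \<in> alg_hom K B E \<Longrightarrow> valid ps \<Longrightarrow> valid qs \<Longrightarrow>
    ev \<phi> (ps @ qs) = ev \<phi> ps \<oplus> ev \<phi> qs"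
  by (rule tensor_lift_append) (auto simp: hom_simps E.abelian_monoid_axioms)

lemma ev_cong: "\<phi> \<in> alg_hom K B E \<Longrightarrow> ps \<approx> qs \<Longrightarrow> ev \<phi> ps = ev \<phi> qs"
  by (rule tensor_lift_cong)
    (auto simp: hom_simps E.abelian_monoid_axioms E.l_distr E.r_distr KE.smult_assoc2
      KE.smult_assoc_right)

lemma ev_times:
  assumes \<phi>: "\<phi> \<in> alg_hom K B E" and v: "valid ps" "valid qs"
  shows "ev \<phi> (times ps qs) = ev \<phi> ps \<otimes> ev \<phi> qs"
  using v(1)
proof (induction ps)
  case Nil
  then show ?case using ev_closed[OF \<phi> v(2)] by simp
next
  case (Cons p ps)
  obtain x y where p: "p = (x, y)" "x \<in> carrier E" "y \<in> carrier B" using Cons.prems by (cases p) auto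
  have single: "ev \<phi> (times [(x, y)] qs) = (x \<otimes> \<phi> y) \<otimes> ev \<phi> qs"
    using v(2)
  proof (induction qs)
    case (Cons q qs)
    obtain x' y' where "q = (x', y')" "x' \<in> carrier E" "y' \<in> carrier B"
      using Cons.prems by (cases q) auto
    then show ?case using Cons p ev_closed[OF \<phi>, of qs] \<phi>
      by (simp add: times_single hom_simps E.r_distr E.m_ac)
  qed (use p \<phi> in \<open>auto simp: times_single hom_simps\<close>)
  have "valid (times [(x, y)] qs)" "valid (times ps qs)"
    using p v Cons.prems by (simp_all add: times_valid)
  then have "ev \<phi> (times (p # ps) qs) = (x \<otimes> \<phi> y) \<otimes> ev \<phi> qs \<oplus> ev \<phi> (times ps qs)"
    by (subst times_Cons) (simp add: p(1) ev_append[OF \<phi>] single)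
  then show ?case using Cons p v ev_closed[OF \<phi>] \<phi>
    by (simp add: E.l_distr hom_simps)
qed

lemma teq_map_sum:
  fixes n :: nat
  assumes "\<And>i. i < n \<Longrightarrow> p i \<in> carrier E" "b \<in> carrier B"
  shows "map (\<lambda>i. (p i, b)) [0..<n] \<approx> [(\<Oplus>i\<in>{..<n}. p i, b)]"
  using assms(1)
proof (induction n)
  case 0
  show ?case using tensor_eq.sym[OF tensor_eq.zero[OF assms(2), of K E]] by simp
next
  case (Suc n)
  let ?s = "\<Oplus>i\<in>{..<n}. p i"
  have s: "?s \<in> carrier E" "p n \<in> carrier E" using Suc.prems by (auto intro!: E.finsum_closed)
  have "(\<Oplus>i\<in>{..<Suc n}. p i) = p n \<oplus> ?s"
    unfolding lessThan_Suc using Suc.prems by (intro E.finsum_insert) auto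
  then have "(\<Oplus>i\<in>{..<Suc n}. p i) = ?s \<oplus> p n" using s by (simp add: E.a_comm)
  moreover have "map (\<lambda>i. (p i, b)) [0..<n] @ [(p n, b)] \<approx> [(?s, b)] @ [(p n, b)]"
    using Suc s assms(2) by (intro tensor_eq.append tensor_eq.refl) auto
  moreover have "[(?s, b), (p n, b)] \<approx> [(?s \<oplus> p n, b)]"
    using s assms(2) by (intro tensor_eq.sym[OF tensor_eq.add_left])
  ultimately show ?case by (auto intro: tensor_eq.trans)
qed

text \<open>The relation \<open>zero\<close> speaks about the left factor. The zero of
  \<open>K\<close> carries it to the right one: it can be split off the right factor and moved
  across by \<open>balanced\<close>.\<close>

lemma teq_zero_right:
  assumes "x \<in> carrier E"
  shows "[(x, \<zero>\<^bsub>B\<^esub>)] \<approx> []"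
proof -
  have "[(\<zero>\<^bsub>K\<^esub> \<odot> x, \<zero>\<^bsub>B\<^esub>)] \<approx> [(x, \<zero>\<^bsub>K\<^esub> \<odot>\<^bsub>B\<^esub> \<zero>\<^bsub>B\<^esub>)]"
    using assms by (intro tensor_eq.balanced) auto
  then have "[(\<zero>, \<zero>\<^bsub>B\<^esub>)] \<approx> [(x, \<zero>\<^bsub>B\<^esub>)]" using assms by simp
  then show ?thesis using tensor_eq.zero[OF B.zero_closed] by (blast intro: tensor_eq.sym tensor_eq.trans)
qed

text \<open>\<open>W\<close> is the set of coordinates of an isomorphism from the tensor product to
  the power of \<open>E\<close> indexed by \<open>W\<close>, described without classes and without a
  numbering of \<open>W\<close>. The last two clauses are surjectivity and injectivity of joint
  evaluation.\<close>

definition splits :: "('b \<Rightarrow> 'a) set \<Rightarrow> bool" where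
  "splits W \<longleftrightarrow> finite W \<and> W \<subseteq> alg_hom K B E \<inter> extensional (carrier B) \<and>
     (\<forall>F\<in>W \<rightarrow> carrier E. \<exists>ps. valid ps \<and> (\<forall>\<phi>\<in>W. ev \<phi> ps = F \<phi>)) \<and>
     (\<forall>ps qs. valid ps \<longrightarrow> valid qs \<longrightarrow> (\<forall>\<phi>\<in>W. ev \<phi> ps = ev \<phi> qs) \<longrightarrow> ps \<approx> qs)"

definition coord :: "(('a \<times> 'b) list set \<Rightarrow> nat \<Rightarrow> 'a) \<Rightarrow> nat \<Rightarrow> 'b \<Rightarrow> 'a" where
  "coord \<phi> i = (\<lambda>b\<in>carrier B. \<phi> (cls [(\<one>, b)]) i)"

text \<open>By linearity over \<open>E\<close>, the coordinate \<open>i\<close> of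
  \<open>\<phi>\<close> is evaluation along \<open>coord \<phi> i\<close>, so bijectivity of
  \<open>\<phi>\<close> becomes bijectivity of joint evaluation. Surjectivity also yields a tensor
  with coordinate \<open>\<one>\<close> at \<open>i\<close> and \<open>\<zero>\<close> at all other
  indices; since \<open>\<one> \<noteq> \<zero>\<close>, the coordinates are distinct and their set
  has exactly \<open>m\<close> elements.\<close>

lemma splits_if_iso:
  assumes iso: "\<phi> \<in> alg_iso E tns (power_algebra E m)" and ne: "\<one> \<noteq> \<zero>"
  shows "splits (coord \<phi> ` {..<m})" "card (coord \<phi> ` {..<m}) = m"
proof -
  let ?P = "power_algebra E m"
  have bij: "bij_betw \<phi> (carrier tns) (carrier ?P)" using iso by (simp add: alg_iso_def)
  have P: "f i \<in> carrier E" if "f \<in> carrier ?P" "i < m" for f i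
    using that by (auto simp: power_algebra_def)
  have cl: "\<phi> (cls ps) \<in> carrier ?P" if "valid ps" for ps
    using bij that by (auto simp: tns_carrier bij_betw_def)
  have add: "\<phi> (cls (ps @ qs)) i = \<phi> (cls ps) i \<oplus> \<phi> (cls qs) i"
    if "valid ps" "valid qs" "i < m" for ps qs i
  proof -
    have "\<phi> (cls ps \<oplus>\<^bsub>tns\<^esub> cls qs) = \<phi> (cls ps) \<oplus>\<^bsub>?P\<^esub> \<phi> (cls qs)"
      using iso that by (auto simp: alg_iso_def alg_hom_def ring_hom_def tns_carrier)
    then show ?thesis using that by (simp add: tns_add power_algebra_def)
  qed
  have mult: "\<phi> (cls (times ps qs)) i = \<phi> (cls ps) i \<otimes> \<phi> (cls qs) i"
    if "valid ps" "valid qs" "i < m" for ps qs i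
  proof -
    have "\<phi> (cls ps \<otimes>\<^bsub>tns\<^esub> cls qs) = \<phi> (cls ps) \<otimes>\<^bsub>?P\<^esub> \<phi> (cls qs)"
      using iso that by (auto simp: alg_iso_def alg_hom_def ring_hom_def tns_carrier)
    then show ?thesis using that by (simp add: tns_mult power_algebra_def)
  qed
  have smult: "\<phi> (cls (times [(a, \<one>\<^bsub>B\<^esub>)] ps)) i = a \<otimes> \<phi> (cls ps) i"
    if "a \<in> carrier E" "valid ps" "i < m" for a ps i
  proof -
    have "\<phi> (a \<odot>\<^bsub>tns\<^esub> cls ps) = a \<odot>\<^bsub>?P\<^esub> \<phi> (cls ps)"
      using iso that by (auto simp: alg_iso_def alg_hom_def ring_hom_def tns_carrier)
    then show ?thesis using that by (simp add: tns_smult power_algebra_def)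
  qed
  have one: "\<phi> (cls [(\<one>, \<one>\<^bsub>B\<^esub>)]) i = \<one>" if "i < m" for i
  proof -
    have "\<phi> \<one>\<^bsub>tns\<^esub> = \<one>\<^bsub>?P\<^esub>"
      using iso by (auto simp: alg_iso_def alg_hom_def ring_hom_def)
    then show ?thesis using that by (simp add: tns_one power_algebra_def)
  qed
  have cong: "\<phi> (cls ps) = \<phi> (cls qs)" if "ps \<approx> qs" for ps qs
    using that cls_eq_iff[of ps qs] teq_valid[OF that] by simp
  have single: "\<phi> (cls [(a, b)]) i = a \<otimes> coord \<phi> i b"
    if "a \<in> carrier E" "b \<in> carrier B" "i < m" for a b i
    using smult[of a "[(\<one>, b)]" i] that by (simp add: times_single coord_def)
  have hom: "coord \<phi> i \<in> alg_hom K B E" if i: "i < m" for i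
  proof (rule alg_homI)
    show "coord \<phi> i x \<in> carrier E" if "x \<in> carrier B" for x
      using i that by (auto simp: coord_def intro!: P[OF cl])
    show "coord \<phi> i \<one>\<^bsub>B\<^esub> = \<one>" using one[OF i] by (simp add: coord_def)
    show "coord \<phi> i (x \<otimes>\<^bsub>B\<^esub> y) = coord \<phi> i x \<otimes> coord \<phi> i y"
      if "x \<in> carrier B" "y \<in> carrier B" for x y
      using mult[of "[(\<one>, x)]" "[(\<one>, y)]" i] i that by (simp add: coord_def times_single)
    show "coord \<phi> i (x \<oplus>\<^bsub>B\<^esub> y) = coord \<phi> i x \<oplus> coord \<phi> i y"
      if "x \<in> carrier B" "y \<in> carrier B" for x y
      using add[of "[(\<one>, x)]" "[(\<one>, y)]" i] i that
        cong[OF tensor_eq.add_right[of "\<one>" E x B y K]] by (simp add: coord_def)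
    show "coord \<phi> i (k \<odot>\<^bsub>B\<^esub> x) = k \<odot> coord \<phi> i x"
      if k: "k \<in> carrier K" "x \<in> carrier B" for k x
    proof -
      have "coord \<phi> i (k \<odot>\<^bsub>B\<^esub> x) = \<phi> (cls [(k \<odot> \<one>, x)]) i"
        using cong[OF tensor_eq.balanced[of k K "\<one>" E x B]] k by (simp add: coord_def)
      also have "\<dots> = (k \<odot> \<one>) \<otimes> coord \<phi> i x"
        using k i by (intro single) auto
      also have "\<dots> = k \<odot> coord \<phi> i x"
        using k i P[OF cl[of "[(\<one>, x)]"]] by (subst KE.smult_assoc2) (auto simp: coord_def)
      finally show ?thesis .
    qed
  qed
  have ev: "\<phi> (cls ps) i = ev (coord \<phi> i) ps" if "valid ps" "i < m" for ps i
    using that(1)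
  proof (induction ps)
    case Nil
    \<comment> \<open>\<open>alg_hom\<close> does not mention zero; that zero is preserved comes
      from linearity with the scalar zero.\<close>
    have "\<phi> (cls []) i = \<zero> \<otimes> \<phi> (cls []) i"
      using smult[of "\<zero>" "[]" i] that(2) by (simp add: times_def)
    then show ?case using P[OF cl[of "[]"] that(2)] by simp
  next
    case (Cons p ps)
    then show ?case
      using add[of "[p]" ps i] that(2) by (cases p) (auto simp: single)
  qed
  have surj: "\<exists>ps. valid ps \<and> (\<forall>i<m. ev (coord \<phi> i) ps = F i)" if "F \<in> {..<m} \<rightarrow> carrier E" for F
  proof -
    have "restrict F {..<m} \<in> carrier ?P" using that by (auto simp: power_algebra_def)
    then obtain ps where ps: "valid ps" "restrict F {..<m} = \<phi> (cls ps)"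
      using bij by (auto simp: tns_carrier bij_betw_def)
    have "ev (coord \<phi> i) ps = F i" if "i < m" for i
      using ev[OF ps(1) that] ps(2) that by (metis lessThan_iff restrict_apply')
    then show ?thesis using ps(1) by blast
  qed
  have inj: "inj_on (coord \<phi>) {..<m}"
  proof (rule inj_onI, rule ccontr)
    fix i j assume ij: "i \<in> {..<m}" "j \<in> {..<m}" "coord \<phi> i = coord \<phi> j" "i \<noteq> j"
    obtain ps where "valid ps"
      "\<forall>k<m. ev (coord \<phi> k) ps = (if k = i then \<one> else \<zero>)"
      using surj[of "\<lambda>k. if k = i then \<one> else \<zero>"] by auto
    then show False using ij ne by (metis lessThan_iff)
  qed
  then show "card (coord \<phi> ` {..<m}) = m" by (simp add: card_image)
  show "splits (coord \<phi> ` {..<m})"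
    unfolding splits_def
  proof (intro conjI allI impI ballI)
    show "coord \<phi> ` {..<m} \<subseteq> alg_hom K B E \<inter> extensional (carrier B)"
      using hom by (auto simp: coord_def)
  next
    fix F assume "F \<in> coord \<phi> ` {..<m} \<rightarrow> carrier E"
    then have "F \<circ> coord \<phi> \<in> {..<m} \<rightarrow> carrier E" by auto
    from surj[OF this] show "\<exists>ps. valid ps \<and> (\<forall>\<psi>\<in>coord \<phi> ` {..<m}. ev \<psi> ps = F \<psi>)" by auto
  next
    fix ps qs assume v: "valid ps" "valid qs" and "\<forall>\<psi>\<in>coord \<phi> ` {..<m}. ev \<psi> ps = ev \<psi> qs"
    then have "\<phi> (cls ps) i = \<phi> (cls qs) i" if "i < m" for i using ev that by auto
    moreover have "\<phi> (cls ps) \<in> extensional {..<m}" "\<phi> (cls qs) \<in> extensional {..<m}"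
      using cl v by (auto simp: power_algebra_def PiE_def)
    ultimately have "\<phi> (cls ps) = \<phi> (cls qs)" by (auto intro: extensionalityI)
    then have "cls ps = cls qs" using bij v by (auto simp: bij_betw_def tns_carrier dest: inj_onD)
    then show "ps \<approx> qs" using cls_eq_iff v by simp
  qed auto
qed

lemma iso_if_splits:
  assumes W: "splits W" and m: "card W = m"
  shows "\<exists>\<phi>\<in>alg_iso E tns (power_algebra E m). W = coord \<phi> ` {..<m}"
proof -
  let ?P = "power_algebra E m"
  have fin: "finite W" and hom: "\<And>\<phi>. \<phi> \<in> W \<Longrightarrow> \<phi> \<in> alg_hom K B E"
    and ext: "\<And>\<phi>. \<phi> \<in> W \<Longrightarrow> \<phi> \<in> extensional (carrier B)"
    and surj: "\<And>F. F \<in> W \<rightarrow> carrier E \<Longrightarrow> \<exists>ps. valid ps \<and> (\<forall>\<phi>\<in>W. ev \<phi> ps = F \<phi>)"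
    and inj: "\<And>ps qs. valid ps \<Longrightarrow> valid qs \<Longrightarrow> (\<forall>\<phi>\<in>W. ev \<phi> ps = ev \<phi> qs) \<Longrightarrow> ps \<approx> qs"
    using W unfolding splits_def by blast+
  obtain w where w: "bij_betw w {..<m} W"
    using ex_bij_betw_nat_finite[OF fin] m by (auto simp: atLeast0LessThan)
  have wW: "w i \<in> W" if "i < m" for i using w that by (auto simp: bij_betw_def)
  \<comment> \<open>The value on a class is computed from a chosen representative; by
    \<open>ev_cong\<close> the choice does not matter.\<close>
  define \<phi> where "\<phi> P = (\<lambda>i\<in>{..<m}. ev (w i) (SOME ps. ps \<in> P))" for P
  have \<phi>: "\<phi> (cls ps) = (\<lambda>i\<in>{..<m}. ev (w i) ps)" if "valid ps" for ps
  proof -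
    have "ps \<in> cls ps" using that by (auto simp: tensor_class_def intro: tensor_eq.refl)
    then have "(SOME qs. qs \<in> cls ps) \<in> cls ps" by (rule someI)
    then have "ps \<approx> (SOME qs. qs \<in> cls ps)" by (simp add: tensor_class_def)
    then show ?thesis unfolding \<phi>_def
      by (intro restrict_ext) (use ev_cong hom wW in \<open>metis lessThan_iff\<close>)
  qed
  have cl: "\<phi> P \<in> carrier ?P" if P: "P \<in> carrier tns" for P
  proof -
    obtain ps where "P = cls ps" "valid ps" using P by (auto simp: tns_carrier)
    then show ?thesis by (simp add: \<phi> power_algebra_def restrict_PiE_iff ev_closed hom wW)
  qed
  have "\<phi> \<in> alg_hom E tns ?P"
  proof (rule alg_homI)
    show "\<phi> \<one>\<^bsub>tns\<^esub> = \<one>\<^bsub>?P\<^esub>"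
      by (auto simp: tns_one \<phi> power_algebra_def hom_simps[OF hom[OF wW]] intro!: restrict_ext)
  next
    fix P assume "P \<in> carrier tns"
    then show "\<phi> P \<in> carrier ?P" by (rule cl)
  next
    fix P Q assume "P \<in> carrier tns" "Q \<in> carrier tns"
    then obtain ps qs where p: "P = cls ps" "Q = cls qs" "valid ps" "valid qs"
      by (auto simp: tns_carrier)
    show "\<phi> (P \<otimes>\<^bsub>tns\<^esub> Q) = \<phi> P \<otimes>\<^bsub>?P\<^esub> \<phi> Q"
      using p by (auto simp: tns_mult \<phi> times_valid power_algebra_def ev_times[OF hom[OF wW]]
          intro!: restrict_ext)
    show "\<phi> (P \<oplus>\<^bsub>tns\<^esub> Q) = \<phi> P \<oplus>\<^bsub>?P\<^esub> \<phi> Q"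
      using p by (auto simp: tns_add \<phi> power_algebra_def ev_append[OF hom[OF wW]]
          intro!: restrict_ext)
  next
    fix a P assume a: "a \<in> carrier E" and "P \<in> carrier tns"
    then obtain ps where p: "P = cls ps" "valid ps" by (auto simp: tns_carrier)
    have v: "valid (times [(a, \<one>\<^bsub>B\<^esub>)] ps)" using a p by (intro times_valid) auto
    show "\<phi> (a \<odot>\<^bsub>tns\<^esub> P) = a \<odot>\<^bsub>?P\<^esub> \<phi> P"
      using p a by (auto simp: tns_smult \<phi>[OF v] \<phi> power_algebra_def ev_times[OF hom[OF wW]]
          hom_simps[OF hom[OF wW]] intro!: restrict_ext)
  qed
  moreover have "bij_betw \<phi> (carrier tns) (carrier ?P)"
  proof (rule bij_betw_imageI)
    show "inj_on \<phi> (carrier tns)"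
    proof (rule inj_onI)
      fix P Q assume "P \<in> carrier tns" "Q \<in> carrier tns" and eq: "\<phi> P = \<phi> Q"
      then obtain ps qs where p: "P = cls ps" "Q = cls qs" "valid ps" "valid qs"
        by (auto simp: tns_carrier)
      have "ev (w i) ps = ev (w i) qs" if "i < m" for i
        using fun_cong[OF eq, of i] p that by (simp add: \<phi>)
      then have "\<forall>\<psi>\<in>W. ev \<psi> ps = ev \<psi> qs" using w by (auto simp: bij_betw_def)
      then have "ps \<approx> qs" using inj p by blast
      then show "P = Q" using p cls_eq_iff by simp
    qed
    have "F \<in> \<phi> ` carrier tns" if "F \<in> carrier ?P" for F
    proof -
      have F: "F \<in> {..<m} \<rightarrow>\<^sub>E carrier E" using that by (simp add: power_algebra_def)
      have "(F \<circ> inv_into {..<m} w) \<in> W \<rightarrow> carrier E"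
        using w by (auto simp: bij_betw_def intro!: PiE_mem[OF F, unfolded lessThan_iff] inv_into_into)
      then obtain ps where ps: "valid ps" "\<forall>\<psi>\<in>W. ev \<psi> ps = (F \<circ> inv_into {..<m} w) \<psi>"
        using surj by blast
      have "F = \<phi> (cls ps)"
      proof (rule extensionalityI[of _ "{..<m}"])
        show "F x = \<phi> (cls ps) x" if "x \<in> {..<m}" for x
          using that ps wW w by (simp add: \<phi> bij_betw_def)
      qed (use F in \<open>auto simp: PiE_def \<phi>[OF ps(1)] extensional_def\<close>)
      then show ?thesis using ps by (auto simp: tns_carrier)
    qed
    then show "\<phi> ` carrier tns = carrier ?P" using cl by blast
  qed
  ultimately have "\<phi> \<in> alg_iso E tns ?P" by (simp add: alg_iso_def)
  moreover have "coord \<phi> i = w i" if "i < m" for i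
  proof (rule extensionalityI[of _ "carrier B"])
    show "coord \<phi> i b = w i b" if b: "b \<in> carrier B" for b
      using b \<open>i < m\<close> hom_simps(1)[OF hom[OF wW] b] by (simp add: coord_def \<phi>)
  qed (use that ext wW in \<open>auto simp: coord_def\<close>)
  then have "coord \<phi> ` {..<m} = W" using w by (auto simp: bij_betw_def)
  ultimately show ?thesis by blast
qed

end

section \<open>Groupoids and their actions on sets\<close>

locale groupoid =
  fixes G :: "'g groupoid"
  assumes is_groupoid: "is_groupoid G"
begin

definition arrs :: "'g \<Rightarrow> 'g \<Rightarrow> 'g set" where
  "arrs e e' = {g \<in> arr G. gdom G g = e \<and> grng G g = e'}"

lemma arr_simps [simp]:
  assumes "g \<in> arr G"
  shows "ginv G g \<in> arr G" "gdom G g \<in> arr G" "grng G g \<in> arr G"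
    "gdom G (ginv G g) = grng G g" "grng G (ginv G g) = gdom G g"
    "grng G (gdom G g) = gdom G g" "gdom G (gdom G g) = gdom G g"
    "grng G (grng G g) = grng G g" "gdom G (grng G g) = grng G g"
    "gmult G g (gdom G g) = g" "gmult G (grng G g) g = g"
  using is_groupoid assms unfolding is_groupoid_def by blast+

lemma comp_simps [simp]:
  assumes "g \<in> arr G" "h \<in> arr G" "gdom G g = grng G h"
  shows "gmult G g h \<in> arr G" "gdom G (gmult G g h) = gdom G h" "grng G (gmult G g h) = grng G g"
  using is_groupoid assms unfolding is_groupoid_def by blast+

lemma gmult_assoc:
  assumes "g \<in> arr G" "h \<in> arr G" "k \<in> arr G" "gdom G g = grng G h" "gdom G h = grng G k"
  shows "gmult G (gmult G g h) k = gmult G g (gmult G h k)"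
  using is_groupoid assms unfolding is_groupoid_def by blast

lemma gdom_idents [simp]: "g \<in> arr G \<Longrightarrow> gdom G g \<in> idents G"
  by (simp add: idents_def)

lemma identsD [simp]:
  assumes "e \<in> idents G"
  shows "e \<in> arr G" "gdom G e = e" "grng G e = e"
  using assms by (auto simp: idents_def)

lemma grng_idents [simp]: "g \<in> arr G \<Longrightarrow> grng G g \<in> idents G"
  using gdom_idents[of "ginv G g"] by simp

lemma arrsD:
  assumes "g \<in> arrs e e'"
  shows "g \<in> arr G" "gdom G g = e" "grng G g = e'" "e \<in> idents G" "e' \<in> idents G"
  using assms by (auto simp: arrs_def)

lemma arrsI: "g \<in> arr G \<Longrightarrow> g \<in> arrs (gdom G g) (grng G g)"
  by (simp add: arrs_def)

lemma ident_arrs: "e \<in> idents G \<Longrightarrow> e \<in> arrs e e"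
  by (simp add: arrs_def)

lemma ginv_arrs: "g \<in> arrs e e' \<Longrightarrow> ginv G g \<in> arrs e' e"
  by (simp add: arrs_def)

lemma gmult_arrs: "h \<in> arrs e' e'' \<Longrightarrow> g \<in> arrs e e' \<Longrightarrow> gmult G h g \<in> arrs e e''"
  by (simp add: arrs_def)

lemma ginv_gmult: "g \<in> arrs e e' \<Longrightarrow> gmult G (ginv G g) g = e"
  by (simp add: arrs_def gdom_def)

lemma gmult_ginv: "g \<in> arrs e e' \<Longrightarrow> gmult G g (ginv G g) = e'"
  by (simp add: arrs_def grng_def)

text \<open>Left translation reindexes sums over the arrows out of \<open>e\<close>. This is what
  makes traces and averages equivariant.\<close>

lemma bij_betw_gmult:
  assumes h: "h \<in> arrs e' e''"
  shows "bij_betw (gmult G h) (arrs e e') (arrs e e'')"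
proof (rule bij_betw_byWitness[where f' = "gmult G (ginv G h)"])
  show "\<forall>g\<in>arrs e e'. gmult G (ginv G h) (gmult G h g) = g"
  proof
    fix g assume g: "g \<in> arrs e e'"
    then have "gmult G (ginv G h) (gmult G h g) = gmult G (gmult G (ginv G h) h) g"
      using h arrsD[OF g] arrsD[OF h] by (simp add: gmult_assoc)
    then show "gmult G (ginv G h) (gmult G h g) = g"
      using ginv_gmult[OF h] arrsD[OF g] arr_simps(11)[of g] by simp
  qed
  show "\<forall>g\<in>arrs e e''. gmult G h (gmult G (ginv G h) g) = g"
  proof
    fix g assume g: "g \<in> arrs e e''"
    then have "gmult G h (gmult G (ginv G h) g) = gmult G (gmult G h (ginv G h)) g"
      using h arrsD[OF g] arrsD[OF h] by (simp add: gmult_assoc)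
    then show "gmult G h (gmult G (ginv G h) g) = g"
      using gmult_ginv[OF h] arrsD[OF g] arr_simps(11)[of g] by simp
  qed
qed (use gmult_arrs[OF h] gmult_arrs[OF ginv_arrs[OF h]] in blast)+

lemma idents_nonempty: "idents G \<noteq> {}"
  using is_groupoid unfolding is_groupoid_def idents_def by blast

section \<open>Actions on sets and equivariant maps\<close>

definition split_gset :: "('g, 'x) gset \<Rightarrow> bool" where
  "split_gset X \<longleftrightarrow> is_gset G X \<and> is_split G X \<and> finite (gcar X)"

text \<open>For a split set this is the index of the piece containing \<open>x\<close>. The
  description agrees with the one in the identity of \<open>A_alg\<close>.\<close>

definition pos :: "('g, 'x) gset \<Rightarrow> 'x \<Rightarrow> 'g" where
  "pos X x = (THE e. e \<in> idents G \<and> x \<in> gsub X e)"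

lemma gset_gsub:
  assumes "is_gset G X" "g \<in> arrs e e'"
  shows "gsub X g = gsub X e'" "gsub X (ginv G g) = gsub X e"
proof -
  have "gsub X h = gsub X (grng G h)" if "h \<in> arr G" for h
    using assms(1) that unfolding is_gset_def by blast
  then show "gsub X g = gsub X e'" "gsub X (ginv G g) = gsub X e"
    using arrsD[OF assms(2)] arr_simps(1,5) by metis+
qed

lemma gsub_gcar: "is_gset G X \<Longrightarrow> e \<in> idents G \<Longrightarrow> x \<in> gsub X e \<Longrightarrow> x \<in> gcar X"
  using identsD(1) unfolding is_gset_def by blast

lemma gact_bij:
  assumes "is_gset G X" "g \<in> arrs e e'"
  shows "bij_betw (gact X g) (gsub X e) (gsub X e')"
proof -
  have "bij_betw (gact X g) (gsub X (ginv G g)) (gsub X g)"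
    using assms(1) arrsD(1)[OF assms(2)] unfolding is_gset_def by blast
  then show ?thesis by (simp add: gset_gsub[OF assms])
qed

lemma gact_mem: "is_gset G X \<Longrightarrow> g \<in> arrs e e' \<Longrightarrow> x \<in> gsub X e \<Longrightarrow> gact X g x \<in> gsub X e'"
  using gact_bij bij_betw_apply by metis

lemma gact_ident: "is_gset G X \<Longrightarrow> e \<in> idents G \<Longrightarrow> x \<in> gsub X e \<Longrightarrow> gact X e x = x"
  unfolding is_gset_def by blast

lemma gact_comp:
  assumes "is_gset G X" "h \<in> arrs e' e''" "g \<in> arrs e e'" "x \<in> gsub X e"
  shows "gact X h (gact X g x) = gact X (gmult G h g) x"
proof -
  have "x \<in> gsub X (ginv G g)" using assms gset_gsub by metis
  moreover have "h \<in> arr G" "g \<in> arr G" "gdom G h = grng G g"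
    using assms(2,3) arrsD by metis+
  ultimately show ?thesis using assms(1) unfolding is_gset_def by blast
qed

lemma gact_ginv:
  assumes "is_gset G X" "g \<in> arrs e e'" "x \<in> gsub X e"
  shows "gact X (ginv G g) (gact X g x) = x"
  using gact_comp[OF assms(1) ginv_arrs[OF assms(2)] assms(2,3)] ginv_gmult[OF assms(2)]
    gact_ident[OF assms(1) arrsD(4)[OF assms(2)] assms(3)] by simp

lemma gact_ginv':
  assumes "is_gset G X" "g \<in> arrs e e'" "x \<in> gsub X e'"
  shows "gact X g (gact X (ginv G g) x) = x"
  using gact_comp[OF assms(1,2) ginv_arrs[OF assms(2)] assms(3)] gmult_ginv[OF assms(2)]
    gact_ident[OF assms(1) arrsD(5)[OF assms(2)] assms(3)] by simp

text \<open>Bijectivity is obtained from the laws for identities and composites: the map of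
  \<open>ginv G g\<close> inverts the map of \<open>g\<close>.\<close>

lemma is_gsetI:
  assumes ne: "gcar X \<noteq> {}"
    and sub: "\<And>e. e \<in> idents G \<Longrightarrow> gsub X e \<subseteq> gcar X"
    and rng: "\<And>g. g \<in> arr G \<Longrightarrow> gsub X g = gsub X (grng G g)"
    and mem: "\<And>g e e' x. g \<in> arrs e e' \<Longrightarrow> x \<in> gsub X e \<Longrightarrow> gact X g x \<in> gsub X e'"
    and ident: "\<And>e x. e \<in> idents G \<Longrightarrow> x \<in> gsub X e \<Longrightarrow> gact X e x = x"
    and comp: "\<And>h g e e' e'' x. h \<in> arrs e' e'' \<Longrightarrow> g \<in> arrs e e' \<Longrightarrow> x \<in> gsub X e \<Longrightarrow>
      gact X h (gact X g x) = gact X (gmult G h g) x"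
  shows "is_gset G X"
  unfolding is_gset_def
proof (intro conjI ballI impI)
  fix g assume g: "g \<in> arr G"
  then show "gsub X g = gsub X (grng G g)" by (rule rng)
  then show "gsub X g \<subseteq> gcar X" using sub[of "grng G g"] g by simp
  have ga: "g \<in> arrs (gdom G g) (grng G g)" "ginv G g \<in> arrs (grng G g) (gdom G g)"
    using g arrsI ginv_arrs by auto
  have "bij_betw (gact X g) (gsub X (gdom G g)) (gsub X (grng G g))"
  proof (rule bij_betw_byWitness[where f' = "gact X (ginv G g)"])
    show "\<forall>x\<in>gsub X (gdom G g). gact X (ginv G g) (gact X g x) = x"
      using comp[OF ga(2,1)] ginv_gmult[OF ga(1)] ident arrsD(4)[OF ga(1)] by simp
    show "\<forall>x\<in>gsub X (grng G g). gact X g (gact X (ginv G g) x) = x"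
      using comp[OF ga] gmult_ginv[OF ga(1)] ident arrsD(5)[OF ga(1)] by simp
  qed (use mem[OF ga(1)] mem[OF ga(2)] in blast)+
  then show "bij_betw (gact X g) (gsub X (ginv G g)) (gsub X g)"
    using rng[OF g] rng[of "ginv G g"] g by simp
next
  fix g h x assume "g \<in> arr G" "h \<in> arr G" "gdom G g = grng G h" "x \<in> gsub X (ginv G h)"
  then show "gact X g (gact X h x) = gact X (gmult G g h) x"
    using comp[of g "grng G h" "grng G g" h "gdom G h" x] arrsI[of h] arrsI[of g] rng[of "ginv G h"]
    by simp
qed (use ne ident in auto)

lemma split_gsetD:
  assumes "split_gset X"
  shows "is_gset G X" "is_split G X" "finite (gcar X)"
  using assms by (simp_all add: split_gset_def)

lemma pos_eq:
  assumes "is_split G X" "e \<in> idents G" "x \<in> gsub X e"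
  shows "pos X x = e"
  unfolding pos_def
proof (rule the_equality)
  fix e' assume "e' \<in> idents G \<and> x \<in> gsub X e'"
  then show "e' = e"
    using assms unfolding is_split_def disjoint_family_on_def by blast
qed (use assms in blast)

lemma pos:
  assumes "is_split G X" "x \<in> gcar X"
  shows "pos X x \<in> idents G" "x \<in> gsub X (pos X x)"
proof -
  obtain e where "e \<in> idents G" "x \<in> gsub X e" using assms by (auto simp: is_split_def)
  then show "pos X x \<in> idents G" "x \<in> gsub X (pos X x)" using pos_eq[OF assms(1)] by auto
qed

lemma fin_gsub: "split_gset X \<Longrightarrow> e \<in> idents G \<Longrightarrow> finite (gsub X e)"
  by (rule finite_subset[OF subsetI split_gsetD(3)]) (rule gsub_gcar[OF split_gsetD(1)])

lemma gmapsD: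
  assumes X: "is_gset G X" and f: "f \<in> gmaps G X Y"
  shows "f \<in> extensional (gcar X)" "\<And>x. x \<in> gcar X \<Longrightarrow> f x \<in> gcar Y"
    "\<And>e x. e \<in> idents G \<Longrightarrow> x \<in> gsub X e \<Longrightarrow> f x \<in> gsub Y e"
    "\<And>g e e' x. g \<in> arrs e e' \<Longrightarrow> x \<in> gsub X e \<Longrightarrow> f (gact X g x) = gact Y g (f x)"
proof -
  show "f \<in> extensional (gcar X)" "\<And>x. x \<in> gcar X \<Longrightarrow> f x \<in> gcar Y"
    using f by (auto simp: gmaps_def PiE_def)
  show "f x \<in> gsub Y e" if "e \<in> idents G" "x \<in> gsub X e" for e x
    using f that identsD(1)[OF that(1)] unfolding gmaps_def by blast
  show "f (gact X g x) = gact Y g (f x)" if "g \<in> arrs e e'" "x \<in> gsub X e" for g e e' x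
    using f that arrsD(1)[OF that(1)] gset_gsub(2)[OF X that(1)] unfolding gmaps_def by blast
qed

lemma gmapsI:
  assumes X: "is_gset G X" "is_split G X" and Y: "is_gset G Y"
    and "f \<in> extensional (gcar X)"
    and f: "\<And>e x. e \<in> idents G \<Longrightarrow> x \<in> gsub X e \<Longrightarrow> f x \<in> gsub Y e"
    and "\<And>g e e' x. g \<in> arrs e e' \<Longrightarrow> x \<in> gsub X e \<Longrightarrow> f (gact X g x) = gact Y g (f x)"
  shows "f \<in> gmaps G X Y"
proof -
  have "f x \<in> gcar Y" if "x \<in> gcar X" for x
    using gsub_gcar[OF Y _ f] pos[OF X(2) that] by blast
  moreover have "f ` gsub X g \<subseteq> gsub Y g" if "g \<in> arr G" for g
    using f[of "grng G g"] gset_gsub(1)[OF X(1) arrsI[OF that]] gset_gsub(1)[OF Y arrsI[OF that]]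
      grng_idents[OF that] by blast
  moreover have "f (gact X g x) = gact Y g (f x)" if "g \<in> arr G" "x \<in> gsub X (ginv G g)" for g x
    using assms(6)[OF arrsI[OF that(1)]] gset_gsub(2)[OF X(1) arrsI[OF that(1)]] that(2) by blast
  ultimately show ?thesis using assms(4) by (auto simp: gmaps_def PiE_def)
qed

lemma gset_isoI:
  assumes X: "is_gset G X" "is_split G X" and Y: "is_gset G Y" "is_split G Y"
    and ext: "f \<in> extensional (gcar X)"
    and bij: "\<And>e. e \<in> idents G \<Longrightarrow> bij_betw f (gsub X e) (gsub Y e)"
    and act: "\<And>g e e' x. g \<in> arrs e e' \<Longrightarrow> x \<in> gsub X e \<Longrightarrow> f (gact X g x) = gact Y g (f x)"
  shows "gset_iso G X Y f"
proof -
  \<comment> \<open>The inverse is formed piece by piece, using \<open>pos\<close>, because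
    \<open>f\<close> is given as a bijection on each piece separately.\<close>
  define h where "h = (\<lambda>y\<in>gcar Y. inv_into (gsub X (pos Y y)) f y)"
  have h: "h y = inv_into (gsub X e) f y" if "e \<in> idents G" "y \<in> gsub Y e" for e y
    using that gsub_gcar[OF Y(1)] pos_eq[OF Y(2)] by (simp add: h_def)
  have hX: "h y \<in> gsub X e" and fh: "f (h y) = y" if "e \<in> idents G" "y \<in> gsub Y e" for e y
    using bij_betw_imp_surj_on[OF bij[OF that(1)]] that(2) unfolding h[OF that]
    by (auto intro: inv_into_into f_inv_into_f)
  have hf: "h (f x) = x" if "e \<in> idents G" "x \<in> gsub X e" for e x
    using bij_betw_apply[OF bij[OF that(1)] that(2)] bij_betw_inv_into_left[OF bij[OF that(1)] that(2)]
      h[OF that(1)] by simp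
  have "f \<in> gmaps G X Y"
    using bij_betw_apply[OF bij] by (intro gmapsI[OF X Y(1) ext _ act])
  moreover have "h \<in> gmaps G Y X"
  proof (rule gmapsI[OF Y X(1)])
    show "h \<in> extensional (gcar Y)" by (simp add: h_def)
    fix g e e' y assume g: "g \<in> arrs e e'" and y: "y \<in> gsub Y e"
    note e = arrsD(4,5)[OF g]
    have "h (gact Y g y) = h (f (gact X g (h y)))"
      using act[OF g hX[OF e(1) y]] fh[OF e(1) y] by simp
    also have "\<dots> = gact X g (h y)"
      using hf[OF e(2) gact_mem[OF X(1) g hX[OF e(1) y]]] .
    finally show "h (gact Y g y) = gact X g (h y)" .
  qed (rule hX)
  moreover have "\<forall>x\<in>gcar X. h (f x) = x" using hf pos[OF X(2)] by blast
  moreover have "\<forall>y\<in>gcar Y. f (h y) = y" using fh pos[OF Y(2)] by blast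
  ultimately show ?thesis unfolding gset_iso_def by blast
qed

section \<open>The category of finite split sets\<close>

lemma fin_split_gsets_simps:
  "Ob (fin_split_gsets G) = Collect split_gset" "Hom (fin_split_gsets G) = gmaps G"
  "Ide (fin_split_gsets G) X = (\<lambda>x\<in>gcar X. x)"
  "Comp (fin_split_gsets G) X Y Z g f = compose (gcar X) g f"
  by (auto simp: fin_split_gsets_def split_gset_def)

lemma gmaps_compose:
  assumes X: "split_gset X" and Y: "split_gset Y" and Z: "split_gset Z"
    and f: "f \<in> gmaps G X Y" and h: "h \<in> gmaps G Y Z"
  shows "compose (gcar X) h f \<in> gmaps G X Z"
proof (rule gmapsI)
  note X' = split_gsetD[OF X]
  note c = gsub_gcar[OF X'(1)]
  note f' = gmapsD[OF X'(1) f] and h' = gmapsD[OF split_gsetD(1)[OF Y] h]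
  show "compose (gcar X) h f x \<in> gsub Z e" if "e \<in> idents G" "x \<in> gsub X e" for e x
    using h'(3)[OF that(1) f'(3)[OF that]] c[OF that] by (simp add: compose_eq)
  fix g e e' x assume gx: "g \<in> arrs e e'" "x \<in> gsub X e"
  note e = arrsD(4,5)[OF gx(1)]
  show "compose (gcar X) h f (gact X g x) = gact Z g (compose (gcar X) h f x)"
    using c[OF e(2) gact_mem[OF X'(1) gx]] c[OF e(1) gx(2)] f'(4)[OF gx] h'(4)[OF gx(1) f'(3)[OF e(1) gx(2)]]
    by (simp add: compose_eq)
qed (use split_gsetD[OF X] split_gsetD[OF Z] in \<open>auto simp: compose_extensional\<close>)

lemma gmaps_id:
  assumes X: "split_gset X"
  shows "(\<lambda>x\<in>gcar X. x) \<in> gmaps G X X"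
proof (rule gmapsI)
  note X' = split_gsetD[OF X]
  show "(\<lambda>x\<in>gcar X. x) x \<in> gsub X e" if "e \<in> idents G" "x \<in> gsub X e" for e x
    using that gsub_gcar[OF X'(1)] by simp
  fix g e e' x assume gx: "g \<in> arrs e e'" "x \<in> gsub X e"
  note e = arrsD(4,5)[OF gx(1)]
  show "(\<lambda>x\<in>gcar X. x) (gact X g x) = gact X g ((\<lambda>x\<in>gcar X. x) x)"
    using gsub_gcar[OF X'(1) e(2) gact_mem[OF X'(1) gx]] gsub_gcar[OF X'(1) e(1) gx(2)] by simp
qed (use split_gsetD[OF X] in auto)

lemma category_gsets: "is_category (fin_split_gsets G :: (('g, 'x) gset, 'x \<Rightarrow> 'x) cat)"
  unfolding is_category_def fin_split_gsets_simps
proof (intro conjI ballI)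
  fix W X Y Z :: "('g, 'x) gset" and f g h
  assume *: "W \<in> Collect split_gset" "X \<in> Collect split_gset" "f \<in> gmaps G W X"
  then show "compose (gcar W) h (compose (gcar W) g f) = compose (gcar W) (compose (gcar X) h g) f"
    using gmapsD(2)[OF split_gsetD(1)] by (intro compose_assoc) auto
next
  fix X Y :: "('g, 'x) gset" and f
  assume "X \<in> Collect split_gset" "Y \<in> Collect split_gset" "f \<in> gmaps G X Y"
  then show "compose (gcar X) f (\<lambda>x\<in>gcar X. x) = f" "compose (gcar X) (\<lambda>x\<in>gcar Y. x) f = f"
    using gmapsD(1,2)[OF split_gsetD(1)] by (auto intro!: compose_id_left compose_id_right)
qed (auto intro: gmaps_id gmaps_compose)

end

section \<open>Galois actions and the trace\<close>

locale galois_action = groupoid G + K: cring K + R: cring R + KR: algebra K R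
  for K :: "'k ring" and R :: "('k, 'r) module" (structure) and G :: "'g groupoid" +
  fixes E :: "'g \<Rightarrow> 'r set" and u :: "'g \<Rightarrow> 'r" and \<beta> :: "'g \<Rightarrow> 'r \<Rightarrow> 'r"
  assumes K_ne: "\<one>\<^bsub>K\<^esub> \<noteq> \<zero>\<^bsub>K\<^esub>"
    and fin: "finite (arr G)"
    and action: "is_algebra_action G K R E \<beta>"
    and ident: "\<forall>e\<in>idents G. has_identity R (E e) (u e)"
    and direct: "is_direct_sum G R E"
    and inv: "invariants G R u \<beta> = (\<lambda>k. k \<odot> \<one>) ` carrier K"
    and galois: "has_galois_coordinates G R u \<beta>"
    and faithful: "\<forall>g\<in>arr G. faithful_module K (ideal_algebra R (E g) (u (grng G g)))"
begin

abbreviation EA :: "'g \<Rightarrow> ('k, 'r) module" where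
  "EA e \<equiv> ideal_algebra R (E e) (u e)"

lemma EA_simps [simp]:
  "carrier (EA e) = E e" "\<one>\<^bsub>EA e\<^esub> = u e" "\<zero>\<^bsub>EA e\<^esub> = \<zero>" "add (EA e) = add R"
  "monoid.mult (EA e) = monoid.mult R" "smult (EA e) = smult R"
  by (simp_all add: ideal_algebra_def)

section \<open>The ideals of the decomposition and their identities\<close>

lemma fin_idents [simp]: "finite (idents G)"
  unfolding idents_def using fin by (rule finite_imageI)

lemma fin_arrs [simp]: "finite (arrs e e')"
  using fin by (simp add: arrs_def)

lemma E_ideal: "e \<in> idents G \<Longrightarrow> ideal (E e) R"
  using action identsD(1) unfolding is_algebra_action_def by blast

lemma E_sub: "e \<in> idents G \<Longrightarrow> a \<in> E e \<Longrightarrow> a \<in> carrier R"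
  using ideal.Icarr[OF E_ideal] by blast

lemma E_add: "e \<in> idents G \<Longrightarrow> a \<in> E e \<Longrightarrow> b \<in> E e \<Longrightarrow> a \<oplus> b \<in> E e"
  using additive_subgroup.a_closed[OF ideal.axioms(1)[OF E_ideal]] by blast

lemma E_zero: "e \<in> idents G \<Longrightarrow> \<zero> \<in> E e"
  using additive_subgroup.zero_closed[OF ideal.axioms(1)[OF E_ideal]] by blast

lemma E_mult_left: "e \<in> idents G \<Longrightarrow> a \<in> E e \<Longrightarrow> r \<in> carrier R \<Longrightarrow> r \<otimes> a \<in> E e"
  using ideal.I_l_closed[OF E_ideal] by blast

lemma E_mult_right: "e \<in> idents G \<Longrightarrow> a \<in> E e \<Longrightarrow> r \<in> carrier R \<Longrightarrow> a \<otimes> r \<in> E e"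
  using ideal.I_r_closed[OF E_ideal] by blast

lemma E_minus: "e \<in> idents G \<Longrightarrow> a \<in> E e \<Longrightarrow> \<ominus> a \<in> E e"
  using additive_subgroup.a_inv_closed[OF ideal.axioms(1)[OF E_ideal]] by blast

lemma E_smult:
  assumes "e \<in> idents G" "a \<in> E e" "k \<in> carrier K"
  shows "k \<odot> a \<in> E e"
proof -
  have "(k \<odot> \<one>) \<otimes> a \<in> E e" using assms by (intro E_mult_left) auto
  then show ?thesis using assms E_sub by (simp add: KR.smult_assoc2)
qed

lemma E_finsum: "e \<in> idents G \<Longrightarrow> finite A \<Longrightarrow> (\<And>i. i \<in> A \<Longrightarrow> f i \<in> E e) \<Longrightarrow> (\<Oplus>i\<in>A. f i) \<in> E e"
  by (intro R.finsum_mem) (auto simp: E_add E_zero E_sub)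

lemma u_mem [simp]: "e \<in> idents G \<Longrightarrow> u e \<in> E e"
  using ident by (auto simp: has_identity_def)

lemma u_carrier [simp]: "e \<in> idents G \<Longrightarrow> u e \<in> carrier R"
  using E_sub u_mem by blast

lemma u_left: "e \<in> idents G \<Longrightarrow> a \<in> E e \<Longrightarrow> u e \<otimes> a = a"
  using ident by (auto simp: has_identity_def)

lemma u_right: "e \<in> idents G \<Longrightarrow> a \<in> E e \<Longrightarrow> a \<otimes> u e = a"
  using u_left E_sub R.m_comm u_carrier by metis

lemma EA_algebra: assumes e: "e \<in> idents G" shows "algebra K (EA e)"
proof (rule algebraI)
  show "cring (EA e)"
  proof (rule cringI)
    show "abelian_group (EA e)"
    proof (rule abelian_groupI)
      show "\<exists>y\<in>carrier (EA e). y \<oplus>\<^bsub>EA e\<^esub> x = \<zero>\<^bsub>EA e\<^esub>" if "x \<in> carrier (EA e)" for x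
        using that e E_minus[OF e, of x] E_sub[OF e, of x]
        by (intro bexI[of _ "\<ominus> x"]) (auto simp: R.l_neg)
    qed (use e in \<open>auto simp: E_add E_zero R.a_ac E_sub\<close>)
    show "comm_monoid (EA e)"
      by (rule comm_monoidI) (use e in \<open>auto simp: E_mult_left R.m_ac E_sub u_left u_right\<close>)
  qed (use e in \<open>auto simp: E_sub R.l_distr\<close>)
qed (use e in \<open>auto simp: E_sub E_smult K.cring_axioms KR.smult_l_distr KR.smult_r_distr
      KR.smult_assoc1 KR.smult_assoc2\<close>)

lemma E_pair: "e \<in> idents G \<Longrightarrow> algebra K B \<Longrightarrow> algebra_pair K (EA e) B"
  using EA_algebra[of e] by (simp add: algebra_pair_def algebra.R_cring algebra.M_cring)

text \<open>Since \<open>u e\<close> is the identity of \<open>E e\<close>, the multiple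
  \<open>k \<odot> u e\<close> determines the action of \<open>k\<close> on the whole ideal.
  Faithfulness is applied in this form whenever two scalars are identified.\<close>

lemma E_faithful:
  assumes "e \<in> idents G" "k \<in> carrier K" "k' \<in> carrier K" "k \<odot> u e = k' \<odot> u e"
  shows "k = k'"
proof -
  have "(k \<ominus>\<^bsub>K\<^esub> k') \<odot> a = \<zero>" if a: "a \<in> E e" for a
  proof -
    have "(k \<ominus>\<^bsub>K\<^esub> k') \<odot> a = ((k \<ominus>\<^bsub>K\<^esub> k') \<odot> u e) \<otimes> a"
      using assms a E_sub by (simp add: KR.smult_assoc2 u_left)
    also have "(k \<ominus>\<^bsub>K\<^esub> k') \<odot> u e = \<zero>"
      using assms by (simp add: K.minus_eq KR.smult_l_distr KR.smult_l_minus R.r_neg)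
    finally show ?thesis using a E_sub assms by simp
  qed
  moreover have "faithful_module K (EA e)" using faithful assms(1) by (metis identsD)
  ultimately have "k \<ominus>\<^bsub>K\<^esub> k' = \<zero>\<^bsub>K\<^esub>" using assms by (auto simp: faithful_module_def)
  moreover have "k = (k \<ominus>\<^bsub>K\<^esub> k') \<oplus>\<^bsub>K\<^esub> k'" using assms(2,3) by algebra
  ultimately show ?thesis using assms by simp
qed

lemma u_ne: assumes "e \<in> idents G" shows "u e \<noteq> \<zero>"
proof
  assume "u e = \<zero>"
  then show False using E_faithful[OF assms, of "\<one>\<^bsub>K\<^esub>" "\<zero>\<^bsub>K\<^esub>"] K_ne by simp
qed

text \<open>The product lies in both ideals, so it has one decomposition concentrated at
  \<open>e\<close> and another concentrated at \<open>e'\<close>. Uniqueness of decompositions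
  forces it to vanish.\<close>

lemma E_orthogonal:
  assumes e: "e \<in> idents G" "e' \<in> idents G" "e \<noteq> e'" and a: "a \<in> E e" "b \<in> E e'"
  shows "a \<otimes> b = \<zero>"
proof -
  let ?z = "a \<otimes> b"
  have z: "?z \<in> E e" "?z \<in> E e'" "?z \<in> carrier R"
    using assms E_sub by (auto intro: E_mult_left E_mult_right)
  define c where "c f = (\<lambda>h\<in>idents G. if h = f then ?z else \<zero>)" for f
  have c: "c f \<in> Pi\<^sub>E (idents G) E \<and> ?z = (\<Oplus>h\<in>idents G. c f h)" if "f = e \<or> f = e'" for f
  proof
    show "c f \<in> Pi\<^sub>E (idents G) E" using that z E_zero by (auto simp: c_def)
    have "(\<Oplus>h\<in>idents G. c f h) = (\<Oplus>h\<in>idents G. if f = h then ?z else \<zero>)"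
      using z by (intro R.finsum_cong') (auto simp: c_def)
    then show "?z = (\<Oplus>h\<in>idents G. c f h)"
      using R.finsum_singleton[of f "idents G" "\<lambda>_. ?z"] that e z by auto
  qed
  have "\<exists>!c. c \<in> Pi\<^sub>E (idents G) E \<and> ?z = (\<Oplus>e\<in>idents G. c e)"
    using direct z by (simp add: is_direct_sum_def)
  then have "c e = c e'" using c by blast
  then have "c e e = c e' e" by simp
  then show ?thesis using e by (simp add: c_def)
qed

section \<open>The isomorphisms along arrows\<close>

lemma E_arrow: "g \<in> arrs e e' \<Longrightarrow> E (ginv G g) = E e \<and> E g = E e'"
  using action unfolding is_algebra_action_def arrs_def
  by (metis (mono_tags, lifting) arr_simps(1,5) mem_Collect_eq)

lemma \<beta>_bij: "g \<in> arrs e e' \<Longrightarrow> bij_betw (\<beta> g) (E e) (E e')"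
  using action E_arrow[of g e e'] arrsD(1)[of g e e'] unfolding is_algebra_action_def by metis

lemma \<beta>_mem: "g \<in> arrs e e' \<Longrightarrow> a \<in> E e \<Longrightarrow> \<beta> g a \<in> E e'"
  using \<beta>_bij bij_betw_apply by metis

lemma \<beta>_carrier: "g \<in> arrs e e' \<Longrightarrow> a \<in> E e \<Longrightarrow> \<beta> g a \<in> carrier R"
  using \<beta>_mem E_sub arrsD(5) by blast

lemma \<beta>_hom:
  assumes "g \<in> arrs e e'" "a \<in> E e" "b \<in> E e"
  shows "\<beta> g (a \<oplus> b) = \<beta> g a \<oplus> \<beta> g b" "\<beta> g (a \<otimes> b) = \<beta> g a \<otimes> \<beta> g b"
  using action assms E_arrow[OF assms(1)] arrsD(1)[OF assms(1)]
  unfolding is_algebra_action_def by blast+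

lemma \<beta>_smult:
  assumes "g \<in> arrs e e'" "a \<in> E e" "k \<in> carrier K"
  shows "\<beta> g (k \<odot> a) = k \<odot> \<beta> g a"
  using action assms E_arrow[OF assms(1)] arrsD(1)[OF assms(1)]
  unfolding is_algebra_action_def by blast

lemma \<beta>_ident: "e \<in> idents G \<Longrightarrow> a \<in> E e \<Longrightarrow> \<beta> e a = a"
  using action unfolding is_algebra_action_def by blast

lemma \<beta>_comp:
  assumes "h \<in> arrs e' e''" "g \<in> arrs e e'" "a \<in> E e"
  shows "\<beta> h (\<beta> g a) = \<beta> (gmult G h g) a"
  using action assms E_arrow[OF assms(2)] arrsD[OF assms(1)] arrsD[OF assms(2)]
  unfolding is_algebra_action_def by metis

lemma \<beta>_zero:
  assumes g: "g \<in> arrs e e'"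
  shows "\<beta> g \<zero> = \<zero>"
  using \<beta>_smult[OF g E_zero, of "\<zero>\<^bsub>K\<^esub>"] \<beta>_carrier[OF g E_zero] arrsD(4)[OF g] by simp

text \<open>The identity is not among the data preserved by \<open>\<beta> g\<close> in the
  definition of an action. Surjectivity provides \<open>a\<close> with image \<open>u e'\<close>,
  and then \<open>\<beta> g (u e) \<otimes> \<beta> g a = \<beta> g a\<close> gives the
  claim.\<close>

lemma \<beta>_u:
  assumes g: "g \<in> arrs e e'"
  shows "\<beta> g (u e) = u e'"
proof -
  have e: "e \<in> idents G" "e' \<in> idents G" using arrsD[OF g] by auto
  obtain a where a: "a \<in> E e" "\<beta> g a = u e'"
    using \<beta>_bij[OF g] u_mem[OF e(2)] unfolding bij_betw_def by (metis imageE)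
  have "\<beta> g (u e) = \<beta> g (u e) \<otimes> u e'" using e \<beta>_mem[OF g] by (simp add: u_right)
  also have "\<dots> = u e'"
    using a e \<beta>_hom(2)[OF g u_mem a(1)] by (simp add: u_left)
  finally show ?thesis .
qed

lemma \<beta>_finsum:
  assumes g: "g \<in> arrs e e'" and "finite A" "\<And>i. i \<in> A \<Longrightarrow> f i \<in> E e"
  shows "\<beta> g (\<Oplus>i\<in>A. f i) = (\<Oplus>i\<in>A. \<beta> g (f i))"
  by (rule R.finsum_additive[where S = "E e"])
    (use assms(2,3) arrsD(4)[OF g] in \<open>auto simp: E_sub E_zero E_add \<beta>_zero[OF g] \<beta>_hom[OF g]
      \<beta>_carrier[OF g] R.abelian_monoid_axioms\<close>)

text \<open>The hypothesis that the invariants are the scalars enters here. It is applied to the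
  idempotent of a connected component and to the family of traces of an element.\<close>

lemma invariant_scalar:
  assumes "w \<in> carrier R" "\<And>g e e'. g \<in> arrs e e' \<Longrightarrow> \<beta> g (w \<otimes> u e) = w \<otimes> u e'"
  shows "\<exists>k\<in>carrier K. \<forall>r\<in>carrier R. k \<odot> r = w \<otimes> r"
proof -
  have "w \<in> invariants G R u \<beta>" using assms arrsI by (auto simp: invariants_def)
  then obtain k where "k \<in> carrier K" "w = k \<odot> \<one>" using inv by auto
  then show ?thesis by (intro bexI[of _ k]) (auto simp: KR.smult_assoc2)
qed

text \<open>By orthogonality, multiplication by \<open>u e\<close> is the projection onto the
  component at \<open>e\<close>.\<close>

lemma sum_mult_u:
  assumes e: "e \<in> idents G" and S: "S \<subseteq> idents G" and f: "\<And>e'. e' \<in> S \<Longrightarrow> f e' \<in> E e'"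
  shows "(\<Oplus>e'\<in>S. f e') \<otimes> u e = (if e \<in> S then f e else \<zero>)"
proof -
  have fc: "f e' \<in> carrier R" if "e' \<in> S" for e' using f that S E_sub by blast
  have finS: "finite S" using finite_subset[OF S fin_idents] .
  have "(\<Oplus>e'\<in>S. f e') \<otimes> u e = (\<Oplus>e'\<in>S. f e' \<otimes> u e)"
    using finS e fc by (intro R.finsum_ldistr) auto
  also have "\<dots> = (\<Oplus>e'\<in>S. if e = e' then f e' else \<zero>)"
  proof (rule R.finsum_cong')
    show "f e' \<otimes> u e = (if e = e' then f e' else \<zero>)" if "e' \<in> S" for e'
      using f[OF that] that S e u_right E_orthogonal[of e' e "f e'" "u e"] by auto
  qed (use fc in auto)
  also have "\<dots> = (if e \<in> S then f e else \<zero>)"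
  proof (cases "e \<in> S")
    case True
    then show ?thesis using R.finsum_singleton[of e S f] finS fc by auto
  next
    case False
    then have "(\<Oplus>e'\<in>S. if e = e' then f e' else \<zero>) = (\<Oplus>e'\<in>S. \<zero>)"
      by (intro R.finsum_cong') auto
    then show ?thesis using False by (simp add: R.finsum_zero)
  qed
  finally show ?thesis .
qed

text \<open>The identity of the sum of the \<open>E e'\<close> over a connected component is invariant, hence a scalar;
  it annihilates the remaining \<open>E e'\<close>, which are faithful.\<close>

lemma connected:
  assumes e: "e \<in> idents G" "e' \<in> idents G"
  shows "arrs e e' \<noteq> {}"
proof
  assume no: "arrs e e' = {}"
  define C where "C = {f \<in> idents G. arrs e f \<noteq> {}}"
  define w where "w = (\<Oplus>f\<in>C. u f)"
  have wu: "w \<otimes> u f = (if f \<in> C then u f else \<zero>)" if "f \<in> idents G" for f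
    unfolding w_def using that by (intro sum_mult_u) (auto simp: C_def)
  have w: "w \<in> carrier R" unfolding w_def by (intro R.finsum_closed) (auto simp: C_def)
  have "\<exists>k\<in>carrier K. \<forall>r\<in>carrier R. k \<odot> r = w \<otimes> r"
  proof (rule invariant_scalar[OF w])
    fix g f f' assume g: "g \<in> arrs f f'"
    have "f \<in> C \<longleftrightarrow> f' \<in> C"
      unfolding C_def
      using gmult_arrs[OF g] gmult_arrs[OF ginv_arrs[OF g]] arrsD(4,5)[OF g] by blast
    then show "\<beta> g (w \<otimes> u f) = w \<otimes> u f'"
      using arrsD(4,5)[OF g] \<beta>_u[OF g] \<beta>_zero[OF g] by (simp add: wu)
  qed
  then obtain k where k: "k \<in> carrier K" "\<And>r. r \<in> carrier R \<Longrightarrow> k \<odot> r = w \<otimes> r"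
    by blast
  have "k \<odot> u e' = \<zero>" using k e no by (simp add: wu C_def)
  then have "k = \<zero>\<^bsub>K\<^esub>" using E_faithful[OF e(2) k(1) K.zero_closed] e by simp
  moreover have "k \<odot> u e = u e" using k e ident_arrs[OF e(1)] by (auto simp: wu C_def)
  ultimately show False using u_ne[OF e(1)] e by simp
qed

section \<open>The trace from one component to the scalars\<close>

definition tr :: "'g \<Rightarrow> 'g \<Rightarrow> 'r \<Rightarrow> 'r" where
  "tr e e' a = (\<Oplus>g\<in>arrs e e'. \<beta> g a)"

lemma tr_mem: "e' \<in> idents G \<Longrightarrow> a \<in> E e \<Longrightarrow> tr e e' a \<in> E e'"
  unfolding tr_def by (intro E_finsum) (auto simp: \<beta>_mem)

text \<open>The family of the \<open>tr e e' a\<close> is an invariant element of \<open>R\<close>, so it is a scalar.\<close>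

definition trace :: "'g \<Rightarrow> 'r \<Rightarrow> 'k" where
  "trace e a = (SOME k. k \<in> carrier K \<and> (\<forall>e'\<in>idents G. k \<odot> u e' = tr e e' a))"

lemma \<beta>_tr:
  assumes h: "h \<in> arrs e' e''" and a: "a \<in> E e"
  shows "\<beta> h (tr e e' a) = tr e e'' a"
proof -
  have "\<beta> h (tr e e' a) = (\<Oplus>g\<in>arrs e e'. \<beta> h (\<beta> g a))"
    unfolding tr_def using a by (intro \<beta>_finsum[OF h]) (auto simp: \<beta>_mem)
  also have "\<dots> = (\<Oplus>g\<in>arrs e e'. \<beta> (gmult G h g) a)"
    using \<beta>_comp[OF h _ a] \<beta>_carrier[OF gmult_arrs[OF h] a] by (intro R.finsum_cong') auto
  also have "\<dots> = tr e e'' a"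
    unfolding tr_def using bij_betw_gmult[OF h, of e] a \<beta>_carrier
    by (subst R.finsum_reindex[symmetric]) (auto simp: bij_betw_def)
  finally show ?thesis .
qed

lemma trace:
  assumes e: "e \<in> idents G" and a: "a \<in> E e"
  shows "trace e a \<in> carrier K" "\<And>e'. e' \<in> idents G \<Longrightarrow> trace e a \<odot> u e' = tr e e' a"
proof -
  define w where "w = (\<Oplus>e'\<in>idents G. tr e e' a)"
  have wu: "w \<otimes> u f = tr e f a" if "f \<in> idents G" for f
    unfolding w_def using that by (subst sum_mult_u) (auto simp: tr_mem a)
  have w: "w \<in> carrier R" unfolding w_def using tr_mem E_sub a by (intro R.finsum_closed) auto
  have "\<exists>k\<in>carrier K. \<forall>r\<in>carrier R. k \<odot> r = w \<otimes> r"
    using invariant_scalar[OF w] wu arrsD(4,5) \<beta>_tr a by metis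
  then have "\<exists>k. k \<in> carrier K \<and> (\<forall>e'\<in>idents G. k \<odot> u e' = tr e e' a)" using wu by auto
  from someI_ex[OF this] show "trace e a \<in> carrier K"
    "\<And>e'. e' \<in> idents G \<Longrightarrow> trace e a \<odot> u e' = tr e e' a"
    unfolding trace_def by blast+
qed

text \<open>Faithfulness of the single ideal \<open>E e\<close> allows a candidate for the trace to
  be tested at \<open>e\<close> alone, so the computations below involve only loops at
  \<open>e\<close>.\<close>

lemma trace_eqI:
  assumes "e \<in> idents G" "a \<in> E e" "k \<in> carrier K" "k \<odot> u e = tr e e a"
  shows "trace e a = k"
  using assms trace E_faithful by metis

lemma trace_add:
  assumes e: "e \<in> idents G" and a: "a \<in> E e" "b \<in> E e"
  shows "trace e (a \<oplus> b) = trace e a \<oplus>\<^bsub>K\<^esub> trace e b"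
proof (rule trace_eqI)
  have "tr e e (a \<oplus> b) = (\<Oplus>g\<in>arrs e e. \<beta> g a \<oplus> \<beta> g b)"
    unfolding tr_def using a \<beta>_carrier by (intro R.finsum_cong') (auto simp: \<beta>_hom)
  also have "\<dots> = tr e e a \<oplus> tr e e b"
    unfolding tr_def using a \<beta>_carrier by (intro R.finsum_addf) auto
  finally show "(trace e a \<oplus>\<^bsub>K\<^esub> trace e b) \<odot> u e = tr e e (a \<oplus> b)"
    using e a trace by (simp add: KR.smult_l_distr)
qed (use assms trace E_add in auto)

lemma trace_smult:
  assumes e: "e \<in> idents G" and a: "a \<in> E e" and k: "k \<in> carrier K"
  shows "trace e (k \<odot> a) = k \<otimes>\<^bsub>K\<^esub> trace e a"
proof (rule trace_eqI)
  have "tr e e (k \<odot> a) = (\<Oplus>g\<in>arrs e e. k \<odot> \<beta> g a)"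
    unfolding tr_def using a k \<beta>_carrier by (intro R.finsum_cong') (auto simp: \<beta>_smult)
  also have "\<dots> = k \<odot> tr e e a"
    unfolding tr_def using a k \<beta>_carrier by (intro KR.finsum_smult_ldistr[symmetric]) auto
  finally show "(k \<otimes>\<^bsub>K\<^esub> trace e a) \<odot> u e = tr e e (k \<odot> a)"
    using e a k trace by (simp add: KR.smult_assoc1)
qed (use assms trace E_smult in auto)

lemma trace_zero: "e \<in> idents G \<Longrightarrow> trace e \<zero> = \<zero>\<^bsub>K\<^esub>"
  using trace_smult[of e "u e" "\<zero>\<^bsub>K\<^esub>"] trace(1) by simp

section \<open>Galois coordinates at one object and the dual basis\<close>

definition coords :: "'g \<Rightarrow> nat \<Rightarrow> (nat \<Rightarrow> 'r) \<Rightarrow> (nat \<Rightarrow> 'r) \<Rightarrow> bool" where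
  "coords e n v w \<longleftrightarrow> (\<forall>i<n. v i \<in> E e \<and> w i \<in> E e) \<and>
     (\<forall>g\<in>arrs e e. (\<Oplus>i\<in>{..<n}. v i \<otimes> \<beta> g (w i)) = (if g = e then u e else \<zero>))"

lemma ex_coords:
  assumes e: "e \<in> idents G"
  shows "\<exists>n v w. coords e n v w"
proof -
  obtain m :: nat and x y where x: "x \<in> {..<m} \<rightarrow> carrier R" and y: "y \<in> {..<m} \<rightarrow> carrier R"
    and xy: "\<And>g. g \<in> arr G \<Longrightarrow>
      (\<Oplus>i\<in>{..<m}. x i \<otimes> \<beta> g (y i \<otimes> u (grng G (ginv G g)))) =
        (if g \<in> idents G then u (grng G g) else \<zero>)"
    using galois unfolding has_galois_coordinates_def by blast
  have xc: "x i \<in> carrier R" and yc: "y i \<in> carrier R" if "i < m" for i using x y that by auto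
  have yu: "y i \<otimes> u e \<in> E e" and xu: "x i \<otimes> u e \<in> E e" if "i < m" for i
    using e xc yc that by (auto intro: E_mult_left)
  have "coords e m (\<lambda>i. x i \<otimes> u e) (\<lambda>i. y i \<otimes> u e)"
    unfolding coords_def
  proof (intro conjI ballI allI impI yu xu)
    fix g assume g: "g \<in> arrs e e"
    have c: "\<beta> g (y i \<otimes> u e) \<in> carrier R" if "i < m" for i by (rule \<beta>_carrier[OF g yu[OF that]])
    have "(\<Oplus>i\<in>{..<m}. x i \<otimes> u e \<otimes> \<beta> g (y i \<otimes> u e))
        = (\<Oplus>i\<in>{..<m}. u e \<otimes> (x i \<otimes> \<beta> g (y i \<otimes> u e)))"
      using c xc e by (intro R.finsum_cong') (auto simp: R.m_ac)
    also have "\<dots> = u e \<otimes> (\<Oplus>i\<in>{..<m}. x i \<otimes> \<beta> g (y i \<otimes> u e))"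
      using c xc e by (intro R.finsum_rdistr[symmetric]) auto
    also have "(\<Oplus>i\<in>{..<m}. x i \<otimes> \<beta> g (y i \<otimes> u e)) = (if g \<in> idents G then u e else \<zero>)"
      using xy[of g] arrsD[OF g] by simp
    \<comment> \<open>The only identity among the loops at \<open>e\<close> is \<open>e\<close>
      itself, so the dichotomy of the Galois condition becomes \<open>g = e\<close>.\<close>
    also have "g \<in> idents G \<longleftrightarrow> g = e" using e arrsD[OF g] identsD(2)[of g] by auto
    finally show "(\<Oplus>i\<in>{..<m}. x i \<otimes> u e \<otimes> \<beta> g (y i \<otimes> u e))
        = (if g = e then u e else \<zero>)" using e by (simp add: u_left)
  qed auto
  then show ?thesis by blast
qed

text \<open>After the sums are exchanged, orthogonality removes every loop except \<open>e\<close>.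
  The family \<open>c\<close> will be the translates \<open>\<beta> g a\<close> of an element in
  \<open>coords_trace\<close>, and the translated values of a function at a point in
  \<open>A_splits\<close>.\<close>

lemma coords_sum:
  assumes e: "e \<in> idents G" and vw: "coords e n v w" and c: "\<And>g. g \<in> arrs e e \<Longrightarrow> c g \<in> E e"
  shows "(\<Oplus>i\<in>{..<n}. v i \<otimes> (\<Oplus>g\<in>arrs e e. \<beta> g (w i) \<otimes> c g)) = c e"
proof -
  have v: "v i \<in> carrier R" and w: "w i \<in> E e" if "i < n" for i
    using vw that e E_sub unfolding coords_def by auto
  have bw: "\<beta> g (w i) \<in> carrier R" if "i < n" "g \<in> arrs e e" for g i
    using that w \<beta>_carrier by blast
  have cc: "c g \<in> carrier R" if "g \<in> arrs e e" for g using that c E_sub e by blast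
  have "(\<Oplus>i\<in>{..<n}. v i \<otimes> (\<Oplus>g\<in>arrs e e. \<beta> g (w i) \<otimes> c g))
      = (\<Oplus>i\<in>{..<n}. \<Oplus>g\<in>arrs e e. v i \<otimes> \<beta> g (w i) \<otimes> c g)"
  proof (rule R.finsum_cong')
    fix i assume "i \<in> {..<n}"
    then have i: "i < n" by simp
    have "v i \<otimes> (\<Oplus>g\<in>arrs e e. \<beta> g (w i) \<otimes> c g)
        = (\<Oplus>g\<in>arrs e e. v i \<otimes> (\<beta> g (w i) \<otimes> c g))"
      using v bw cc i by (intro R.finsum_rdistr) auto
    also have "\<dots> = (\<Oplus>g\<in>arrs e e. v i \<otimes> \<beta> g (w i) \<otimes> c g)"
      using v bw cc i by (intro R.finsum_cong') (auto simp: R.m_assoc)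
    finally show "v i \<otimes> (\<Oplus>g\<in>arrs e e. \<beta> g (w i) \<otimes> c g)
        = (\<Oplus>g\<in>arrs e e. v i \<otimes> \<beta> g (w i) \<otimes> c g)" .
  qed (use v bw cc in \<open>auto intro!: R.finsum_closed\<close>)
  also have "\<dots> = (\<Oplus>g\<in>arrs e e. \<Oplus>i\<in>{..<n}. v i \<otimes> \<beta> g (w i) \<otimes> c g)"
    using v bw cc by (intro R.finsum_swap) auto
  also have "\<dots> = (\<Oplus>g\<in>arrs e e. if e = g then c g else \<zero>)"
  proof (rule R.finsum_cong')
    fix g assume g: "g \<in> arrs e e"
    have "(\<Oplus>i\<in>{..<n}. v i \<otimes> \<beta> g (w i) \<otimes> c g)
        = (\<Oplus>i\<in>{..<n}. v i \<otimes> \<beta> g (w i)) \<otimes> c g"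
      using v bw cc g by (intro R.finsum_ldistr[symmetric]) auto
    also have "(\<Oplus>i\<in>{..<n}. v i \<otimes> \<beta> g (w i)) = (if g = e then u e else \<zero>)"
      using vw g by (simp add: coords_def)
    finally show "(\<Oplus>i\<in>{..<n}. v i \<otimes> \<beta> g (w i) \<otimes> c g) = (if e = g then c g else \<zero>)"
      using c[OF g] cc[OF g] e by (auto simp: u_left)
  qed (use cc in auto)
  also have "\<dots> = c e"
    using R.finsum_singleton[of e "arrs e e" c] ident_arrs[OF e] cc by auto
  finally show ?thesis .
qed

text \<open>The dual basis property of the \<open>v i\<close> and the functionals
  \<open>trace e (w i \<otimes> a)\<close> of \<open>a\<close>. It is \<open>coords_sum\<close> for
  the translates of \<open>a\<close>, because the trace of \<open>w i \<otimes> a\<close> is the sum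
  of the products of translates.\<close>

lemma coords_trace:
  assumes e: "e \<in> idents G" and vw: "coords e n v w" and a: "a \<in> E e"
  shows "(\<Oplus>i\<in>{..<n}. trace e (w i \<otimes> a) \<odot> v i) = a"
proof -
  have v: "v i \<in> E e" and w: "w i \<in> E e" if "i < n" for i
    using vw that unfolding coords_def by auto
  have wa: "w i \<otimes> a \<in> E e" if "i < n" for i using w[OF that] a e E_sub by (auto intro: E_mult_left)
  have "(\<Oplus>i\<in>{..<n}. trace e (w i \<otimes> a) \<odot> v i)
      = (\<Oplus>i\<in>{..<n}. v i \<otimes> (\<Oplus>g\<in>arrs e e. \<beta> g (w i) \<otimes> \<beta> g a))"
  proof (rule R.finsum_cong')
    fix i assume "i \<in> {..<n}"
    then have i: "i < n" by simp
    have "trace e (w i \<otimes> a) \<odot> v i = trace e (w i \<otimes> a) \<odot> (v i \<otimes> u e)"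
      using e v[OF i] by (simp add: u_right)
    also have "\<dots> = v i \<otimes> tr e e (w i \<otimes> a)"
      using trace[OF e wa[OF i]] v[OF i] e E_sub by (simp flip: KR.smult_assoc_right)
    also have "tr e e (w i \<otimes> a) = (\<Oplus>g\<in>arrs e e. \<beta> g (w i) \<otimes> \<beta> g a)"
      unfolding tr_def using w[OF i] a \<beta>_carrier by (intro R.finsum_cong') (auto simp: \<beta>_hom)
    finally show "trace e (w i \<otimes> a) \<odot> v i
        = v i \<otimes> (\<Oplus>g\<in>arrs e e. \<beta> g (w i) \<otimes> \<beta> g a)" .
  qed (use v w a e E_sub \<beta>_carrier in \<open>auto intro!: R.finsum_closed R.m_closed\<close>)
  also have "\<dots> = \<beta> e a" using e vw a \<beta>_mem by (intro coords_sum) auto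
  finally show ?thesis using e a \<beta>_ident by simp
qed

text \<open>The image of the trace is an ideal of \<open>K\<close>, and the dual basis writes every
  element of \<open>E e\<close> with coefficients in it. The determinant trick gives an element of
  this ideal that acts on \<open>E e\<close> as the identity, and by faithfulness this element is
  1.\<close>

lemma trace_surj:
  assumes e: "e \<in> idents G"
  shows "\<exists>c\<in>E e. trace e c = \<one>\<^bsub>K\<^esub>"
proof -
  interpret EA: module K "EA e" using EA_algebra[OF e] by (rule algebra.axioms)
  obtain n v w where vw: "coords e n v w" using ex_coords[OF e] by blast
  have v: "v i \<in> E e" and w: "w i \<in> E e" if "i < n" for i
    using vw that unfolding coords_def by auto
  have I: "ideal (trace e ` E e) K"
  proof (rule idealI)
    show "subgroup (trace e ` E e) (add_monoid K)"
    proof (rule K.add.subgroupI)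
      show "trace e ` E e \<subseteq> carrier K" using trace(1)[OF e] by auto
      show "trace e ` E e \<noteq> {}" using u_mem[OF e] by blast
      show "\<ominus>\<^bsub>K\<^esub> x \<in> trace e ` E e" if x: "x \<in> trace e ` E e" for x
      proof -
        obtain a where a: "a \<in> E e" "x = trace e a" using x by auto
        have "trace e ((\<ominus>\<^bsub>K\<^esub> \<one>\<^bsub>K\<^esub>) \<odot> a) = \<ominus>\<^bsub>K\<^esub> x"
          using trace_smult[OF e a(1)] trace(1)[OF e a(1)] a(2) by (simp add: K.l_minus)
        then show ?thesis using E_smult[OF e a(1)] by (metis K.a_inv_closed K.one_closed image_eqI)
      qed
      show "x \<oplus>\<^bsub>K\<^esub> y \<in> trace e ` E e" if "x \<in> trace e ` E e" "y \<in> trace e ` E e" for x y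
        using that by (auto simp flip: trace_add[OF e] intro!: imageI E_add[OF e])
    qed
    show l: "x \<otimes>\<^bsub>K\<^esub> k \<in> trace e ` E e" if "k \<in> trace e ` E e" "x \<in> carrier K" for k x
      using that by (auto simp flip: trace_smult[OF e] intro!: imageI E_smult[OF e])
    show "k \<otimes>\<^bsub>K\<^esub> x \<in> trace e ` E e" if "k \<in> trace e ` E e" "x \<in> carrier K" for k x
      using l[OF that] that trace(1)[OF e] K.m_comm by auto
  qed (rule K.ring_axioms)
  have "\<exists>k\<in>trace e ` E e. \<forall>x\<in>carrier (EA e). k \<odot>\<^bsub>EA e\<^esub> x = x"
  proof (rule EA.ideal_mult_eq_imp_fixes[OF I])
    show "v \<in> {..<n} \<rightarrow> carrier (EA e)" using v by auto
    fix a assume "a \<in> carrier (EA e)"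
    then have a: "a \<in> E e" by simp
    have wa: "w i \<otimes> a \<in> E e" if "i < n" for i
      using w[OF that] a e E_sub by (auto intro: E_mult_left)
    have "(\<Oplus>\<^bsub>EA e\<^esub>i\<in>{..<n}. trace e (w i \<otimes> a) \<odot>\<^bsub>EA e\<^esub> v i)
        = id (\<Oplus>\<^bsub>EA e\<^esub>i\<in>{..<n}. trace e (w i \<otimes> a) \<odot>\<^bsub>EA e\<^esub> v i)" by simp
    also have "\<dots> = (\<Oplus>i\<in>{..<n}. id (trace e (w i \<otimes> a) \<odot>\<^bsub>EA e\<^esub> v i))"
      by (rule EA.M.finsum_additive[where S = "E e"])
        (use e wa v trace(1) in \<open>auto simp: E_sub E_zero E_add E_smult R.abelian_monoid_axioms\<close>)
    also have "\<dots> = a" using coords_trace[OF e vw a] by simp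
    finally show "\<exists>c\<in>{..<n} \<rightarrow> trace e ` E e. a = (\<Oplus>\<^bsub>EA e\<^esub>i\<in>{..<n}. c i \<odot>\<^bsub>EA e\<^esub> v i)"
      using wa by (intro bexI[of _ "\<lambda>i. trace e (w i \<otimes> a)"]) auto
  qed
  then obtain c where c: "c \<in> E e" "trace e c \<odot> u e = u e" using e by auto
  have "trace e c = \<one>\<^bsub>K\<^esub>" using E_faithful[OF e trace(1)[OF e c(1)] K.one_closed] c e by simp
  then show ?thesis using c(1) by blast
qed

section \<open>The splitting of \<open>A(X)\<close>\<close>

text \<open>Some piece contains a point, and a connecting arrow carries it to the piece at
  \<open>e\<close>. This supplies the bound \<open>m \<ge> 1\<close> in the splitting of
  \<open>A X\<close>.\<close>

lemma gsub_nonempty: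
  assumes "split_gset X" "e \<in> idents G"
  shows "gsub X e \<noteq> {}"
proof -
  obtain x where x: "x \<in> gcar X"
    using split_gsetD(1)[OF assms(1)] unfolding is_gset_def by blast
  obtain g where "g \<in> arrs (pos X x) e"
    using connected[OF pos(1)[OF split_gsetD(2)[OF assms(1)] x] assms(2)] by blast
  then show ?thesis
    using gact_mem[OF split_gsetD(1)[OF assms(1)]] pos(2)[OF split_gsetD(2)[OF assms(1)] x] by blast
qed

section \<open>The algebra of equivariant functions\<close>

abbreviation A :: "('g, 'x) gset \<Rightarrow> ('k, 'x \<Rightarrow> 'r) module" where
  "A \<equiv> A_alg G R E u \<beta>"

lemma A_simps:
  "\<one>\<^bsub>A X\<^esub> = (\<lambda>x\<in>gcar X. u (pos X x))"
  "\<zero>\<^bsub>A X\<^esub> = (\<lambda>x\<in>gcar X. \<zero>)"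
  "f \<otimes>\<^bsub>A X\<^esub> h = (\<lambda>x\<in>gcar X. f x \<otimes> h x)"
  "f \<oplus>\<^bsub>A X\<^esub> h = (\<lambda>x\<in>gcar X. f x \<oplus> h x)"
  "k \<odot>\<^bsub>A X\<^esub> f = (\<lambda>x\<in>gcar X. k \<odot> f x)"
  by (simp_all add: A_alg_def pos_def)

lemma A_memD:
  assumes X: "split_gset X" and f: "f \<in> carrier (A X)"
  shows "f \<in> extensional (gcar X)" "\<And>e x. e \<in> idents G \<Longrightarrow> x \<in> gsub X e \<Longrightarrow> f x \<in> E e"
    "\<And>x. x \<in> gcar X \<Longrightarrow> f x \<in> E (pos X x)" "\<And>x. x \<in> gcar X \<Longrightarrow> f x \<in> carrier R"
    "\<And>g e e' x. g \<in> arrs e e' \<Longrightarrow> x \<in> gsub X e \<Longrightarrow> \<beta> g (f x) = f (gact X g x)"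
proof -
  show "f \<in> extensional (gcar X)" using f by (simp add: A_alg_def Map_set_def PiE_def)
  show E: "f x \<in> E e" if "e \<in> idents G" "x \<in> gsub X e" for e x
    using f that identsD(1) unfolding A_alg_def Map_set_def by fastforce
  note pos = pos[OF split_gsetD(2)[OF X]]
  show "f x \<in> E (pos X x)" if "x \<in> gcar X" for x using E[OF pos[OF that]] .
  then show "f x \<in> carrier R" if "x \<in> gcar X" for x using E_sub[OF pos(1)[OF that]] that by simp
  show "\<beta> g (f x) = f (gact X g x)" if "g \<in> arrs e e'" "x \<in> gsub X e" for g e e' x
    using f that arrsD(1) gset_gsub(2)[OF split_gsetD(1)[OF X]] by (simp add: A_alg_def)
qed

lemma A_memI:
  assumes X: "split_gset X" and "f \<in> extensional (gcar X)"
    and E: "\<And>e x. e \<in> idents G \<Longrightarrow> x \<in> gsub X e \<Longrightarrow> f x \<in> E e"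
    and "\<And>g e e' x. g \<in> arrs e e' \<Longrightarrow> x \<in> gsub X e \<Longrightarrow> \<beta> g (f x) = f (gact X g x)"
  shows "f \<in> carrier (A X)"
proof -
  have "f x \<in> carrier R" if "x \<in> gcar X" for x
    using E_sub[OF _ E] pos[OF split_gsetD(2)[OF X] that] by blast
  moreover have "f ` gsub X g \<subseteq> E g" if "g \<in> arr G" for g
    using E[of "grng G g"] gset_gsub(1)[OF split_gsetD(1)[OF X] arrsI[OF that]]
      E_arrow[OF arrsI[OF that]] that by auto
  moreover have "\<beta> g (f x) = f (gact X g x)" if "g \<in> arr G" "x \<in> gsub X (ginv G g)" for g x
    using assms(4)[OF arrsI] gset_gsub(2)[OF split_gsetD(1)[OF X] arrsI] that by simp
  ultimately show ?thesis using assms(2) by (simp add: A_alg_def Map_set_def PiE_def)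
qed

lemma A_ext:
  assumes X: "split_gset X" and "f \<in> carrier (A X)" "h \<in> carrier (A X)"
    and "\<And>x. x \<in> gcar X \<Longrightarrow> f x = h x"
  shows "f = h"
  using A_memD(1)[OF X] assms extensionalityI by metis

lemma A_restrict_eq:
  assumes X: "split_gset X" and "f \<in> carrier (A X)" "\<And>x. x \<in> gcar X \<Longrightarrow> F x = f x"
  shows "(\<lambda>x\<in>gcar X. F x) = f"
  using A_memD(1)[OF X assms(2)] assms(3) by (intro extensionalityI[of _ "gcar X"]) auto

lemma A_closed:
  assumes X: "split_gset X"
  shows "\<zero>\<^bsub>A X\<^esub> \<in> carrier (A X)" "\<one>\<^bsub>A X\<^esub> \<in> carrier (A X)"
    "\<And>f h. f \<in> carrier (A X) \<Longrightarrow> h \<in> carrier (A X) \<Longrightarrow> f \<oplus>\<^bsub>A X\<^esub> h \<in> carrier (A X)"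
    "\<And>f h. f \<in> carrier (A X) \<Longrightarrow> h \<in> carrier (A X) \<Longrightarrow> f \<otimes>\<^bsub>A X\<^esub> h \<in> carrier (A X)"
    "\<And>k f. k \<in> carrier K \<Longrightarrow> f \<in> carrier (A X) \<Longrightarrow> k \<odot>\<^bsub>A X\<^esub> f \<in> carrier (A X)"
proof -
  note X' = split_gsetD[OF X]
  note c = gsub_gcar[OF X'(1)]
  have c': "x \<in> gcar X" "gact X g x \<in> gcar X" if "g \<in> arrs e e'" "x \<in> gsub X e" for g e e' x
    using that c arrsD(4,5)[OF that(1)] gact_mem[OF X'(1) that] by auto
  show "\<zero>\<^bsub>A X\<^esub> \<in> carrier (A X)" unfolding A_simps
    by (rule A_memI[OF X]) (auto simp: c c' E_zero \<beta>_zero)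
  show "\<one>\<^bsub>A X\<^esub> \<in> carrier (A X)" unfolding A_simps
  proof (rule A_memI[OF X])
    fix g e e' x assume gx: "g \<in> arrs e e'" "x \<in> gsub X e"
    then show "\<beta> g ((\<lambda>x\<in>gcar X. u (pos X x)) x) = (\<lambda>x\<in>gcar X. u (pos X x)) (gact X g x)"
      using c'[OF gx] pos_eq[OF X'(2)] arrsD(4,5)[OF gx(1)] gact_mem[OF X'(1) gx] \<beta>_u[OF gx(1)]
      by simp
  qed (auto simp: c pos_eq[OF X'(2)])
  show "f \<oplus>\<^bsub>A X\<^esub> h \<in> carrier (A X)" if fh: "f \<in> carrier (A X)" "h \<in> carrier (A X)" for f h
    unfolding A_simps
  proof (rule A_memI[OF X])
    fix g e e' x assume gx: "g \<in> arrs e e'" "x \<in> gsub X e"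
    then show "\<beta> g ((\<lambda>x\<in>gcar X. f x \<oplus> h x) x) = (\<lambda>x\<in>gcar X. f x \<oplus> h x) (gact X g x)"
      using c'[OF gx] arrsD(4)[OF gx(1)] A_memD(2)[OF X fh(1)] A_memD(2)[OF X fh(2)]
        A_memD(5)[OF X fh(1) gx] A_memD(5)[OF X fh(2) gx] \<beta>_hom(1)[OF gx(1)] by simp
  qed (auto simp: c A_memD(2)[OF X fh(1)] A_memD(2)[OF X fh(2)] E_add)
  show "f \<otimes>\<^bsub>A X\<^esub> h \<in> carrier (A X)" if fh: "f \<in> carrier (A X)" "h \<in> carrier (A X)" for f h
    unfolding A_simps
  proof (rule A_memI[OF X])
    fix g e e' x assume gx: "g \<in> arrs e e'" "x \<in> gsub X e"
    then show "\<beta> g ((\<lambda>x\<in>gcar X. f x \<otimes> h x) x) = (\<lambda>x\<in>gcar X. f x \<otimes> h x) (gact X g x)"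
      using c'[OF gx] arrsD(4)[OF gx(1)] A_memD(2)[OF X fh(1)] A_memD(2)[OF X fh(2)]
        A_memD(5)[OF X fh(1) gx] A_memD(5)[OF X fh(2) gx] \<beta>_hom(2)[OF gx(1)] by simp
  qed (auto simp: c A_memD(2)[OF X fh(1)] A_memD(4)[OF X fh(2)] E_mult_right)
  show "k \<odot>\<^bsub>A X\<^esub> f \<in> carrier (A X)" if k: "k \<in> carrier K" and f: "f \<in> carrier (A X)" for k f
    unfolding A_simps
  proof (rule A_memI[OF X])
    fix g e e' x assume gx: "g \<in> arrs e e'" "x \<in> gsub X e"
    then show "\<beta> g ((\<lambda>x\<in>gcar X. k \<odot> f x) x) = (\<lambda>x\<in>gcar X. k \<odot> f x) (gact X g x)"
      using c'[OF gx] arrsD(4)[OF gx(1)] A_memD(2)[OF X f] A_memD(5)[OF X f gx]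
        \<beta>_smult[OF gx(1) _ k] by simp
  qed (auto simp: c A_memD(2)[OF X f] E_smult k)
qed

lemma A_algebra:
  fixes X :: "('g, 'x) gset"
  assumes X: "split_gset X"
  shows "algebra K (A X)"
proof -
  note cl = A_closed[OF X] and X' = split_gsetD[OF X]
  note c = A_memD(4)[OF X]
  have um: "u (pos X x) \<otimes> f x = f x" if "x \<in> gcar X" "f \<in> carrier (A X)" for x f
    using u_left pos(1)[OF X'(2)] A_memD(3)[OF X] that by blast
  have ab: "abelian_group (A X)"
  proof (rule abelian_groupI)
    fix f assume f: "f \<in> carrier (A X)"
    \<comment> \<open>The negative is formed as a scalar multiple, so that its membership is an
      instance of closure under scalars.\<close>
    let ?h = "(\<ominus>\<^bsub>K\<^esub> \<one>\<^bsub>K\<^esub>) \<odot>\<^bsub>A X\<^esub> f"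
    have h: "?h \<in> carrier (A X)" using f by (intro cl) auto
    have "?h \<oplus>\<^bsub>A X\<^esub> f = \<zero>\<^bsub>A X\<^esub>"
      unfolding A_simps(4) by (rule A_restrict_eq[OF X cl(1)])
        (use f in \<open>simp add: A_simps c KR.smult_l_minus R.l_neg\<close>)
    then show "\<exists>h\<in>carrier (A X). h \<oplus>\<^bsub>A X\<^esub> f = \<zero>\<^bsub>A X\<^esub>" using h by blast
    show "\<zero>\<^bsub>A X\<^esub> \<oplus>\<^bsub>A X\<^esub> f = f"
      unfolding A_simps(4) by (rule A_restrict_eq[OF X f]) (use f in \<open>simp add: A_simps c\<close>)
    fix h assume h: "h \<in> carrier (A X)"
    show "f \<oplus>\<^bsub>A X\<^esub> h = h \<oplus>\<^bsub>A X\<^esub> f"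
      using f h by (auto simp: A_simps c R.a_comm intro!: restrict_ext)
    fix h' assume h': "h' \<in> carrier (A X)"
    show "f \<oplus>\<^bsub>A X\<^esub> h \<oplus>\<^bsub>A X\<^esub> h' = f \<oplus>\<^bsub>A X\<^esub> (h \<oplus>\<^bsub>A X\<^esub> h')"
      using f h h' by (auto simp: A_simps c R.a_assoc intro!: restrict_ext)
  qed (rule cl; assumption)+
  have cm: "comm_monoid (A X)"
  proof (rule comm_monoidI)
    fix f assume f: "f \<in> carrier (A X)"
    show "\<one>\<^bsub>A X\<^esub> \<otimes>\<^bsub>A X\<^esub> f = f"
      unfolding A_simps(3) by (rule A_restrict_eq[OF X f]) (use f um in \<open>simp add: A_simps\<close>)
    fix h assume h: "h \<in> carrier (A X)"
    show "f \<otimes>\<^bsub>A X\<^esub> h = h \<otimes>\<^bsub>A X\<^esub> f"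
      using f h by (auto simp: A_simps c R.m_comm intro!: restrict_ext)
    fix h' assume h': "h' \<in> carrier (A X)"
    show "f \<otimes>\<^bsub>A X\<^esub> h \<otimes>\<^bsub>A X\<^esub> h' = f \<otimes>\<^bsub>A X\<^esub> (h \<otimes>\<^bsub>A X\<^esub> h')"
      using f h h' by (auto simp: A_simps c R.m_assoc intro!: restrict_ext)
  qed (rule cl; assumption)+
  show ?thesis
  proof (rule algebraI)
    show "cring (A X)"
      by (rule cringI[OF ab cm]) (auto simp: A_simps c R.l_distr intro!: restrict_ext)
    show "\<one>\<^bsub>K\<^esub> \<odot>\<^bsub>A X\<^esub> f = f" if f: "f \<in> carrier (A X)" for f
      unfolding A_simps(5) by (rule A_restrict_eq[OF X f]) (use f in \<open>simp add: c\<close>)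
  qed (use K.cring_axioms cl(5) in \<open>auto simp: A_simps c KR.smult_l_distr KR.smult_r_distr
      KR.smult_assoc1 KR.smult_assoc2 intro!: restrict_ext\<close>)
qed

section \<open>Evaluation at points and averaging over arrows\<close>

definition pt :: "('g, 'x) gset \<Rightarrow> 'x \<Rightarrow> ('x \<Rightarrow> 'r) \<Rightarrow> 'r" where
  "pt X x = (\<lambda>f\<in>carrier (A X). f x)"

lemma pt_hom:
  assumes X: "split_gset X" and e: "e \<in> idents G" and x: "x \<in> gsub X e"
  shows "pt X x \<in> alg_hom K (A X) (EA e)"
proof (rule alg_homI)
  have xc: "x \<in> gcar X" using gsub_gcar[OF split_gsetD(1)[OF X] e x] .
  show "pt X x \<one>\<^bsub>A X\<^esub> = \<one>\<^bsub>EA e\<^esub>"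
    using A_closed(2)[OF X] xc pos_eq[OF split_gsetD(2)[OF X] e x] by (simp add: pt_def A_simps)
  fix f assume f: "f \<in> carrier (A X)"
  show "pt X x f \<in> carrier (EA e)" using A_memD(2)[OF X f e x] f by (simp add: pt_def)
  show "pt X x (k \<odot>\<^bsub>A X\<^esub> f) = k \<odot>\<^bsub>EA e\<^esub> pt X x f" if "k \<in> carrier K" for k
    using A_closed(5)[OF X that f] f xc by (simp add: pt_def A_simps)
  fix h assume h: "h \<in> carrier (A X)"
  show "pt X x (f \<otimes>\<^bsub>A X\<^esub> h) = pt X x f \<otimes>\<^bsub>EA e\<^esub> pt X x h"
    using A_closed(4)[OF X f h] f h xc by (simp add: pt_def A_simps)
  show "pt X x (f \<oplus>\<^bsub>A X\<^esub> h) = pt X x f \<oplus>\<^bsub>EA e\<^esub> pt X x h"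
    using A_closed(3)[OF X f h] f h xc by (simp add: pt_def A_simps)
qed

text \<open>The transfer from functions on the piece of \<open>X\<close> at \<open>e\<close> to
  equivariant functions on all of \<open>X\<close>: at \<open>x\<close>, the sum of the translates
  of \<open>F\<close> along all arrows from \<open>e\<close> to the position of \<open>x\<close>.
  Only values of \<open>F\<close> on the piece at \<open>e\<close> enter.\<close>

definition avg :: "('g, 'x) gset \<Rightarrow> 'g \<Rightarrow> ('x \<Rightarrow> 'r) \<Rightarrow> 'x \<Rightarrow> 'r" where
  "avg X e F = (\<lambda>x\<in>gcar X. \<Oplus>g\<in>arrs e (pos X x). \<beta> g (F (gact X (ginv G g) x)))"

lemma avg_eq:
  assumes X: "split_gset X" and e: "e' \<in> idents G" and x: "x \<in> gsub X e'"
  shows "avg X e F x = (\<Oplus>g\<in>arrs e e'. \<beta> g (F (gact X (ginv G g) x)))"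
  using gsub_gcar[OF split_gsetD(1)[OF X] e x] pos_eq[OF split_gsetD(2)[OF X] e x]
  by (simp add: avg_def)

text \<open>Applying \<open>\<beta> h\<close> to the term of \<open>g\<close> at \<open>x\<close>
  gives the term of \<open>gmult G h g\<close> at the translate of \<open>x\<close> by
  \<open>h\<close>, because the inverse of the composite leads back to the same point of the piece
  at \<open>e\<close>. Left translation then permutes the terms.\<close>

lemma avg_mem:
  assumes X: "split_gset X" and F: "\<And>x. x \<in> gsub X e \<Longrightarrow> F x \<in> E e"
  shows "avg X e F \<in> carrier (A X)"
proof (rule A_memI[OF X])
  note X' = split_gsetD[OF X]
  show "avg X e F \<in> extensional (gcar X)" by (simp add: avg_def)
  have Fg: "\<beta> g (F (gact X (ginv G g) x)) \<in> E e'" if "x \<in> gsub X e'" "g \<in> arrs e e'" for g e' x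
    using that by (intro \<beta>_mem[OF that(2)] F gact_mem[OF X'(1)] ginv_arrs)
  show "avg X e F x \<in> E e'" if "e' \<in> idents G" "x \<in> gsub X e'" for e' x
    unfolding avg_eq[OF X that] using that Fg by (intro E_finsum) auto
  fix h e' e'' x assume h: "h \<in> arrs e' e''" and x: "x \<in> gsub X e'"
  have e: "e' \<in> idents G" "e'' \<in> idents G" using arrsD[OF h] by auto
  have hx: "gact X h x \<in> gsub X e''" by (rule gact_mem[OF X'(1) h x])
  have "\<beta> h (avg X e F x) = (\<Oplus>g\<in>arrs e e'. \<beta> h (\<beta> g (F (gact X (ginv G g) x))))"
    unfolding avg_eq[OF X e(1) x] using x Fg by (intro \<beta>_finsum[OF h]) auto
  also have "\<dots> = (\<Oplus>g\<in>arrs e e'.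
      \<beta> (gmult G h g) (F (gact X (ginv G (gmult G h g)) (gact X h x))))"
  proof (rule R.finsum_cong')
    fix g assume g: "g \<in> arrs e e'"
    let ?y = "gact X (ginv G g) x"
    have y: "?y \<in> gsub X e" by (rule gact_mem[OF X'(1) ginv_arrs[OF g] x])
    have "gact X h x = gact X (gmult G h g) ?y"
      using gact_comp[OF X'(1) h g y] gact_ginv'[OF X'(1) g x] by simp
    then have "gact X (ginv G (gmult G h g)) (gact X h x) = ?y"
      using gact_ginv[OF X'(1) gmult_arrs[OF h g] y] by simp
    then show "\<beta> h (\<beta> g (F ?y))
        = \<beta> (gmult G h g) (F (gact X (ginv G (gmult G h g)) (gact X h x)))"
      using \<beta>_comp[OF h g F[OF y]] by simp
  next
    show "(\<lambda>g. \<beta> (gmult G h g) (F (gact X (ginv G (gmult G h g)) (gact X h x))))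
        \<in> arrs e e' \<rightarrow> carrier R"
      using Fg[OF hx gmult_arrs[OF h]] E_sub[OF e(2)] by auto
  qed simp
  also have "\<dots> = avg X e F (gact X h x)"
    unfolding avg_eq[OF X e(2) hx]
    using bij_betw_gmult[OF h, of e] Fg[OF hx] E_sub[OF e(2)]
      R.finsum_reindex[of "\<lambda>g. \<beta> g (F (gact X (ginv G g) (gact X h x)))" "gmult G h" "arrs e e'"]
    unfolding bij_betw_def by auto
  finally show "\<beta> h (avg X e F x) = avg X e F (gact X h x)" .
qed

lemma avg_cong:
  assumes X: "split_gset X" and "\<And>x. x \<in> gsub X e \<Longrightarrow> F x \<in> E e"
    and "\<And>x. x \<in> gsub X e \<Longrightarrow> F x = F' x"
  shows "avg X e F = avg X e F'"
proof (rule A_ext[OF X])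
  note X' = split_gsetD[OF X]
  show "avg X e F \<in> carrier (A X)" "avg X e F' \<in> carrier (A X)"
    using assms by (auto intro!: avg_mem)
  fix x assume x: "x \<in> gcar X"
  have m: "gact X (ginv G g) x \<in> gsub X e" if "g \<in> arrs e (pos X x)" for g
    using that x pos[OF X'(2)] by (intro gact_mem[OF X'(1)] ginv_arrs)
  show "avg X e F x = avg X e F' x"
    using x m assms \<beta>_carrier unfolding avg_def by (auto intro!: R.finsum_cong')
qed

lemma avg_add:
  assumes X: "split_gset X" and F: "\<And>x. x \<in> gsub X e \<Longrightarrow> F x \<in> E e"
    and F': "\<And>x. x \<in> gsub X e \<Longrightarrow> F' x \<in> E e" and e: "e \<in> idents G"
  shows "avg X e (\<lambda>x. F x \<oplus> F' x) = avg X e F \<oplus>\<^bsub>A X\<^esub> avg X e F'"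
proof (rule A_ext[OF X])
  note X' = split_gsetD[OF X]
  show "avg X e (\<lambda>x. F x \<oplus> F' x) \<in> carrier (A X)" using F F' e by (intro avg_mem[OF X] E_add)
  show "avg X e F \<oplus>\<^bsub>A X\<^esub> avg X e F' \<in> carrier (A X)" using F F' by (intro A_closed[OF X] avg_mem[OF X])
  fix x assume x: "x \<in> gcar X"
  have m: "gact X (ginv G g) x \<in> gsub X e" if "g \<in> arrs e (pos X x)" for g
    using that x pos[OF X'(2)] by (intro gact_mem[OF X'(1)] ginv_arrs)
  have "avg X e (\<lambda>x. F x \<oplus> F' x) x = (\<Oplus>g\<in>arrs e (pos X x).
      \<beta> g (F (gact X (ginv G g) x) \<oplus> F' (gact X (ginv G g) x)))"
    using x by (simp add: avg_def)
  also have "\<dots> = (\<Oplus>g\<in>arrs e (pos X x).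
      \<beta> g (F (gact X (ginv G g) x)) \<oplus> \<beta> g (F' (gact X (ginv G g) x)))"
    using F F' m \<beta>_carrier by (intro R.finsum_cong' \<beta>_hom(1)) blast+
  also have "\<dots> = avg X e F x \<oplus> avg X e F' x"
    using x F F' m \<beta>_carrier unfolding avg_def by (auto intro!: R.finsum_addf)
  finally show "avg X e (\<lambda>x. F x \<oplus> F' x) x = (avg X e F \<oplus>\<^bsub>A X\<^esub> avg X e F') x"
    using x by (simp add: A_simps)
qed

lemma avg_zero:
  assumes X: "split_gset X" and e: "e \<in> idents G"
  shows "avg X e (\<lambda>x. \<zero>) = \<zero>\<^bsub>A X\<^esub>"
proof -
  have "(\<Oplus>g\<in>arrs e e'. \<beta> g \<zero>) = \<zero>" for e'
    using R.finsum_cong'[of "arrs e e'" "arrs e e'" "\<lambda>_. \<zero>" "\<lambda>g. \<beta> g \<zero>"] \<beta>_zero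
    by (simp add: R.finsum_zero)
  then show ?thesis by (simp add: avg_def A_simps)
qed

text \<open>A projection formula. By equivariance of \<open>f\<close> every translate contributes
  the same factor \<open>f x\<close>, which leaves the sum; what remains is the sum of the
  translates of \<open>a\<close>, that is, its trace.\<close>

lemma avg_mult:
  assumes X: "split_gset X" and e: "e \<in> idents G" and a: "a \<in> E e" and f: "f \<in> carrier (A X)"
  shows "avg X e (\<lambda>x. a \<otimes> f x) = trace e a \<odot>\<^bsub>A X\<^esub> f"
proof (rule A_ext[OF X])
  note X' = split_gsetD[OF X]
  show "avg X e (\<lambda>x. a \<otimes> f x) \<in> carrier (A X)"
    using A_memD(2)[OF X f e] a e E_sub by (intro avg_mem[OF X] E_mult_left) auto
  show "trace e a \<odot>\<^bsub>A X\<^esub> f \<in> carrier (A X)" using trace(1)[OF e a] f by (intro A_closed[OF X])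
  fix x assume x: "x \<in> gcar X"
  define e' where "e' = pos X x"
  have e': "e' \<in> idents G" and xe': "x \<in> gsub X e'" using pos[OF X'(2) x] by (simp_all add: e'_def)
  have fx: "f x \<in> E e'" "f x \<in> carrier R" using A_memD(2)[OF X f e' xe'] E_sub e' by auto
  have "avg X e (\<lambda>x. a \<otimes> f x) x = (\<Oplus>g\<in>arrs e e'. \<beta> g a \<otimes> f x)"
    unfolding avg_eq[OF X e' xe']
  proof (rule R.finsum_cong')
    fix g assume g: "g \<in> arrs e e'"
    have y: "gact X (ginv G g) x \<in> gsub X e" by (rule gact_mem[OF X'(1) ginv_arrs[OF g] xe'])
    show "\<beta> g (a \<otimes> f (gact X (ginv G g) x)) = \<beta> g a \<otimes> f x"
      using \<beta>_hom(2)[OF g a A_memD(2)[OF X f e y]] A_memD(5)[OF X f g y] gact_ginv'[OF X'(1) g xe']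
      by simp
  qed (use \<beta>_carrier a fx in auto)
  also have "\<dots> = tr e e' a \<otimes> f x"
    unfolding tr_def using \<beta>_carrier a fx by (intro R.finsum_ldistr[symmetric]) auto
  also have "\<dots> = trace e a \<odot> f x"
    using trace[OF e a] e' fx by (simp add: KR.smult_assoc2 u_left flip: trace(2)[OF e a])
  finally show "avg X e (\<lambda>x. a \<otimes> f x) x = (trace e a \<odot>\<^bsub>A X\<^esub> f) x" using x by (simp add: A_simps)
qed

text \<open>A finite sum refers to the carrier of its structure, so the sums in \<open>EA e\<close>
  and in \<open>R\<close> are different terms. They are compared through the inclusion, which is
  additive.\<close>

lemma EA_finsum:
  assumes e: "e \<in> idents G" and "finite S" "\<And>i. i \<in> S \<Longrightarrow> f i \<in> E e"
  shows "(\<Oplus>\<^bsub>EA e\<^esub>i\<in>S. f i) = (\<Oplus>i\<in>S. f i)"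
proof -
  interpret EA: module K "EA e" using EA_algebra[OF e] by (rule algebra.axioms)
  have "id (\<Oplus>\<^bsub>EA e\<^esub>i\<in>S. f i) = (\<Oplus>i\<in>S. id (f i))"
    by (rule EA.M.finsum_additive[where S = "E e"])
      (use assms in \<open>auto simp: E_sub E_zero E_add R.abelian_monoid_axioms\<close>)
  then show ?thesis by simp
qed

text \<open>The ring operations of all \<open>EA e\<close> are those of \<open>R\<close>, so one
  evaluation serves every \<open>e\<close>; \<open>EA_ev\<close> identifies it with the evaluation
  of the locale \<open>algebra_pair\<close>.\<close>

definition ev :: "('b \<Rightarrow> 'r) \<Rightarrow> ('r \<times> 'b) list \<Rightarrow> 'r" where
  "ev \<phi> = tensor_lift R (\<lambda>x y. x \<otimes> \<phi> y)"

lemma EA_ev: "tensor_lift (EA e) (\<lambda>x y. x \<otimes>\<^bsub>EA e\<^esub> \<phi> y) = ev \<phi>"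
  by (simp add: ev_def tensor_lift_def fun_eq_iff)

lemma ev_map_upt:
  fixes n :: nat
  assumes "\<And>i. i < n \<Longrightarrow> v i \<otimes> \<phi> (b i) \<in> carrier R"
  shows "ev \<phi> (map (\<lambda>i. (v i, b i)) [0..<n]) = (\<Oplus>i\<in>{..<n}. v i \<otimes> \<phi> (b i))"
proof -
  have "ev \<phi> (map (\<lambda>i. (v i, b i)) xs) = (\<Oplus>i\<in>set xs. v i \<otimes> \<phi> (b i))"
    if "distinct xs" "set xs \<subseteq> {..<n}" for xs
    using that
  proof (induction xs)
    case (Cons i xs)
    have c: "v j \<otimes> \<phi> (b j) \<in> carrier R" if "j \<in> set (i # xs)" for j
      using Cons.prems(2) that assms by auto
    have "(\<Oplus>j\<in>insert i (set xs). v j \<otimes> \<phi> (b j))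
        = v i \<otimes> \<phi> (b i) \<oplus> (\<Oplus>j\<in>set xs. v j \<otimes> \<phi> (b j))"
      using Cons.prems(1) c by (intro R.finsum_insert) auto
    then show ?case using Cons by (simp add: ev_def)
  qed (simp add: ev_def)
  from this[of "[0..<n]"] show ?thesis by (simp add: atLeast0LessThan)
qed

text \<open>The inverse of \<open>E\<^sub>e \<otimes> A(X) \<rightarrow> Map(X\<^sub>e, E\<^sub>e)\<close> is \<open>F \<mapsto> \<Sum>\<^sub>i v\<^sub>i \<otimes> avg (w\<^sub>i F)\<close>.\<close>

lemma A_splits:
  fixes X :: "('g, 'x) gset"
  assumes X: "split_gset X" and e: "e \<in> idents G"
  shows "algebra_pair.splits K (EA e) (A X) (pt X ` gsub X e)" "inj_on (pt X) (gsub X e)"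
proof -
  note X' = split_gsetD[OF X]
  interpret P: algebra_pair K "EA e" "A X" by (rule E_pair[OF e A_algebra[OF X]])
  have Pev: "P.ev \<phi> = ev \<phi>" for \<phi> by (rule EA_ev)
  obtain n v w where vw: "coords e n v w" using ex_coords[OF e] by blast
  have v: "v i \<in> E e" and w: "w i \<in> E e" if "i < n" for i
    using vw that unfolding coords_def by auto
  note [simp] = v w
  define \<Psi> where "\<Psi> F = map (\<lambda>i. (v i, avg X e (\<lambda>x. w i \<otimes> F x))) [0..<n]" for F
  have wF: "w i \<otimes> a \<in> E e" if "a \<in> E e" "i < n" for i a
    using that e E_sub by (intro E_mult_left) auto
  have avg: "avg X e (\<lambda>x. w i \<otimes> F x) \<in> carrier (A X)"
    if "\<And>x. x \<in> gsub X e \<Longrightarrow> F x \<in> E e" "i < n" for F i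
    using that wF by (intro avg_mem[OF X]) blast
  have valid\<Psi>: "P.valid (\<Psi> F)" if "\<And>x. x \<in> gsub X e \<Longrightarrow> F x \<in> E e" for F
    unfolding \<Psi>_def using avg[OF that] v by auto
  \<comment> \<open>First composite: the averages at \<open>x\<close> are sums over the loops at
    \<open>e\<close>, and orthogonality leaves only the loop \<open>e\<close>, whose term is
    \<open>F x\<close>.\<close>
  have ev\<Psi>: "ev (pt X x) (\<Psi> F) = F x"
    if F: "\<And>x. x \<in> gsub X e \<Longrightarrow> F x \<in> E e" and x: "x \<in> gsub X e" for F x
  proof -
    have y: "gact X (ginv G g) x \<in> gsub X e" if "g \<in> arrs e e" for g
      by (rule gact_mem[OF X'(1) ginv_arrs[OF that] x])
    have val: "pt X x (avg X e (\<lambda>x. w i \<otimes> F x))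
        = (\<Oplus>g\<in>arrs e e. \<beta> g (w i) \<otimes> \<beta> g (F (gact X (ginv G g) x)))" if "i < n" for i
      using avg[OF F that] avg_eq[OF X e x] y F w[OF that] \<beta>_carrier
      by (auto simp: pt_def \<beta>_hom intro!: R.finsum_cong')
    have c: "(\<Oplus>g\<in>arrs e e. \<beta> g (w i) \<otimes> \<beta> g (F (gact X (ginv G g) x))) \<in> carrier R"
      if "i < n" for i
      using y F w[OF that] \<beta>_carrier by (intro R.finsum_closed) blast
    have "ev (pt X x) (\<Psi> F) = (\<Oplus>i\<in>{..<n}. v i \<otimes> pt X x (avg X e (\<lambda>x. w i \<otimes> F x)))"
      unfolding \<Psi>_def by (rule ev_map_upt) (use c e E_sub in \<open>simp add: val\<close>)
    also have "\<dots> = (\<Oplus>i\<in>{..<n}. v i \<otimes>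
        (\<Oplus>g\<in>arrs e e. \<beta> g (w i) \<otimes> \<beta> g (F (gact X (ginv G g) x))))"
      using c e E_sub by (intro R.finsum_cong') (auto simp: val)
    also have "\<dots> = \<beta> e (F (gact X (ginv G e) x))"
      using y F \<beta>_mem by (intro coords_sum[OF e vw]) blast
    also have "\<dots> = F x"
      using gact_ginv'[OF X'(1) ident_arrs[OF e] x] gact_ident[OF X'(1) e y[OF ident_arrs[OF e]]]
        \<beta>_ident[OF e F[OF x]] by simp
    finally show ?thesis .
  qed
  show "inj_on (pt X) (gsub X e)"
  proof (rule inj_onI, rule ccontr)
    fix x y assume xy: "x \<in> gsub X e" "y \<in> gsub X e" "pt X x = pt X y" "x \<noteq> y"
    \<comment> \<open>The indicator function of \<open>x\<close> is among the functions that are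
      attained, and it separates \<open>x\<close> from \<open>y\<close> since \<open>u e\<close> is
      nonzero.\<close>
    let ?F = "\<lambda>z. if z = x then u e else \<zero>"
    have "?F z \<in> E e" for z using e E_zero by simp
    then have "?F x = ?F y" using ev\<Psi>[of ?F] xy by metis
    then show False using xy u_ne[OF e] by simp
  qed
  have ev_mem: "ev (pt X x) ps \<in> E e" if "P.valid ps" "x \<in> gsub X e" for ps x
    using P.ev_closed[OF pt_hom[OF X e that(2)] that(1)] unfolding Pev by simp
  \<comment> \<open>Second composite, by additivity reduced to one tensor of \<open>a\<close> and
    \<open>f\<close>: \<open>avg_mult\<close> turns the average of
    \<open>w i \<otimes> a \<otimes> f x\<close> into a scalar multiple of \<open>f\<close>, the
    scalar moves to the left factor, and the dual basis adds the left factors up to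
    \<open>a\<close>.\<close>
  have \<Psi>ev: "P.teq (\<Psi> (\<lambda>x. ev (pt X x) ps)) ps" if "P.valid ps" for ps
    using that
  proof (induction ps)
    case Nil
    have *: "avg X e (\<lambda>x. w i \<otimes> \<zero>) = \<zero>\<^bsub>A X\<^esub>" if "i < n" for i
      using avg_zero[OF X e] that e E_sub by simp
    show ?case unfolding \<Psi>_def using P.teq_zero_right
      by (intro P.teq_map_Nil) (auto simp: ev_def *)
  next
    case (Cons p ps)
    obtain a f where p: "p = (a, f)" "a \<in> E e" "f \<in> carrier (A X)" using Cons.prems by (cases p) auto
    have ps: "P.valid ps" using Cons.prems by simp
    let ?F = "\<lambda>x. ev (pt X x) ps"
    have wa: "w i \<otimes> a \<in> E e" if "i < n" for i
      using that p(2) e E_sub by (intro E_mult_left) auto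
    have fx: "f x \<in> E e" if "x \<in> gsub X e" for x using A_memD(2)[OF X p(3) e that] .
    have eq: "avg X e (\<lambda>x. w i \<otimes> ev (pt X x) (p # ps))
        = trace e (w i \<otimes> a) \<odot>\<^bsub>A X\<^esub> f \<oplus>\<^bsub>A X\<^esub> avg X e (\<lambda>x. w i \<otimes> ?F x)" if i: "i < n" for i
    proof -
      have "avg X e (\<lambda>x. w i \<otimes> ev (pt X x) (p # ps))
          = avg X e (\<lambda>x. (w i \<otimes> a) \<otimes> f x \<oplus> w i \<otimes> ?F x)"
      proof (rule avg_cong[OF X])
        fix x assume x: "x \<in> gsub X e"
        show "w i \<otimes> ev (pt X x) (p # ps) \<in> E e" by (intro wF ev_mem x Cons.prems i)
        have "pt X x f = f x" using p(3) by (simp add: pt_def)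
        then show "w i \<otimes> ev (pt X x) (p # ps) = (w i \<otimes> a) \<otimes> f x \<oplus> w i \<otimes> ?F x"
          using E_sub[OF e] w[OF i] p(2) fx[OF x] ev_mem[OF ps x]
          by (simp add: p(1) ev_def R.r_distr R.m_assoc)
      qed
      also have "\<dots> = avg X e (\<lambda>x. (w i \<otimes> a) \<otimes> f x) \<oplus>\<^bsub>A X\<^esub> avg X e (\<lambda>x. w i \<otimes> ?F x)"
        using e wa[OF i] E_sub[OF e fx] ev_mem[OF ps] wF i
        by (intro avg_add[OF X _ _ e] E_mult_right[OF e wa[OF i]]) auto
      finally show ?thesis unfolding avg_mult[OF X e wa[OF i] p(3)] .
    qed
    have trc: "trace e (w i \<otimes> a) \<in> carrier K" if "i < n" for i using trace(1)[OF e wa[OF that]] .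
    have 1: "P.teq (\<Psi> (\<lambda>x. ev (pt X x) (p # ps)))
        (map (\<lambda>i. (v i, trace e (w i \<otimes> a) \<odot>\<^bsub>A X\<^esub> f)) [0..<n] @ \<Psi> ?F)"
      unfolding \<Psi>_def
    proof (rule P.teq_map_append)
      fix i assume "i \<in> set [0..<n]"
      then have i: "i < n" by simp
      show "P.teq [(v i, avg X e (\<lambda>x. w i \<otimes> ev (pt X x) (p # ps)))]
          [(v i, trace e (w i \<otimes> a) \<odot>\<^bsub>A X\<^esub> f), (v i, avg X e (\<lambda>x. w i \<otimes> ?F x))]"
        unfolding eq[OF i]
        by (intro tensor_eq.add_right A_closed(5)[OF X trc[OF i] p(3)] avg ev_mem ps i)
          (use v[OF i] in auto)
    qed
    have 2: "P.teq (map (\<lambda>i. (v i, trace e (w i \<otimes> a) \<odot>\<^bsub>A X\<^esub> f)) [0..<n])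
        (map (\<lambda>i. (trace e (w i \<otimes> a) \<odot> v i, f)) [0..<n])"
    proof (rule P.teq_map)
      fix i assume "i \<in> set [0..<n]"
      then have i: "i < n" by simp
      show "P.teq [(v i, trace e (w i \<otimes> a) \<odot>\<^bsub>A X\<^esub> f)] [(trace e (w i \<otimes> a) \<odot> v i, f)]"
        using tensor_eq.balanced[of "trace e (w i \<otimes> a)" K "v i" "EA e" f "A X"] trc[OF i] v[OF i] p(3)
        by (auto intro: tensor_eq.sym)
    qed
    have 3: "P.teq (map (\<lambda>i. (trace e (w i \<otimes> a) \<odot> v i, f)) [0..<n]) [(a, f)]"
    proof -
      have "(\<Oplus>\<^bsub>EA e\<^esub>i\<in>{..<n}. trace e (w i \<otimes> a) \<odot> v i) = a"
        using coords_trace[OF e vw p(2)] trc v e by (subst EA_finsum) (auto intro: E_smult)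
      then show ?thesis
        using P.teq_map_sum[of n "\<lambda>i. trace e (w i \<otimes> a) \<odot> v i" f] trc v e p(3) E_smult by auto
    qed
    have 4: "P.teq (map (\<lambda>i. (v i, trace e (w i \<otimes> a) \<odot>\<^bsub>A X\<^esub> f)) [0..<n] @ \<Psi> ?F) ([(a, f)] @ ps)"
      using tensor_eq.append[OF tensor_eq.trans[OF 2 3] Cons.IH[OF ps]] .
    show ?case using tensor_eq.trans[OF 1 4] p(1) by simp
  qed
  show "P.splits (pt X ` gsub X e)"
    unfolding P.splits_def
  proof (intro conjI allI impI ballI)
    show "finite (pt X ` gsub X e)" using fin_gsub[OF X e] by simp
    show "pt X ` gsub X e \<subseteq> alg_hom K (A X) (EA e) \<inter> extensional (carrier (A X))"
      using pt_hom[OF X e] by (auto simp: pt_def)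
  next
    fix F assume F: "F \<in> pt X ` gsub X e \<rightarrow> carrier (EA e)"
    let ?F = "\<lambda>x. F (pt X x)"
    have F': "?F x \<in> E e" if "x \<in> gsub X e" for x using F that by auto
    show "\<exists>ps. P.valid ps \<and> (\<forall>\<phi>\<in>pt X ` gsub X e. P.ev \<phi> ps = F \<phi>)"
      using valid\<Psi>[of ?F] ev\<Psi>[of ?F] F' unfolding Pev by (intro exI[of _ "\<Psi> ?F"]) auto
  next
    fix ps qs assume ps: "P.valid ps" and qs: "P.valid qs"
      and eq: "\<forall>\<phi>\<in>pt X ` gsub X e. P.ev \<phi> ps = P.ev \<phi> qs"
    have "avg X e (\<lambda>x. w i \<otimes> ev (pt X x) ps) = avg X e (\<lambda>x. w i \<otimes> ev (pt X x) qs)" if "i < n" for i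
      using that eq ev_mem[OF ps] wF unfolding Pev by (intro avg_cong[OF X]) auto
    then have "\<Psi> (\<lambda>x. ev (pt X x) ps) = \<Psi> (\<lambda>x. ev (pt X x) qs)" by (simp add: \<Psi>_def)
    then show "P.teq ps qs"
      using \<Psi>ev[OF ps] \<Psi>ev[OF qs] by (metis tensor_eq.sym tensor_eq.trans)
  qed
qed

section \<open>Functoriality\<close>

text \<open>The numbering of the coordinates is forgotten; only the set \<open>V e\<close> and its
  cardinality remain, the latter because one exponent \<open>m\<close> serves all \<open>e\<close>.
  Since \<open>u e\<close> is nonzero, coordinates with different indices are distinct, and
  \<open>bchoice_iff\<close> assembles isomorphisms found separately for each
  \<open>e\<close>.\<close>

lemma is_splitting_iff:
  fixes B :: "('k, 'b) module"
  assumes B: "algebra K B"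
  shows "is_splitting G K R E u \<beta> B V \<longleftrightarrow>
    V \<in> extensional (idents G) \<and> is_gset G (V_gset G \<beta> (B, V)) \<and>
    (\<exists>m\<ge>1. \<forall>e\<in>idents G. algebra_pair.splits K (EA e) B (V e) \<and> card (V e) = m)"
proof -
  have coord: "(\<lambda>i. \<lambda>b\<in>carrier B. \<phi> (tensor_class K (EA e) B [(u e, b)]) i)
      = algebra_pair.coord K (EA e) B \<phi>" if "e \<in> idents G" for \<phi> e
    using algebra_pair.coord_def[OF E_pair[OF that B]] by (simp add: fun_eq_iff)
  have iff: "(\<exists>\<phi>. \<phi> \<in> alg_iso (EA e) (tensor_algebra K (EA e) B) (power_algebra (EA e) m) \<and>
      V e = (\<lambda>i. \<lambda>b\<in>carrier B. \<phi> (tensor_class K (EA e) B [(u e, b)]) i) ` {..<m}) \<longleftrightarrow>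
      algebra_pair.splits K (EA e) B (V e) \<and> card (V e) = m" if e: "e \<in> idents G" for e m
  proof -
    interpret P: algebra_pair K "EA e" B by (rule E_pair[OF e B])
    show ?thesis
      unfolding coord[OF e] using P.splits_if_iso P.iso_if_splits u_ne[OF e]
      by (metis EA_simps(2,3))
  qed
  have "(\<exists>\<phi>. \<forall>e\<in>idents G.
       \<phi> e \<in> alg_iso (EA e) (tensor_algebra K (EA e) B) (power_algebra (EA e) m) \<and>
       V e = (\<lambda>i. \<lambda>b\<in>carrier B. \<phi> e (tensor_class K (EA e) B [(u e, b)]) i) ` {..<m}) \<longleftrightarrow>
     (\<forall>e\<in>idents G. algebra_pair.splits K (EA e) B (V e) \<and> card (V e) = m)" (is "?l \<longleftrightarrow> ?r") for m
  proof -
    have "?l \<longleftrightarrow> (\<forall>e\<in>idents G. \<exists>\<phi>.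
       \<phi> \<in> alg_iso (EA e) (tensor_algebra K (EA e) B) (power_algebra (EA e) m) \<and>
       V e = (\<lambda>i. \<lambda>b\<in>carrier B. \<phi> (tensor_class K (EA e) B [(u e, b)]) i) ` {..<m})"
      by (rule bchoice_iff[symmetric])
    also have "\<dots> \<longleftrightarrow> ?r" by (rule ball_cong[OF HOL.refl iff])
    finally show ?thesis .
  qed
  then show ?thesis unfolding is_splitting_def by auto
qed

definition split_alg :: "('k, 'b) module \<Rightarrow> ('g \<Rightarrow> ('b \<Rightarrow> 'r) set) \<Rightarrow> bool" where
  "split_alg B V \<longleftrightarrow> algebra K B \<and> is_splitting G K R E u \<beta> B V"

lemma split_algD:
  assumes "split_alg B V"
  shows "algebra K B" "V \<in> extensional (idents G)" "is_gset G (V_gset G \<beta> (B, V))"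
    "\<And>e. e \<in> idents G \<Longrightarrow> algebra_pair.splits K (EA e) B (V e)"
    "\<And>e \<phi>. e \<in> idents G \<Longrightarrow> \<phi> \<in> V e \<Longrightarrow> \<phi> \<in> alg_hom K B (EA e)"
    "\<And>e \<phi>. e \<in> idents G \<Longrightarrow> \<phi> \<in> V e \<Longrightarrow> \<phi> \<in> extensional (carrier B)"
    "\<And>e. e \<in> idents G \<Longrightarrow> finite (V e)"
proof -
  show B: "algebra K B" using assms by (simp add: split_alg_def)
  show "V \<in> extensional (idents G)" "is_gset G (V_gset G \<beta> (B, V))"
    and s: "\<And>e. e \<in> idents G \<Longrightarrow> algebra_pair.splits K (EA e) B (V e)"
    using assms is_splitting_iff[OF B] by (auto simp: split_alg_def)
  have *: "finite (V e) \<and> V e \<subseteq> alg_hom K B (EA e) \<inter> extensional (carrier B)" if "e \<in> idents G" for e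
    using s[OF that, unfolded algebra_pair.splits_def[OF E_pair[OF that B]]]
    by (elim conjE) (intro conjI)
  show "\<phi> \<in> alg_hom K B (EA e)" "\<phi> \<in> extensional (carrier B)" if "e \<in> idents G" "\<phi> \<in> V e" for e \<phi>
    using *[OF that(1)] that(2) by auto
  show "finite (V e)" if "e \<in> idents G" for e using *[OF that] by simp
qed

lemma V_gset_simps:
  "gcar (V_gset G \<beta> (B, V)) = (SIGMA e:idents G. V e)"
  "gsub (V_gset G \<beta> (B, V)) g = {grng G g} \<times> V (grng G g)"
  "gact (V_gset G \<beta> (B, V)) g (e, \<phi>) = (grng G g, \<lambda>b\<in>carrier B. \<beta> g (\<phi> b))"
  by (simp_all add: V_gset_def)

lemma V_gsub: "e \<in> idents G \<Longrightarrow> gsub (V_gset G \<beta> (B, V)) e = {e} \<times> V e"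
  by (simp add: V_gset_simps)

lemma V_gact: "g \<in> arrs e e' \<Longrightarrow>
    gact (V_gset G \<beta> (B, V)) g (e, \<phi>) = (e', \<lambda>b\<in>carrier B. \<beta> g (\<phi> b))"
  using arrsD(3) by (simp add: V_gset_simps)

lemma V_split_gset:
  assumes "split_alg B V"
  shows "split_gset (V_gset G \<beta> (B, V))"
  unfolding split_gset_def
proof (intro conjI)
  show "is_gset G (V_gset G \<beta> (B, V))" by (rule split_algD(3)[OF assms])
  show "is_split G (V_gset G \<beta> (B, V))"
    unfolding is_split_def disjoint_family_on_def by (auto simp: V_gset_simps V_gsub)
  show "finite (gcar (V_gset G \<beta> (B, V)))"
    using split_algD(7)[OF assms] by (simp add: V_gset_simps)
qed

lemma V_act_mem:
  assumes "split_alg B V" "g \<in> arrs e e'" "\<phi> \<in> V e"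
  shows "(\<lambda>b\<in>carrier B. \<beta> g (\<phi> b)) \<in> V e'"
  using gact_mem[OF split_algD(3)[OF assms(1)] assms(2), of "(e, \<phi>)"] arrsD(4,5)[OF assms(2)] assms(3)
  by (simp add: V_gact[OF assms(2)] V_gsub)

section \<open>The category of split algebras\<close>

lemma split_algebras_simps:
  "P \<in> Ob (split_algebras G K R E u \<beta>) \<longleftrightarrow> split_alg (fst P) (snd P)"
  "Hom (split_algebras G K R E u \<beta>) = split_homs G K"
  "Ide (split_algebras G K R E u \<beta>) P = (\<lambda>b\<in>carrier (fst P). b)"
  "Comp (split_algebras G K R E u \<beta>) P Q S g f = compose (carrier (fst P)) g f"
  by (auto simp: split_algebras_def split_alg_def split: prod.splits)

lemma split_homs_iff:
  "f \<in> split_homs G K (B, V) (B', V') \<longleftrightarrow> f \<in> alg_hom K B B' \<and> f \<in> extensional (carrier B) \<and>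
     (\<forall>e\<in>idents G. \<forall>\<phi>\<in>V' e. compose (carrier B) \<phi> f \<in> V e)"
  by (simp add: split_homs_def)

lemma split_homs_compose:
  assumes B: "algebra K B" and f: "f \<in> split_homs G K (B, V) (B', V')"
    and h: "h \<in> split_homs G K (B', V') (B'', V'')"
  shows "compose (carrier B) h f \<in> split_homs G K (B, V) (B'', V'')"
proof -
  have fc: "f \<in> carrier B \<rightarrow> carrier B'" using f alg_homD(1) by (auto simp: split_homs_iff)
  have "compose (carrier B) \<phi> (compose (carrier B) h f) \<in> V e" if "e \<in> idents G" "\<phi> \<in> V'' e" for e \<phi>
  proof -
    have "compose (carrier B) \<phi> (compose (carrier B) h f)
        = compose (carrier B) (compose (carrier B') \<phi> h) f"
      using fc by (rule compose_assoc)
    then show ?thesis using f h that by (simp add: split_homs_iff)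
  qed
  then show ?thesis using f h alg_hom_compose[OF B, of f B' h B'']
    by (simp add: split_homs_iff compose_extensional)
qed

lemma split_homs_id:
  assumes B: "split_alg B V"
  shows "(\<lambda>b\<in>carrier B. b) \<in> split_homs G K (B, V) (B, V)"
proof -
  interpret B: algebra K B by (rule split_algD(1)[OF B])
  have "(\<lambda>b\<in>carrier B. b) \<in> alg_hom K B B" by (rule alg_homI) simp_all
  then show ?thesis
    using split_algD(6)[OF B] by (simp add: split_homs_iff compose_id_right)
qed

lemma category_algebras:
  "is_category (split_algebras G K R E u \<beta> :: (('k, 'b) module \<times> ('g \<Rightarrow> ('b \<Rightarrow> 'r) set), 'b \<Rightarrow> 'b) cat)"
  unfolding is_category_def split_algebras_simps
proof (intro conjI ballI)
  fix W X Y Z :: "('k, 'b) module \<times> ('g \<Rightarrow> ('b \<Rightarrow> 'r) set)" and f g h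
  assume "f \<in> split_homs G K W X"
  then show "compose (carrier (fst W)) h (compose (carrier (fst W)) g f)
      = compose (carrier (fst W)) (compose (carrier (fst X)) h g) f"
    by (intro compose_assoc) (cases W, cases X, auto simp: split_homs_iff dest: alg_homD(1))
next
  fix X Y :: "('k, 'b) module \<times> ('g \<Rightarrow> ('b \<Rightarrow> 'r) set)" and f
  assume "f \<in> split_homs G K X Y"
  then show "compose (carrier (fst X)) f (\<lambda>b\<in>carrier (fst X). b) = f"
    "compose (carrier (fst X)) (\<lambda>b\<in>carrier (fst Y). b) f = f"
    by (cases X, cases Y, auto simp: split_homs_iff intro!: compose_id_left compose_id_right
        dest: alg_homD(1))+
next
  fix X Y Z :: "('k, 'b) module \<times> ('g \<Rightarrow> ('b \<Rightarrow> 'r) set)" and f g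
  assume "X \<in> Ob (split_algebras G K R E u \<beta>)" "f \<in> split_homs G K X Y" "g \<in> split_homs G K Y Z"
  then show "compose (carrier (fst X)) g f \<in> split_homs G K X Z"
    using split_homs_compose[of "fst X" f "snd X" "fst Y" "snd Y" g "fst Z" "snd Z"] split_algD(1)[of "fst X" "snd X"]
    by (simp add: split_algebras_simps)
next
  fix X :: "('k, 'b) module \<times> ('g \<Rightarrow> ('b \<Rightarrow> 'r) set)"
  assume "X \<in> Ob (split_algebras G K R E u \<beta>)"
  then show "(\<lambda>b\<in>carrier (fst X). b) \<in> split_homs G K X X"
    using split_homs_id[of "fst X" "snd X"] by (simp add: split_algebras_simps)
qed

lemma theta_eq: "theta G R E u \<beta> X = (A X, \<lambda>e\<in>idents G. pt X ` gsub X e)"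
  by (simp add: theta_def pt_def)

text \<open>Equivariance of the elements of \<open>A X\<close> makes composition of evaluations with
  \<open>\<beta> g\<close> agree with the action on points; the laws of an action on the evaluations
  are inherited from \<open>X\<close> in this way.\<close>

lemma pt_act:
  assumes X: "split_gset X" and g: "g \<in> arrs e e'" and x: "x \<in> gsub X e"
  shows "(\<lambda>f\<in>carrier (A X). \<beta> g (pt X x f)) = pt X (gact X g x)"
  using A_memD(5)[OF X _ g x] by (auto simp: pt_def)

lemma theta_split_alg:
  assumes X: "split_gset X"
  shows "split_alg (A X) (\<lambda>e\<in>idents G. pt X ` gsub X e)"
proof -
  note X' = split_gsetD[OF X]
  let ?V = "\<lambda>e\<in>idents G. pt X ` gsub X e"
  note sub = V_gsub[of _ "A X" ?V] and act = V_gact[of _ _ _ "A X" ?V]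
  obtain e0 where e0: "e0 \<in> idents G" using idents_nonempty by blast
  \<comment> \<open>A splitting requires the same number of coordinates at every \<open>e\<close>.
    An arrow from \<open>e\<close> to \<open>e0\<close> gives a bijection between the two pieces of
    \<open>X\<close>.\<close>
  have card: "card (gsub X e) = card (gsub X e0)" if "e \<in> idents G" for e
    using connected[OF that e0] gact_bij[OF X'(1)] bij_betw_same_card by blast
  have "is_gset G (V_gset G \<beta> (A X, ?V))"
  proof (rule is_gsetI)
    obtain x where "x \<in> gsub X e0" using gsub_nonempty[OF X e0] by blast
    then have "(e0, pt X x) \<in> gcar (V_gset G \<beta> (A X, ?V))" using e0 by (simp add: V_gset_simps)
    then show "gcar (V_gset G \<beta> (A X, ?V)) \<noteq> {}" by blast
    show "gsub (V_gset G \<beta> (A X, ?V)) e \<subseteq> gcar (V_gset G \<beta> (A X, ?V))" if "e \<in> idents G" for e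
      using that by (auto simp: V_gset_simps)
    show "gsub (V_gset G \<beta> (A X, ?V)) g = gsub (V_gset G \<beta> (A X, ?V)) (grng G g)" if "g \<in> arr G" for g
      using that by (simp add: V_gset_simps)
  next
    fix g e e' p assume g: "g \<in> arrs e e'" and "p \<in> gsub (V_gset G \<beta> (A X, ?V)) e"
    then obtain x where "p = (e, pt X x)" "x \<in> gsub X e" using arrsD(4)[OF g] by (auto simp: sub)
    then show "gact (V_gset G \<beta> (A X, ?V)) g p \<in> gsub (V_gset G \<beta> (A X, ?V)) e'"
      using arrsD(5)[OF g] gact_mem[OF X'(1) g] by (simp add: sub act[OF g] pt_act[OF X g])
  next
    fix e p assume e: "e \<in> idents G" and "p \<in> gsub (V_gset G \<beta> (A X, ?V)) e"
    then obtain x where p: "p = (e, pt X x)" "x \<in> gsub X e" by (auto simp: sub)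
    then show "gact (V_gset G \<beta> (A X, ?V)) e p = p"
      using gact_ident[OF X'(1) e p(2)] by (simp add: act[OF ident_arrs[OF e]] pt_act[OF X ident_arrs[OF e]])
  next
    fix h g e e' e'' p assume h: "h \<in> arrs e' e''" and g: "g \<in> arrs e e'"
      and "p \<in> gsub (V_gset G \<beta> (A X, ?V)) e"
    then obtain x where p: "p = (e, pt X x)" "x \<in> gsub X e" using arrsD(4)[OF g] by (auto simp: sub)
    show "gact (V_gset G \<beta> (A X, ?V)) h (gact (V_gset G \<beta> (A X, ?V)) g p)
        = gact (V_gset G \<beta> (A X, ?V)) (gmult G h g) p"
      unfolding p(1) act[OF g] act[OF gmult_arrs[OF h g]] act[OF h] pt_act[OF X g p(2)]
        pt_act[OF X gmult_arrs[OF h g] p(2)] pt_act[OF X h gact_mem[OF X'(1) g p(2)]]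
        gact_comp[OF X'(1) h g p(2)] ..
  qed
  moreover have "card (gsub X e0) \<ge> 1"
    using gsub_nonempty[OF X e0] fin_gsub[OF X e0] by (simp add: Suc_le_eq card_gt_0_iff)
  moreover have "card (pt X ` gsub X e) = card (gsub X e0)" if "e \<in> idents G" for e
    using card_image[OF A_splits(2)[OF X that]] card[OF that] by simp
  ultimately show ?thesis
    unfolding split_alg_def is_splitting_iff[OF A_algebra[OF X]]
    using A_splits(1)[OF X] A_algebra[OF X] by auto
qed

section \<open>The isomorphism from a split set to the set of evaluations\<close>

definition \<eta> :: "('g, 'x) gset \<Rightarrow> 'x \<Rightarrow> 'g \<times> (('x \<Rightarrow> 'r) \<Rightarrow> 'r)" where
  "\<eta> X = (\<lambda>x\<in>gcar X. (pos X x, pt X x))"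

lemma \<eta>_eq: "split_gset X \<Longrightarrow> e \<in> idents G \<Longrightarrow> x \<in> gsub X e \<Longrightarrow> \<eta> X x = (e, pt X x)"
  using gsub_gcar[OF split_gsetD(1), of X e x] pos_eq[OF split_gsetD(2), of X e x] by (simp add: \<eta>_def)

text \<open>Surjectivity is built into \<open>theta\<close>, whose splitting consists of the
  evaluations at points. Injectivity holds because equivariant functions separate the points of one
  piece.\<close>

lemma \<eta>_iso:
  assumes X: "split_gset X"
  shows "gset_iso G X (V_gset G \<beta> (theta G R E u \<beta> X)) (\<eta> X)"
  unfolding theta_eq
proof (rule gset_isoI)
  note X' = split_gsetD[OF X] and V' = split_gsetD[OF V_split_gset[OF theta_split_alg[OF X]]]
  show "is_gset G X" "is_split G X" by (rule X')+
  show "is_gset G (V_gset G \<beta> (A X, \<lambda>e\<in>idents G. pt X ` gsub X e))"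
    "is_split G (V_gset G \<beta> (A X, \<lambda>e\<in>idents G. pt X ` gsub X e))" by (rule V')+
  show "\<eta> X \<in> extensional (gcar X)" by (simp add: \<eta>_def)
  show "bij_betw (\<eta> X) (gsub X e) (gsub (V_gset G \<beta> (A X, \<lambda>e\<in>idents G. pt X ` gsub X e)) e)"
    if e: "e \<in> idents G" for e
  proof (rule bij_betw_imageI)
    show "inj_on (\<eta> X) (gsub X e)"
      using A_splits(2)[OF X e] \<eta>_eq[OF X e] by (auto simp: inj_on_def)
    show "\<eta> X ` gsub X e = gsub (V_gset G \<beta> (A X, \<lambda>e\<in>idents G. pt X ` gsub X e)) e"
      using \<eta>_eq[OF X e] e by (force simp: V_gsub)
  qed
  show "\<eta> X (gact X g x) = gact (V_gset G \<beta> (A X, \<lambda>e\<in>idents G. pt X ` gsub X e)) g (\<eta> X x)"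
    if gx: "g \<in> arrs e e'" "x \<in> gsub X e" for g e e' x
    using \<eta>_eq[OF X arrsD(4)[OF gx(1)] gx(2)] \<eta>_eq[OF X arrsD(5)[OF gx(1)] gact_mem[OF X'(1) gx]]
    by (simp add: V_gact[OF gx(1)] pt_act[OF X gx])
qed

section \<open>Pullback of equivariant functions\<close>

lemma theta_map_apply:
  "f \<in> carrier (A Y) \<Longrightarrow> x \<in> gcar X \<Longrightarrow> theta_map G R E u \<beta> X Y h f x = f (h x)"
  by (simp add: theta_map_def compose_eq)

lemma theta_map_mem:
  assumes X: "split_gset X" and Y: "split_gset Y" and h: "h \<in> gmaps G X Y" and f: "f \<in> carrier (A Y)"
  shows "theta_map G R E u \<beta> X Y h f \<in> carrier (A X)"
proof (rule A_memI[OF X])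
  note X' = split_gsetD[OF X] and h' = gmapsD[OF split_gsetD(1)[OF X] h]
  note ap = theta_map_apply[where h = h, OF f gsub_gcar[OF X'(1)]]
  show "theta_map G R E u \<beta> X Y h f \<in> extensional (gcar X)"
    using f by (simp add: theta_map_def compose_extensional)
  show "theta_map G R E u \<beta> X Y h f x \<in> E e" if "e \<in> idents G" "x \<in> gsub X e" for e x
    using A_memD(2)[OF Y f that(1) h'(3)[OF that]] that ap by simp
  fix g e e' x assume gx: "g \<in> arrs e e'" "x \<in> gsub X e"
  note e = arrsD(4,5)[OF gx(1)]
  show "\<beta> g (theta_map G R E u \<beta> X Y h f x) = theta_map G R E u \<beta> X Y h f (gact X g x)"
    using A_memD(5)[OF Y f gx(1) h'(3)[OF e(1) gx(2)]] h'(4)[OF gx] ap[OF e(1) gx(2)]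
      ap[OF e(2) gact_mem[OF X'(1) gx]] by simp
qed

text \<open>This identity makes pullbacks morphisms of split algebras, makes \<open>\<eta>\<close>
  natural, and shows that a map of split sets can be recovered from its pullback.\<close>

lemma compose_pt_theta_map:
  assumes X: "split_gset X" and Y: "split_gset Y" and h: "h \<in> gmaps G X Y" and x: "x \<in> gcar X"
  shows "compose (carrier (A Y)) (pt X x) (theta_map G R E u \<beta> X Y h) = pt Y (h x)"
  using theta_map_mem[OF X Y h] theta_map_apply[OF _ x, of _ Y h]
  by (auto simp: compose_def pt_def)

lemma theta_map_hom:
  assumes X: "split_gset X" and Y: "split_gset Y" and h: "h \<in> gmaps G X Y"
  shows "theta_map G R E u \<beta> X Y h \<in> split_homs G K (theta G R E u \<beta> Y) (theta G R E u \<beta> X)"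
  unfolding theta_eq split_homs_iff
proof (intro conjI ballI)
  note X' = split_gsetD[OF X] and h' = gmapsD[OF split_gsetD(1)[OF X] h]
  note mem = theta_map_mem[OF X Y h] and ap = theta_map_apply[where X = X and Y = Y and h = h]
  have hc: "h x \<in> gcar Y" if "x \<in> gcar X" for x using h'(2) that .
  show "theta_map G R E u \<beta> X Y h \<in> alg_hom K (A Y) (A X)"
  proof (rule alg_homI)
    show "theta_map G R E u \<beta> X Y h \<one>\<^bsub>A Y\<^esub> = \<one>\<^bsub>A X\<^esub>"
    proof (rule A_ext[OF X mem[OF A_closed(2)[OF Y]] A_closed(2)[OF X]])
      fix x assume x: "x \<in> gcar X"
      have "pos Y (h x) = pos X x"
        using pos[OF X'(2) x] h'(3) pos_eq[OF split_gsetD(2)[OF Y]] by blast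
      then show "theta_map G R E u \<beta> X Y h \<one>\<^bsub>A Y\<^esub> x = \<one>\<^bsub>A X\<^esub> x"
        using ap[OF A_closed(2)[OF Y] x] x hc[OF x] by (simp add: A_simps)
    qed
    fix f assume f: "f \<in> carrier (A Y)"
    show "theta_map G R E u \<beta> X Y h f \<in> carrier (A X)" by (rule mem[OF f])
    show "theta_map G R E u \<beta> X Y h (k \<odot>\<^bsub>A Y\<^esub> f) = k \<odot>\<^bsub>A X\<^esub> theta_map G R E u \<beta> X Y h f"
      if k: "k \<in> carrier K" for k
      by (rule A_ext[OF X mem[OF A_closed(5)[OF Y k f]] A_closed(5)[OF X k mem[OF f]]])
        (use ap[OF f] ap[OF A_closed(5)[OF Y k f]] hc in \<open>simp add: A_simps\<close>)
    fix f' assume f': "f' \<in> carrier (A Y)"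
    show "theta_map G R E u \<beta> X Y h (f \<otimes>\<^bsub>A Y\<^esub> f')
        = theta_map G R E u \<beta> X Y h f \<otimes>\<^bsub>A X\<^esub> theta_map G R E u \<beta> X Y h f'"
      by (rule A_ext[OF X mem[OF A_closed(4)[OF Y f f']] A_closed(4)[OF X mem[OF f] mem[OF f']]])
        (use ap[OF f] ap[OF f'] ap[OF A_closed(4)[OF Y f f']] hc in \<open>simp add: A_simps\<close>)
    show "theta_map G R E u \<beta> X Y h (f \<oplus>\<^bsub>A Y\<^esub> f')
        = theta_map G R E u \<beta> X Y h f \<oplus>\<^bsub>A X\<^esub> theta_map G R E u \<beta> X Y h f'"
      by (rule A_ext[OF X mem[OF A_closed(3)[OF Y f f']] A_closed(3)[OF X mem[OF f] mem[OF f']]])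
        (use ap[OF f] ap[OF f'] ap[OF A_closed(3)[OF Y f f']] hc in \<open>simp add: A_simps\<close>)
  qed
  show "theta_map G R E u \<beta> X Y h \<in> extensional (carrier (A Y))" by (simp add: theta_map_def)
  fix e \<phi> assume e: "e \<in> idents G" and "\<phi> \<in> (\<lambda>e\<in>idents G. pt X ` gsub X e) e"
  then obtain x where x: "x \<in> gsub X e" "\<phi> = pt X x" by auto
  show "compose (carrier (A Y)) \<phi> (theta_map G R E u \<beta> X Y h) \<in> (\<lambda>e\<in>idents G. pt Y ` gsub Y e) e"
    using compose_pt_theta_map[OF X Y h gsub_gcar[OF X'(1) e x(1)]] x(2) e h'(3)[OF e x(1)] by simp
qed

lemma theta_functor:
  "contravariant_functor
     (fin_split_gsets G :: (('g, 'x) gset, 'x \<Rightarrow> 'x) cat) (split_algebras G K R E u \<beta>)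
     (theta G R E u \<beta>) (theta_map G R E u \<beta>)"
  unfolding contravariant_functor_def fin_split_gsets_simps split_algebras_simps
proof (intro conjI ballI category_gsets category_algebras)
  fix X :: "('g, 'x) gset" assume "X \<in> Collect split_gset"
  then have X: "split_gset X" by simp
  then show "split_alg (fst (theta G R E u \<beta> X)) (snd (theta G R E u \<beta> X))"
    using theta_split_alg by (simp add: theta_eq)
  show "theta_map G R E u \<beta> X X (\<lambda>x\<in>gcar X. x) = (\<lambda>b\<in>carrier (fst (theta G R E u \<beta> X)). b)"
    using compose_id_right[OF A_memD(1)[OF X]] by (auto simp: theta_eq theta_map_def)
next
  fix X Y :: "('g, 'x) gset" and f
  assume "X \<in> Collect split_gset" "Y \<in> Collect split_gset" "f \<in> gmaps G X Y"
  then show "theta_map G R E u \<beta> X Y f \<in> split_homs G K (theta G R E u \<beta> Y) (theta G R E u \<beta> X)"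
    by (intro theta_map_hom) auto
next
  fix X Y Z :: "('g, 'x) gset" and f g
  assume "X \<in> Collect split_gset" "Y \<in> Collect split_gset" "Z \<in> Collect split_gset"
    and f: "f \<in> gmaps G X Y" and g: "g \<in> gmaps G Y Z"
  then have X: "split_gset X" and Y: "split_gset Y" and Z: "split_gset Z" by auto
  have fc: "f \<in> gcar X \<rightarrow> gcar Y" using gmapsD(2)[OF split_gsetD(1)[OF X] f] by auto
  show "theta_map G R E u \<beta> X Z (compose (gcar X) g f)
      = compose (carrier (fst (theta G R E u \<beta> Z))) (theta_map G R E u \<beta> X Y f) (theta_map G R E u \<beta> Y Z g)"
  proof (rule extensionalityI[of _ "carrier (A Z)"])
    fix F assume F: "F \<in> carrier (A Z)"
    then show "theta_map G R E u \<beta> X Z (compose (gcar X) g f) F = compose (carrier (fst (theta G R E u \<beta> Z)))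
        (theta_map G R E u \<beta> X Y f) (theta_map G R E u \<beta> Y Z g) F"
      using theta_map_mem[OF Y Z g F] compose_assoc[OF fc, of F g]
      by (simp add: theta_eq compose_eq) (simp add: theta_map_def)
  qed (simp_all add: theta_eq theta_map_def compose_extensional)
qed

section \<open>Functoriality of the set of homomorphisms\<close>

lemma theta'_map_hom:
  assumes P: "split_alg B V" and Q: "split_alg B' V'" and f: "f \<in> split_homs G K (B, V) (B', V')"
  shows "theta'_map G (B, V) (B', V') f \<in> gmaps G (V_gset G \<beta> (B', V')) (V_gset G \<beta> (B, V))"
proof (rule gmapsI)
  show "is_gset G (V_gset G \<beta> (B', V'))" "is_split G (V_gset G \<beta> (B', V'))"
    "is_gset G (V_gset G \<beta> (B, V))"
    using split_gsetD[OF V_split_gset[OF P]] split_gsetD[OF V_split_gset[OF Q]] by auto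
  show "theta'_map G (B, V) (B', V') f \<in> extensional (gcar (V_gset G \<beta> (B', V')))"
    by (simp add: theta'_map_def V_gset_simps)
  show "theta'_map G (B, V) (B', V') f x \<in> gsub (V_gset G \<beta> (B, V)) e"
    if "e \<in> idents G" "x \<in> gsub (V_gset G \<beta> (B', V')) e" for e x
    using that f by (auto simp: theta'_map_def V_gsub split_homs_iff)
  fix g e e' x assume g: "g \<in> arrs e e'" and "x \<in> gsub (V_gset G \<beta> (B', V')) e"
  then obtain \<phi> where x: "x = (e, \<phi>)" "\<phi> \<in> V' e" using arrsD(4)[OF g] by (auto simp: V_gsub)
  have "f b \<in> carrier B'" if "b \<in> carrier B" for b
    using f that alg_homD(1) by (auto simp: split_homs_iff)
  then have "compose (carrier B) (\<lambda>b\<in>carrier B'. \<beta> g (\<phi> b)) f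
      = (\<lambda>b\<in>carrier B. \<beta> g (compose (carrier B) \<phi> f b))"
    by (auto simp: compose_def)
  then show "theta'_map G (B, V) (B', V') f (gact (V_gset G \<beta> (B', V')) g x)
      = gact (V_gset G \<beta> (B, V)) g (theta'_map G (B, V) (B', V') f x)"
    using x arrsD(4,5)[OF g] V_act_mem[OF Q g x(2)] by (simp add: theta'_map_def V_gact[OF g])
qed

lemma V_functor:
  "contravariant_functor
     (split_algebras G K R E u \<beta> :: (('k, 'b) module \<times> ('g \<Rightarrow> ('b \<Rightarrow> 'r) set), 'b \<Rightarrow> 'b) cat)
     (fin_split_gsets G) (V_gset G \<beta>) (theta'_map G)"
  unfolding contravariant_functor_def fin_split_gsets_simps split_algebras_simps
proof (intro conjI ballI category_gsets category_algebras)
  fix P :: "('k, 'b) module \<times> ('g \<Rightarrow> ('b \<Rightarrow> 'r) set)"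
  assume "P \<in> Ob (split_algebras G K R E u \<beta>)"
  then have P: "split_alg (fst P) (snd P)" by (simp add: split_algebras_simps)
  then show "V_gset G \<beta> P \<in> Collect split_gset" using V_split_gset[OF P] by simp
  show "theta'_map G P P (\<lambda>b\<in>carrier (fst P). b) = (\<lambda>x\<in>gcar (V_gset G \<beta> P). x)"
    using split_algD(6)[OF P]
    by (cases P) (auto simp: theta'_map_def V_gset_simps compose_id_right intro!: restrict_ext)
next
  fix P Q :: "('k, 'b) module \<times> ('g \<Rightarrow> ('b \<Rightarrow> 'r) set)" and f
  assume "P \<in> Ob (split_algebras G K R E u \<beta>)" "Q \<in> Ob (split_algebras G K R E u \<beta>)"
    "f \<in> split_homs G K P Q"
  then show "theta'_map G P Q f \<in> gmaps G (V_gset G \<beta> Q) (V_gset G \<beta> P)"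
    using theta'_map_hom[of "fst P" "snd P" "fst Q" "snd Q" f] by (simp add: split_algebras_simps)
next
  fix P Q S :: "('k, 'b) module \<times> ('g \<Rightarrow> ('b \<Rightarrow> 'r) set)" and f g
  assume f: "f \<in> split_homs G K P Q" and g: "g \<in> split_homs G K Q S"
  obtain B V B' V' B'' V'' where PQS: "P = (B, V)" "Q = (B', V')" "S = (B'', V'')"
    by (cases P, cases Q, cases S)
  have fc: "f \<in> carrier B \<rightarrow> carrier B'" using f alg_homD(1) by (auto simp: PQS split_homs_iff)
  have "compose (carrier B') \<phi> g \<in> V' e" if "e \<in> idents G" "\<phi> \<in> V'' e" for e \<phi>
    using g that by (simp add: PQS split_homs_iff)
  then show "theta'_map G P S (compose (carrier (fst P)) g f)
      = compose (gcar (V_gset G \<beta> S)) (theta'_map G P Q f) (theta'_map G Q S g)"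
    using compose_assoc[OF fc]
    by (auto simp: PQS theta'_map_def V_gset_simps compose_def[of "Sigma _ _"] intro!: restrict_ext)
qed

lemma \<eta>_natural:
  assumes X: "split_gset X" and Y: "split_gset Y" and h: "h \<in> gmaps G X Y" and x: "x \<in> gcar X"
  shows "theta'_map G (theta G R E u \<beta> Y) (theta G R E u \<beta> X) (theta_map G R E u \<beta> X Y h) (\<eta> X x)
    = \<eta> Y (h x)"
proof -
  define e where "e = pos X x"
  have e: "e \<in> idents G" "x \<in> gsub X e"
    using pos[OF split_gsetD(2)[OF X] x] by (simp_all add: e_def)
  have hx: "h x \<in> gsub Y e" by (rule gmapsD(3)[OF split_gsetD(1)[OF X] h e])
  show ?thesis
    using e compose_pt_theta_map[OF X Y h x]
    unfolding \<eta>_eq[OF X e] \<eta>_eq[OF Y e(1) hx] by (simp add: theta'_map_def theta_eq)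
qed

section \<open>Reconstruction of a split algebra\<close>

text \<open>The construction starts from a set \<open>X\<close> identified with the homomorphisms of
  \<open>B\<close> by \<open>s\<close>. For \<open>\<epsilon>\<close> this is \<open>V_gset\<close>
  itself with \<open>s = snd\<close>; for essential surjectivity it is a copy of it on another
  type.\<close>

definition eval_at :: "('g, 'x) gset \<Rightarrow> ('x \<Rightarrow> 'b \<Rightarrow> 'r) \<Rightarrow> ('k, 'b) module \<Rightarrow> 'b \<Rightarrow> 'x \<Rightarrow> 'r" where
  "eval_at X s B = (\<lambda>b\<in>carrier B. \<lambda>x\<in>gcar X. s x b)"

text \<open>A bijection \<open>s\<close> from \<open>X\<close> to the \<open>G\<close>-set \<open>V(B)\<close> identifies \<open>B\<close> with \<open>A(X)\<close>. For surjectivity,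
  solve \<open>\<Sum>\<^sub>j a\<^sub>j \<phi>(b\<^sub>j) = c F(\<phi>)\<close> in \<open>E\<^sub>e \<otimes> B\<close>, where \<open>c\<close> has trace 1; then \<open>\<Sum>\<^sub>j trace(a\<^sub>j) b\<^sub>j\<close> is a preimage
  of \<open>F\<close>. For injectivity, apply \<open>trace \<otimes> id\<close> to \<open>c \<otimes> b\<close>.\<close>

lemma eval_at_bij_hom:
  fixes X :: "('g, 'x) gset" and B :: "('k, 'b) module"
  assumes X: "split_gset X" and P: "split_alg B V"
    and s: "\<And>e. e \<in> idents G \<Longrightarrow> bij_betw s (gsub X e) (V e)"
    and act: "\<And>g e e' x. g \<in> arrs e e' \<Longrightarrow> x \<in> gsub X e \<Longrightarrow>
      s (gact X g x) = (\<lambda>b\<in>carrier B. \<beta> g (s x b))"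
  shows "eval_at X s B \<in> alg_hom K B (A X)" "bij_betw (eval_at X s B) (carrier B) (carrier (A X))"
proof -
  note X' = split_gsetD[OF X] and P' = split_algD[OF P]
  interpret B: algebra K B by (rule P'(1))
  have sV: "s x \<in> V e" if "e \<in> idents G" "x \<in> gsub X e" for e x
    using bij_betw_apply[OF s[OF that(1)] that(2)] .
  have sh: "s x \<in> alg_hom K B (EA e)" if "e \<in> idents G" "x \<in> gsub X e" for e x
    using P'(5)[OF that(1) sV[OF that]] .
  have sE: "s x b \<in> E e" if "e \<in> idents G" "x \<in> gsub X e" "b \<in> carrier B" for e x b
    using alg_homD(1)[OF sh[OF that(1,2)] that(3)] by simp
  have sact: "s (gact X g x) b = \<beta> g (s x b)" if "g \<in> arrs e e'" "x \<in> gsub X e" "b \<in> carrier B" for g e e' x b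
    using act[OF that(1,2)] that(3) by simp
  have eval_at: "eval_at X s B b x = s x b" if "b \<in> carrier B" "x \<in> gcar X" for b x
    using that by (simp add: eval_at_def)
  have mem: "eval_at X s B b \<in> carrier (A X)" if b: "b \<in> carrier B" for b
  proof (rule A_memI[OF X])
    show "eval_at X s B b \<in> extensional (gcar X)" using b by (simp add: eval_at_def)
    show "eval_at X s B b x \<in> E e" if "e \<in> idents G" "x \<in> gsub X e" for e x
      using sE[OF that b] eval_at[OF b gsub_gcar[OF X'(1) that]] by simp
    fix g e e' x assume gx: "g \<in> arrs e e'" "x \<in> gsub X e"
    note e = arrsD(4,5)[OF gx(1)]
    show "\<beta> g (eval_at X s B b x) = eval_at X s B b (gact X g x)"
      using sact[OF gx b] eval_at[OF b gsub_gcar[OF X'(1) e(1) gx(2)]]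
        eval_at[OF b gsub_gcar[OF X'(1) e(2) gact_mem[OF X'(1) gx]]] by simp
  qed
  show hom: "eval_at X s B \<in> alg_hom K B (A X)"
  proof (rule alg_homI)
    have h: "s x \<in> alg_hom K B (EA (pos X x))" if "x \<in> gcar X" for x
      using sh pos[OF X'(2) that] by blast
    note h' = alg_homD[OF h, simplified EA_simps]
    show "eval_at X s B \<one>\<^bsub>B\<^esub> = \<one>\<^bsub>A X\<^esub>"
      using h'(4) by (auto simp: eval_at_def A_simps intro!: restrict_ext)
    fix b assume b: "b \<in> carrier B"
    show "eval_at X s B b \<in> carrier (A X)" by (rule mem[OF b])
    show "eval_at X s B (k \<odot>\<^bsub>B\<^esub> b) = k \<odot>\<^bsub>A X\<^esub> eval_at X s B b" if "k \<in> carrier K" for k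
      using h'(5)[OF _ that b] b that by (auto simp: eval_at_def A_simps intro!: restrict_ext)
    fix b' assume b': "b' \<in> carrier B"
    show "eval_at X s B (b \<otimes>\<^bsub>B\<^esub> b') = eval_at X s B b \<otimes>\<^bsub>A X\<^esub> eval_at X s B b'"
      using h'(3)[OF _ b b'] b b' by (auto simp: eval_at_def A_simps intro!: restrict_ext)
    show "eval_at X s B (b \<oplus>\<^bsub>B\<^esub> b') = eval_at X s B b \<oplus>\<^bsub>A X\<^esub> eval_at X s B b'"
      using h'(2)[OF _ b b'] b b' by (auto simp: eval_at_def A_simps intro!: restrict_ext)
  qed
  obtain e where e: "e \<in> idents G" using idents_nonempty by blast
  obtain c where c: "c \<in> E e" "trace e c = \<one>\<^bsub>K\<^esub>" using trace_surj[OF e] by blast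
  interpret Q: algebra_pair K "EA e" B by (rule E_pair[OF e P'(1)])
  have Qev: "Q.ev \<phi> = ev \<phi>" for \<phi> by (rule EA_ev)
  have Qsurj: "\<exists>ps. Q.valid ps \<and> (\<forall>\<phi>\<in>V e. ev \<phi> ps = F \<phi>)" if "\<And>\<phi>. \<phi> \<in> V e \<Longrightarrow> F \<phi> \<in> E e" for F
    using P'(4)[OF e] that unfolding Q.splits_def Qev by simp
  have Qinj: "Q.teq ps qs" if "Q.valid ps" "Q.valid qs" "\<And>\<phi>. \<phi> \<in> V e \<Longrightarrow> ev \<phi> ps = ev \<phi> qs" for ps qs
    using P'(4)[OF e] that unfolding Q.splits_def Qev by blast
  \<comment> \<open>This is \<open>trace \<otimes> id\<close>, from the tensor product to
    \<open>B\<close>. Linearity of the trace over \<open>K\<close> makes it compatible with the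
    relation \<open>balanced\<close>.\<close>
  define L where "L = tensor_lift B (\<lambda>a b. trace e a \<odot>\<^bsub>B\<^esub> b)"
  have L_closed: "L ps \<in> carrier B" if "Q.valid ps" for ps
    unfolding L_def using that trace(1)[OF e]
    by (intro Q.tensor_lift_closed) (auto simp: B.abelian_monoid_axioms)
  have L_cong: "L ps = L qs" if "Q.teq ps qs" for ps qs
    unfolding L_def
  proof (rule Q.tensor_lift_cong[OF _ _ _ _ _ _ that])
    fix k x y assume "k \<in> carrier K" "x \<in> carrier (EA e)" "y \<in> carrier B"
    then show "trace e (k \<odot>\<^bsub>EA e\<^esub> x) \<odot>\<^bsub>B\<^esub> y = trace e x \<odot>\<^bsub>B\<^esub> (k \<odot>\<^bsub>B\<^esub> y)"
      using trace(1)[OF e] trace_smult[OF e] by (simp add: K.m_comm flip: B.smult_assoc1)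
  qed (use trace(1)[OF e] trace_add[OF e] trace_zero[OF e] in
      \<open>auto simp: B.abelian_monoid_axioms B.smult_l_distr B.smult_r_distr\<close>)
  have L_single: "L [(c, b)] = b" if "b \<in> carrier B" for b
    using that c by (simp add: L_def)
  \<comment> \<open>\<open>L\<close> followed by \<open>s x\<close> is an average of evaluations. On
    a pure tensor of \<open>a\<close> and \<open>b\<close>, the trace of \<open>a\<close> times
    \<open>s x b\<close> is the sum of the \<open>\<beta> g a \<otimes> s x b\<close>, and by
    equivariance \<open>s x b\<close> is the image under \<open>\<beta> g\<close> of the value at
    the point moved back by \<open>g\<close>.\<close>
  have sL: "s x (L ps) = (\<Oplus>g\<in>arrs e e'. \<beta> g (ev (s (gact X (ginv G g) x)) ps))"
    if e': "e' \<in> idents G" and x: "x \<in> gsub X e'" and ps: "Q.valid ps" for e' x ps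
    using ps
  proof (induction ps)
    case Nil
    have "(\<Oplus>g\<in>arrs e e'. \<beta> g \<zero>) = \<zero>"
      using R.finsum_cong'[of "arrs e e'" "arrs e e'" "\<lambda>_. \<zero>" "\<lambda>g. \<beta> g \<zero>"] \<beta>_zero
      by (simp add: R.finsum_zero)
    moreover have "s x \<zero>\<^bsub>B\<^esub> = \<zero>"
      using alg_homD(5)[OF sh[OF e' x], of "\<zero>\<^bsub>K\<^esub>" "\<zero>\<^bsub>B\<^esub>"] sE[OF e' x, of "\<zero>\<^bsub>B\<^esub>"] E_sub[OF e'] by simp
    ultimately show ?case by (simp add: L_def ev_def)
  next
    case (Cons p ps)
    obtain a b where p: "p = (a, b)" "a \<in> E e" "b \<in> carrier B" using Cons.prems by (cases p) auto
    have ps: "Q.valid ps" using Cons.prems by simp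
    have y: "gact X (ginv G g) x \<in> gsub X e" if "g \<in> arrs e e'" for g
      by (rule gact_mem[OF X'(1) ginv_arrs[OF that] x])
    have evE: "ev (s (gact X (ginv G g) x)) ps \<in> E e" if "g \<in> arrs e e'" for g
      using Q.ev_closed[OF sh[OF e y[OF that]] ps] unfolding Qev by simp
    have sx: "s x b \<in> E e'" "s x b \<in> carrier R" using sE[OF e' x p(3)] E_sub[OF e'] by auto
    have \<beta>s: "\<beta> g (s (gact X (ginv G g) x) b) = s x b" if g: "g \<in> arrs e e'" for g
      using sact[OF g y[OF g] p(3)] gact_ginv'[OF X'(1) g x] by simp
    have "(\<Oplus>g\<in>arrs e e'. \<beta> g (ev (s (gact X (ginv G g) x)) (p # ps)))
        = (\<Oplus>g\<in>arrs e e'. \<beta> g a \<otimes> s x b \<oplus> \<beta> g (ev (s (gact X (ginv G g) x)) ps))"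
    proof (rule R.finsum_cong')
      fix g assume g: "g \<in> arrs e e'"
      have sy: "s (gact X (ginv G g) x) b \<in> E e" by (rule sE[OF e y[OF g] p(3)])
      have "a \<otimes> s (gact X (ginv G g) x) b \<in> E e"
        using E_mult_left[OF e sy] E_sub[OF e p(2)] by simp
      then have "\<beta> g (ev (s (gact X (ginv G g) x)) (p # ps))
          = \<beta> g (a \<otimes> s (gact X (ginv G g) x) b) \<oplus> \<beta> g (ev (s (gact X (ginv G g) x)) ps)"
        using \<beta>_hom(1)[OF g _ evE[OF g]] by (simp add: p(1) ev_def)
      then show "\<beta> g (ev (s (gact X (ginv G g) x)) (p # ps))
          = \<beta> g a \<otimes> s x b \<oplus> \<beta> g (ev (s (gact X (ginv G g) x)) ps)"
        using \<beta>_hom(2)[OF g p(2) sy] \<beta>s[OF g] by simp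
    qed (use sx p \<beta>_carrier evE in auto)
    also have "\<dots> = (\<Oplus>g\<in>arrs e e'. \<beta> g a \<otimes> s x b)
        \<oplus> (\<Oplus>g\<in>arrs e e'. \<beta> g (ev (s (gact X (ginv G g) x)) ps))"
      using sx p \<beta>_carrier evE by (intro R.finsum_addf) auto
    also have "(\<Oplus>g\<in>arrs e e'. \<beta> g a \<otimes> s x b) = tr e e' a \<otimes> s x b"
      unfolding tr_def using sx p \<beta>_carrier by (intro R.finsum_ldistr[symmetric]) auto
    also have "\<dots> = trace e a \<odot> s x b"
      using trace(1)[OF e p(2)] e' sx by (simp add: KR.smult_assoc2 u_left flip: trace(2)[OF e p(2) e'])
    also have "\<dots> = s x (trace e a \<odot>\<^bsub>B\<^esub> b)"
      using alg_homD(5)[OF sh[OF e' x] trace(1)[OF e p(2)] p(3)] by simp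
    also have "\<dots> \<oplus> (\<Oplus>g\<in>arrs e e'. \<beta> g (ev (s (gact X (ginv G g) x)) ps)) = s x (L (p # ps))"
      using alg_homD(2)[OF sh[OF e' x], of "trace e a \<odot>\<^bsub>B\<^esub> b" "L ps"] trace(1)[OF e p(2)] p(3) L_closed[OF ps]
      by (simp add: Cons.IH[OF ps, symmetric]) (simp add: L_def p(1))
    finally show ?case by simp
  qed
  show "bij_betw (eval_at X s B) (carrier B) (carrier (A X))"
  proof (rule bij_betw_imageI)
    show "inj_on (eval_at X s B) (carrier B)"
    proof (rule inj_onI)
      fix b b' assume b: "b \<in> carrier B" "b' \<in> carrier B" and eq: "eval_at X s B b = eval_at X s B b'"
      have "Q.teq [(c, b)] [(c, b')]"
      proof (rule Qinj)
        fix \<phi> assume "\<phi> \<in> V e"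
        then obtain x where x: "x \<in> gsub X e" "\<phi> = s x" using bij_betw_imp_surj_on[OF s[OF e]] by blast
        then have "\<phi> b = \<phi> b'" using eval_at[OF _ gsub_gcar[OF X'(1) e x(1)]] b eq by metis
        then show "ev \<phi> [(c, b)] = ev \<phi> [(c, b')]" by (simp add: ev_def)
      qed (use b c in auto)
      then show "b = b'" using L_cong L_single b by metis
    qed
    have "F \<in> eval_at X s B ` carrier B" if F: "F \<in> carrier (A X)" for F
    proof -
      have cF: "c \<otimes> F x \<in> E e" if "x \<in> gsub X e" for x
        using A_memD(2)[OF X F e that] c e E_sub by (intro E_mult_left) auto
      have inv: "inv_into (gsub X e) s \<phi> \<in> gsub X e" if "\<phi> \<in> V e" for \<phi>
        using bij_betw_imp_surj_on[OF s[OF e]] that inv_into_into by metis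
      obtain ps where ps: "Q.valid ps" "\<And>\<phi>. \<phi> \<in> V e \<Longrightarrow> ev \<phi> ps = c \<otimes> F (inv_into (gsub X e) s \<phi>)"
        using Qsurj[of "\<lambda>\<phi>. c \<otimes> F (inv_into (gsub X e) s \<phi>)"] cF[OF inv] by blast
      have evs: "ev (s x) ps = c \<otimes> F x" if "x \<in> gsub X e" for x
        using ps(2)[OF sV[OF e that]] bij_betw_inv_into_left[OF s[OF e] that] by simp
      have "eval_at X s B (L ps) = F"
      proof (rule A_ext[OF X mem[OF L_closed[OF ps(1)]] F])
        fix x assume x: "x \<in> gcar X"
        note px = pos[OF X'(2) x]
        have y: "gact X (ginv G g) x \<in> gsub X e" if "g \<in> arrs e (pos X x)" for g
          by (rule gact_mem[OF X'(1) ginv_arrs[OF that] px(2)])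
        have "eval_at X s B (L ps) x
            = (\<Oplus>g\<in>arrs e (pos X x). \<beta> g (ev (s (gact X (ginv G g) x)) ps))"
          using eval_at[OF L_closed[OF ps(1)] x] sL[OF px ps(1)] by simp
        \<comment> \<open>The evaluations of \<open>ps\<close> are the values of
          \<open>c \<otimes> F x\<close>, and averaging these multiplies \<open>F\<close> by the
          trace of \<open>c\<close>, which is 1.\<close>
        also have "\<dots> = avg X e (\<lambda>x. c \<otimes> F x) x"
          unfolding avg_eq[OF X px] using evs[OF y] \<beta>_carrier cF[OF y]
          by (intro R.finsum_cong') auto
        also have "\<dots> = (\<one>\<^bsub>K\<^esub> \<odot>\<^bsub>A X\<^esub> F) x" using avg_mult[OF X e c(1) F] c(2) by simp
        also have "\<dots> = F x" using x A_memD(4)[OF X F x] by (simp add: A_simps)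
        finally show "eval_at X s B (L ps) x = F x" .
      qed
      then show ?thesis using L_closed[OF ps(1)] by blast
    qed
    then show "eval_at X s B ` carrier B = carrier (A X)" using mem by blast
  qed
qed

lemma eval_at_split_iso:
  fixes X :: "('g, 'x) gset" and B :: "('k, 'b) module"
  assumes X: "split_gset X" and P: "split_alg B V"
    and s: "\<And>e. e \<in> idents G \<Longrightarrow> bij_betw s (gsub X e) (V e)"
    and act: "\<And>g e e' x. g \<in> arrs e e' \<Longrightarrow> x \<in> gsub X e \<Longrightarrow>
      s (gact X g x) = (\<lambda>b\<in>carrier B. \<beta> g (s x b))"
  shows "split_iso G K (B, V) (theta G R E u \<beta> X) (eval_at X s B)"
proof -
  note X' = split_gsetD[OF X] and P' = split_algD[OF P]
  have hom: "eval_at X s B \<in> alg_hom K B (A X)" by (rule eval_at_bij_hom(1)[OF X P s act])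
  have bij: "bij_betw (eval_at X s B) (carrier B) (carrier (A X))"
    by (rule eval_at_bij_hom(2)[OF X P s act])
  define h where "h = (\<lambda>F\<in>carrier (A X). inv_into (carrier B) (eval_at X s B) F)"
  have h: "h F \<in> carrier B" "eval_at X s B (h F) = F" if "F \<in> carrier (A X)" for F
    using that bij_betw_imp_surj_on[OF bij] inv_into_into[of F "eval_at X s B" "carrier B"]
      f_inv_into_f[of F "eval_at X s B" "carrier B"] by (simp_all add: h_def)
  have hf: "h (eval_at X s B b) = b" if "b \<in> carrier B" for b
    using bij_betw_apply[OF bij that] bij_betw_inv_into_left[OF bij that] by (simp add: h_def)
  have V: "V e = s ` gsub X e" if "e \<in> idents G" for e
    using bij_betw_imp_surj_on[OF s[OF that]] by simp
  have ext: "s x \<in> extensional (carrier B)" if "e \<in> idents G" "x \<in> gsub X e" for e x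
    using P'(6)[OF that(1)] that by (simp add: V)
  \<comment> \<open>A bijective algebra homomorphism is an isomorphism of split algebras only if it
    matches the splittings in both directions; \<open>c1\<close> and \<open>c2\<close> are the two
    directions.\<close>
  have c1: "compose (carrier B) (pt X x) (eval_at X s B) = s x" if "e \<in> idents G" "x \<in> gsub X e" for e x
  proof (rule extensionalityI[OF _ ext[OF that]])
    show "compose (carrier B) (pt X x) (eval_at X s B) b = s x b" if b: "b \<in> carrier B" for b
      using bij_betw_apply[OF bij b] b gsub_gcar[OF X'(1) \<open>e \<in> idents G\<close> \<open>x \<in> gsub X e\<close>]
      by (simp add: compose_eq pt_def) (simp add: eval_at_def)
  qed (simp add: compose_extensional)
  have c2: "compose (carrier (A X)) (s x) h = pt X x" if "e \<in> idents G" "x \<in> gsub X e" for e x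
  proof (rule extensionalityI[of _ "carrier (A X)"])
    show "compose (carrier (A X)) (s x) h F = pt X x F" if F: "F \<in> carrier (A X)" for F
      using fun_cong[OF c1[OF \<open>e \<in> idents G\<close> \<open>x \<in> gsub X e\<close>], of "h F"] h[OF F] F
      by (simp add: compose_eq)
  qed (simp_all add: compose_extensional pt_def)
  have "h \<in> alg_hom K (A X) B" by (rule alg_hom_inverse[OF P'(1) hom]) (use h hf in auto)
  moreover have "h \<in> extensional (carrier (A X))" by (simp add: h_def)
  ultimately have "h \<in> split_homs G K (theta G R E u \<beta> X) (B, V)"
    unfolding theta_eq split_homs_iff by (auto simp: V c2)
  moreover have "eval_at X s B \<in> split_homs G K (B, V) (theta G R E u \<beta> X)"
    unfolding theta_eq split_homs_iff using hom by (auto simp: V c1) (simp add: eval_at_def)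
  ultimately show ?thesis
    unfolding split_iso_def using h(2) hf by (auto simp: theta_eq intro!: bexI[of _ h])
qed

section \<open>The isomorphism from a split algebra to functions on its homomorphisms\<close>

definition \<epsilon> :: "('k, 'b) module \<times> ('g \<Rightarrow> ('b \<Rightarrow> 'r) set) \<Rightarrow> 'b \<Rightarrow> 'g \<times> ('b \<Rightarrow> 'r) \<Rightarrow> 'r" where
  "\<epsilon> P = eval_at (V_gset G \<beta> P) snd (fst P)"

lemma \<epsilon>_iso:
  assumes P: "split_alg B V"
  shows "split_iso G K (B, V) (theta G R E u \<beta> (V_gset G \<beta> (B, V))) (\<epsilon> (B, V))"
  unfolding \<epsilon>_def fst_conv
proof (rule eval_at_split_iso[OF V_split_gset[OF P] P])
  show "bij_betw snd (gsub (V_gset G \<beta> (B, V)) e) (V e)" if "e \<in> idents G" for e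
    using that by (auto simp: V_gsub bij_betw_def inj_on_def)
  show "snd (gact (V_gset G \<beta> (B, V)) g p) = (\<lambda>b\<in>carrier B. \<beta> g (snd p b))" if "g \<in> arrs e e'" for g e e' p
    by (cases p) (simp add: V_gset_simps)
qed

lemma \<epsilon>_natural:
  assumes P: "split_alg B V" and Q: "split_alg B' V'" and f: "f \<in> split_homs G K (B, V) (B', V')"
    and b: "b \<in> carrier B"
  shows "theta_map G R E u \<beta> (V_gset G \<beta> (B', V')) (V_gset G \<beta> (B, V)) (theta'_map G (B, V) (B', V') f)
      (\<epsilon> (B, V) b) = \<epsilon> (B', V') (f b)"
proof -
  have fb: "f b \<in> carrier B'" using f b alg_homD(1) by (auto simp: split_homs_iff)
  have "\<epsilon> (B, V) \<in> split_homs G K (B, V) (theta G R E u \<beta> (V_gset G \<beta> (B, V)))"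
    using \<epsilon>_iso[OF P] by (simp add: split_iso_def)
  then have "\<epsilon> (B, V) b \<in> carrier (A (V_gset G \<beta> (B, V)))"
    using b alg_homD(1) by (auto simp: theta_eq split_homs_iff)
  then have "theta_map G R E u \<beta> (V_gset G \<beta> (B', V')) (V_gset G \<beta> (B, V)) (theta'_map G (B, V) (B', V') f)
      (\<epsilon> (B, V) b) = compose (gcar (V_gset G \<beta> (B', V'))) (\<epsilon> (B, V) b) (theta'_map G (B, V) (B', V') f)"
    by (simp add: theta_map_def)
  also have "\<dots> = \<epsilon> (B', V') (f b)"
    using b fb f
    by (auto simp: \<epsilon>_def eval_at_def V_gset_simps theta'_map_def compose_def split_homs_iff
        intro!: restrict_ext)
  finally show ?thesis .
qed

text \<open>By the condition on splittings, a morphism \<open>f\<close> composed with evaluation at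
  \<open>x\<close> is evaluation at some point of \<open>Y\<close> over the same identity.
  Evaluations separate the points of a piece, so this point is unique; taking it as
  \<open>h x\<close> reconstructs the map behind \<open>f\<close>, and the same separation gives
  injectivity.\<close>

lemma theta_map_bij:
  fixes X Y :: "('g, 'x) gset"
  assumes X: "split_gset X" and Y: "split_gset Y"
  shows "bij_betw (theta_map G R E u \<beta> X Y) (gmaps G X Y)
    (split_homs G K (theta G R E u \<beta> Y) (theta G R E u \<beta> X))"
proof (rule bij_betw_imageI)
  note X' = split_gsetD[OF X] and Y' = split_gsetD[OF Y]
  show "inj_on (theta_map G R E u \<beta> X Y) (gmaps G X Y)"
  proof (rule inj_onI)
    fix h h' assume h: "h \<in> gmaps G X Y" and h': "h' \<in> gmaps G X Y"
      and eq: "theta_map G R E u \<beta> X Y h = theta_map G R E u \<beta> X Y h'"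
    show "h = h'"
    proof (rule extensionalityI[of _ "gcar X"])
      fix x assume x: "x \<in> gcar X"
      note px = pos[OF X'(2) x]
      have "pt Y (h x) = pt Y (h' x)"
        using compose_pt_theta_map[OF X Y h x] compose_pt_theta_map[OF X Y h' x] eq by simp
      then show "h x = h' x"
        using A_splits(2)[OF Y px(1)] gmapsD(3)[OF X'(1) h px] gmapsD(3)[OF X'(1) h' px]
        by (auto dest: inj_onD)
    qed (use gmapsD(1)[OF X'(1)] h h' in auto)
  qed
  have "f \<in> theta_map G R E u \<beta> X Y ` gmaps G X Y"
    if f: "f \<in> split_homs G K (theta G R E u \<beta> Y) (theta G R E u \<beta> X)" for f
  proof -
    have fhom: "f \<in> alg_hom K (A Y) (A X)" and fext: "f \<in> extensional (carrier (A Y))"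
      and fpt: "\<And>e x. e \<in> idents G \<Longrightarrow> x \<in> gsub X e \<Longrightarrow>
        compose (carrier (A Y)) (pt X x) f \<in> pt Y ` gsub Y e"
      using f by (auto simp: theta_eq split_homs_iff)
    note fA = alg_homD(1)[OF fhom]
    define h where "h = (\<lambda>x\<in>gcar X.
      inv_into (gsub Y (pos X x)) (pt Y) (compose (carrier (A Y)) (pt X x) f))"
    have h: "h x \<in> gsub Y e \<and> pt Y (h x) = compose (carrier (A Y)) (pt X x) f"
      if "e \<in> idents G" "x \<in> gsub X e" for e x
    proof -
      have "h x = inv_into (gsub Y e) (pt Y) (compose (carrier (A Y)) (pt X x) f)"
        using gsub_gcar[OF X'(1) that] pos_eq[OF X'(2) that] by (simp add: h_def)
      then show ?thesis using fpt[OF that] inv_into_into f_inv_into_f by metis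
    qed
    have fh: "f F x = F (h x)" if "F \<in> carrier (A Y)" "e \<in> idents G" "x \<in> gsub X e" for F e x
      using fun_cong[OF conjunct2[OF h[OF that(2,3)]], of F] that(1) fA[OF that(1)]
      by (simp add: pt_def compose_eq)
    have "h \<in> gmaps G X Y"
    proof (rule gmapsI[OF X'(1,2) Y'(1)])
      show "h \<in> extensional (gcar X)" by (simp add: h_def)
      show "h x \<in> gsub Y e" if "e \<in> idents G" "x \<in> gsub X e" for e x using h[OF that] by simp
      fix g e e' x assume gx: "g \<in> arrs e e'" "x \<in> gsub X e"
      note e = arrsD(4,5)[OF gx(1)]
      note gx' = gact_mem[OF X'(1) gx]
      have hx: "h x \<in> gsub Y e" "h (gact X g x) \<in> gsub Y e'"
        using h[OF e(1) gx(2)] h[OF e(2) gx'] by auto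
      \<comment> \<open>Equivariance of \<open>h\<close> is tested on evaluations: both points lie
        in the piece at \<open>e'\<close>, and all equivariant functions agree on them since
        \<open>F\<close> and \<open>f F\<close> are equivariant.\<close>
      have "pt Y (h (gact X g x)) F = pt Y (gact Y g (h x)) F" if F: "F \<in> carrier (A Y)" for F
        using fh[OF F e(2) gx'] fh[OF F e(1) gx(2)] A_memD(5)[OF X fA[OF F] gx]
          A_memD(5)[OF Y F gx(1) hx(1)] F by (simp add: pt_def)
      then have "pt Y (h (gact X g x)) = pt Y (gact Y g (h x))"
        by (intro extensionalityI[of _ "carrier (A Y)"]) (simp_all add: pt_def)
      then show "h (gact X g x) = gact Y g (h x)"
        using A_splits(2)[OF Y e(2)] hx(2) gact_mem[OF Y'(1) gx(1) hx(1)] by (auto dest: inj_onD)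
    qed
    moreover have "theta_map G R E u \<beta> X Y h = f"
    proof (rule extensionalityI[OF _ fext])
      fix F assume F: "F \<in> carrier (A Y)"
      show "theta_map G R E u \<beta> X Y h F = f F"
      proof (rule A_ext[OF X theta_map_mem[OF X Y \<open>h \<in> gmaps G X Y\<close> F] fA[OF F]])
        fix x assume x: "x \<in> gcar X"
        show "theta_map G R E u \<beta> X Y h F x = f F x"
          using theta_map_apply[OF F x, of h] fh[OF F pos[OF X'(2) x]] by simp
      qed
    qed (simp add: theta_map_def)
    ultimately show ?thesis by blast
  qed
  then show "theta_map G R E u \<beta> X Y ` gmaps G X Y
      = split_homs G K (theta G R E u \<beta> Y) (theta G R E u \<beta> X)"
    using theta_map_hom[OF X Y] by blast
qed

text \<open>The homomorphisms of \<open>B\<close> form a finite set on a type other than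
  \<open>'x\<close>. An infinite type has a finite subset \<open>S\<close> of the same cardinality,
  and the action is transported to \<open>S\<close> along a bijection \<open>t\<close>.\<close>

lemma theta_ess_surj:
  fixes B :: "('k, 'x \<Rightarrow> 'r) module"
  assumes inf: "infinite (UNIV :: 'x set)" and P: "split_alg B V"
  shows "\<exists>X :: ('g, 'x) gset. split_gset X \<and> isomorphic (split_algebras G K R E u \<beta>) (theta G R E u \<beta> X) (B, V)"
proof -
  let ?Y = "V_gset G \<beta> (B, V)"
  note Y = V_split_gset[OF P]
  note Y' = split_gsetD[OF Y]
  obtain S :: "'x set" where S: "finite S" "card S = card (gcar ?Y)"
    using infinite_arbitrarily_large[OF inf] by blast
  obtain t where t: "bij_betw t (gcar ?Y) S" using finite_same_card_bij[OF Y'(3) S(1)] S(2) by metis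
  define t' where "t' = inv_into (gcar ?Y) t"
  have t't: "t' (t y) = y" if "y \<in> gcar ?Y" for y
    unfolding t'_def by (rule bij_betw_inv_into_left[OF t that])
  define X where "X = \<lparr>gcar = S, gsub = (\<lambda>g. t ` gsub ?Y g), gact = (\<lambda>g x. t (gact ?Y g (t' x)))\<rparr>"
  note sub = gsub_gcar[OF Y'(1)]
  have X: "is_gset G X"
  proof (rule is_gsetI)
    show "gcar X \<noteq> {}" using t Y'(1) unfolding is_gset_def X_def bij_betw_def by auto
    show "gsub X e \<subseteq> gcar X" if "e \<in> idents G" for e
      using sub[OF that] t unfolding X_def bij_betw_def by auto
    show "gsub X g = gsub X (grng G g)" if "g \<in> arr G" for g
      using that by (simp add: X_def V_gset_simps)
  next
    fix g e e' x assume g: "g \<in> arrs e e'" and "x \<in> gsub X e"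
    then obtain y where y: "y \<in> gsub ?Y e" "x = t y" by (auto simp: X_def)
    then show "gact X g x \<in> gsub X e'"
      using gact_mem[OF Y'(1) g y(1)] t't[OF sub[OF arrsD(4)[OF g] y(1)]] by (simp add: X_def)
  next
    fix e x assume e: "e \<in> idents G" and "x \<in> gsub X e"
    then obtain y where y: "y \<in> gsub ?Y e" "x = t y" by (auto simp: X_def)
    then show "gact X e x = x"
      using gact_ident[OF Y'(1) e y(1)] t't[OF sub[OF e y(1)]] by (simp add: X_def)
  next
    fix h g e e' e'' x assume h: "h \<in> arrs e' e''" and g: "g \<in> arrs e e'" and "x \<in> gsub X e"
    then obtain y where y: "y \<in> gsub ?Y e" "x = t y" by (auto simp: X_def)
    then show "gact X h (gact X g x) = gact X (gmult G h g) x"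
      using gact_comp[OF Y'(1) h g y(1)] t't[OF sub[OF arrsD(4)[OF g] y(1)]]
        t't[OF sub[OF arrsD(5)[OF g] gact_mem[OF Y'(1) g y(1)]]] by (simp add: X_def)
  qed
  have "is_split G X"
    unfolding is_split_def disjoint_family_on_def
  proof (intro conjI ballI impI)
    show "gcar X = (\<Union>e\<in>idents G. gsub X e)"
      using t Y'(2) unfolding is_split_def X_def bij_betw_def by auto
    fix e e' assume e: "e \<in> idents G" "e' \<in> idents G" "e \<noteq> e'"
    then have "gsub ?Y e \<inter> gsub ?Y e' = {}" using Y'(2) unfolding is_split_def disjoint_family_on_def by blast
    then show "gsub X e \<inter> gsub X e' = {}"
      using t't[OF sub[OF e(1)]] t't[OF sub[OF e(2)]] unfolding X_def by (auto, metis disjoint_iff)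
  qed
  then have sX: "split_gset X" using X S by (simp add: split_gset_def X_def)
  define s where "s x = snd (t' x)" for x
  have "split_iso G K (B, V) (theta G R E u \<beta> X) (eval_at X s B)"
  proof (rule eval_at_split_iso[OF sX P])
    fix e assume e: "e \<in> idents G"
    have "s ` gsub X e = V e" "inj_on s (gsub X e)"
      using t't[OF sub[OF e]] e by (force simp: s_def X_def V_gsub image_image inj_on_def)+
    then show "bij_betw s (gsub X e) (V e)" by (simp add: bij_betw_def)
  next
    fix g e e' x assume g: "g \<in> arrs e e'" and "x \<in> gsub X e"
    then obtain y where y: "y \<in> gsub ?Y e" "x = t y" by (auto simp: X_def)
    have "s (gact X g x) = snd (gact ?Y g y)"
      using t't[OF sub[OF arrsD(4)[OF g] y(1)]]
        t't[OF sub[OF arrsD(5)[OF g] gact_mem[OF Y'(1) g y(1)]]] y(2) by (simp add: s_def X_def)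
    moreover have "s x = snd y" using t't[OF sub[OF arrsD(4)[OF g] y(1)]] y(2) by (simp add: s_def)
    ultimately show "s (gact X g x) = (\<lambda>b\<in>carrier B. \<beta> g (s x b))"
      by (cases y) (simp add: V_gset_simps)
  qed
  then obtain h where f: "eval_at X s B \<in> split_homs G K (B, V) (theta G R E u \<beta> X)"
    and h: "h \<in> split_homs G K (theta G R E u \<beta> X) (B, V)"
    and inv: "\<And>b. b \<in> carrier B \<Longrightarrow> h (eval_at X s B b) = b"
      "\<And>c. c \<in> carrier (A X) \<Longrightarrow> eval_at X s B (h c) = c"
    unfolding split_iso_def theta_eq by auto
  have "isomorphic (split_algebras G K R E u \<beta>) (theta G R E u \<beta> X) (B, V)"
    unfolding isomorphic_def split_algebras_simps
  proof (intro bexI conjI)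
    show "compose (carrier (fst (theta G R E u \<beta> X))) (eval_at X s B) h
        = (\<lambda>b\<in>carrier (fst (theta G R E u \<beta> X)). b)"
      using inv(2) by (auto simp: compose_def theta_eq intro!: restrict_ext)
    show "compose (carrier (fst (B, V))) h (eval_at X s B) = (\<lambda>b\<in>carrier (fst (B, V)). b)"
      using inv(1) by (auto simp: compose_def intro!: restrict_ext)
  qed (rule f h)+
  then show ?thesis using sX by blast
qed

text \<open>The algebra homomorphism \<open>\<psi>\<close> is determined by the idempotents \<open>\<Sum>\<^sub>j a\<^sub>j \<psi>(b\<^sub>j)\<close> that it assigns to
  the primitive idempotents of \<open>E\<^sub>e \<otimes> B = E\<^sub>e\<^sup>m\<close>; one of them is nonzero, hence \<open>1\<^sub>e\<close>.\<close>

lemma alg_hom_mem_V: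
  fixes B :: "('k, 'b) module"
  assumes P: "split_alg B V" and e: "e \<in> idents G"
    and conn: "\<And>x. x \<in> E e \<Longrightarrow> x \<otimes> x = x \<Longrightarrow> x = \<zero> \<or> x = u e"
    and \<psi>: "\<psi> \<in> alg_hom K B (EA e)" "\<psi> \<in> extensional (carrier B)"
  shows "\<psi> \<in> V e"
proof -
  note P' = split_algD[OF P]
  interpret B: algebra K B by (rule P'(1))
  interpret Q: algebra_pair K "EA e" B by (rule E_pair[OF e P'(1)])
  have Qev: "Q.ev \<phi> = ev \<phi>" for \<phi> by (rule EA_ev)
  have surj: "\<exists>ps. Q.valid ps \<and> (\<forall>\<phi>\<in>V e. ev \<phi> ps = F \<phi>)" if "\<And>\<phi>. \<phi> \<in> V e \<Longrightarrow> F \<phi> \<in> E e" for F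
    using P'(4)[OF e] that unfolding Q.splits_def Qev by simp
  have inj: "Q.teq ps qs" if "Q.valid ps" "Q.valid qs" "\<And>\<phi>. \<phi> \<in> V e \<Longrightarrow> ev \<phi> ps = ev \<phi> qs" for ps qs
    using P'(4)[OF e] that unfolding Q.splits_def Qev by blast
  note hom = P'(5)[OF e]
  note times = Q.ev_times[unfolded Qev, unfolded EA_simps(5)]
  note cong = Q.ev_cong[unfolded Qev]
  note app = Q.ev_append[unfolded Qev, unfolded EA_simps(4)]
  have cl: "ev \<phi> ps \<in> E e" if "\<phi> \<in> alg_hom K B (EA e)" "Q.valid ps" for \<phi> ps
    using Q.ev_closed[OF that] unfolding Qev by simp
  have homE: "\<phi> b \<in> E e" if "\<phi> \<in> alg_hom K B (EA e)" "b \<in> carrier B" for \<phi> b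
    using alg_homD(1)[OF that] by simp
  have hom1: "\<phi> \<one>\<^bsub>B\<^esub> = u e" if "\<phi> \<in> alg_hom K B (EA e)" for \<phi>
    using alg_homD(4)[OF that] by simp
  have single: "ev \<phi> [(a, b)] = a \<otimes> \<phi> b" if "\<phi> \<in> alg_hom K B (EA e)" "a \<in> E e" "b \<in> carrier B" for \<phi> a b
    using E_sub[OF e that(2)] E_sub[OF e homE[OF that(1,3)]] by (simp add: ev_def)
  have uc: "u e \<otimes> a = a" "a \<otimes> u e = a" "\<zero> \<otimes> a = \<zero>" if "a \<in> E e" for a
    using e that E_sub by (simp_all add: u_left u_right)
  have "\<exists>ps. Q.valid ps \<and> (\<forall>\<phi>'\<in>V e. ev \<phi>' ps = (if \<phi>' = \<phi> then u e else \<zero>))" for \<phi>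
    using e E_zero[OF e] by (intro surj) simp
  \<comment> \<open>\<open>z \<phi>\<close> represents the idempotent of the tensor product that is
    supported at the coordinate \<open>\<phi>\<close>.\<close>
  then obtain z where zv: "\<And>\<phi>. Q.valid (z \<phi>)"
    and z: "\<And>\<phi> \<phi>'. \<phi>' \<in> V e \<Longrightarrow> ev \<phi>' (z \<phi>) = (if \<phi>' = \<phi> then u e else \<zero>)" by metis
  \<comment> \<open>Evaluations along \<open>V e\<close> detect equality of tensors, so
    \<open>z \<phi>\<close> is idempotent modulo the congruence, and its value under
    \<open>\<psi>\<close> is an idempotent of \<open>E e\<close>.\<close>
  have idem: "ev \<psi> (z \<phi>) = \<zero> \<or> ev \<psi> (z \<phi>) = u e" for \<phi>
  proof (rule conn[OF cl[OF \<psi>(1) zv]])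
    have "Q.teq (Q.times (z \<phi>) (z \<phi>)) (z \<phi>)"
      by (rule inj[OF Q.times_valid[OF zv zv] zv]) (use e times[OF hom zv zv] z uc in auto)
    from cong[OF \<psi>(1) this] show "ev \<psi> (z \<phi>) \<otimes> ev \<psi> (z \<phi>) = ev \<psi> (z \<phi>)"
      using times[OF \<psi>(1) zv zv] by simp
  qed
  have one: "Q.valid [(u e, \<one>\<^bsub>B\<^esub>)]" using e by simp
  have "\<exists>\<phi>\<in>V e. ev \<psi> (z \<phi>) \<noteq> \<zero>"
  proof (rule ccontr)
    assume "\<not> ?thesis"
    then have zero: "ev \<psi> (z \<phi>) = \<zero>" if "\<phi> \<in> V e" for \<phi> using that by blast
    \<comment> \<open>If all values vanished, so would the value of every partial sum of the
      \<open>z \<phi>\<close>. The full sum has the evaluations of the identity tensor and is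
      therefore congruent to it, but \<open>\<psi>\<close> sends the identity tensor to
      \<open>u e\<close>.\<close>
    have "\<exists>ps. Q.valid ps \<and> ev \<psi> ps = \<zero> \<and> (\<forall>\<phi>\<in>V e. ev \<phi> ps = (if \<phi> \<in> S then u e else \<zero>))"
      if "S \<subseteq> V e" for S
      using finite_subset[OF that P'(7)[OF e]] that
    proof (induction S)
      case empty
      show ?case by (rule exI[of _ "[]"]) (simp add: ev_def)
    next
      case (insert \<phi> S)
      then obtain ps where ps: "Q.valid ps" "ev \<psi> ps = \<zero>"
        "\<forall>\<phi>\<in>V e. ev \<phi> ps = (if \<phi> \<in> S then u e else \<zero>)" by auto
      show ?case
      proof (intro exI[of _ "ps @ z \<phi>"] conjI ballI)
        show "Q.valid (ps @ z \<phi>)" using ps(1) zv by simp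
        show "ev \<psi> (ps @ z \<phi>) = \<zero>"
          using app[OF \<psi>(1) ps(1) zv] ps(2) zero insert.prems by simp
        show "ev \<phi>' (ps @ z \<phi>) = (if \<phi>' \<in> insert \<phi> S then u e else \<zero>)" if "\<phi>' \<in> V e" for \<phi>'
          using app[OF hom[OF that] ps(1) zv] ps(3) z[OF that] that insert.hyps e by auto
      qed
    qed
    from this[of "V e"] obtain ps where ps: "Q.valid ps" "ev \<psi> ps = \<zero>" "\<And>\<phi>. \<phi> \<in> V e \<Longrightarrow> ev \<phi> ps = u e"
      by auto
    have "Q.teq ps [(u e, \<one>\<^bsub>B\<^esub>)]"
      by (rule inj[OF ps(1) one]) (simp add: e ps(3) single[OF hom] hom1[OF hom] uc)
    from cong[OF \<psi>(1) this] show False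
      using ps(2) u_ne[OF e] single[OF \<psi>(1), of "u e" "\<one>\<^bsub>B\<^esub>"] hom1[OF \<psi>(1)] e uc by simp
  qed
  then obtain \<phi> where \<phi>: "\<phi> \<in> V e" "ev \<psi> (z \<phi>) = u e" using idem by blast
  have "\<psi> = \<phi>"
  proof (rule extensionalityI[OF \<psi>(2) P'(6)[OF e \<phi>(1)]])
    fix b assume b: "b \<in> carrier B"
    have v: "Q.valid [(u e, b)]" "Q.valid [(\<phi> b, \<one>\<^bsub>B\<^esub>)]" using e b homE[OF hom[OF \<phi>(1)] b] by auto
    \<comment> \<open>On the component cut out by \<open>z \<phi>\<close>, the element
      \<open>b\<close> acts as the constant \<open>\<phi> b\<close>: both products evaluate to
      \<open>\<phi> b\<close> at \<open>\<phi>\<close> and to zero at the other homomorphisms.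
      Evaluating along \<open>\<psi>\<close>, where \<open>z \<phi>\<close> becomes
      \<open>u e\<close>, compares \<open>\<psi> b\<close> with \<open>\<phi> b\<close>.\<close>
    have "Q.teq (Q.times (z \<phi>) [(u e, b)]) (Q.times (z \<phi>) [(\<phi> b, \<one>\<^bsub>B\<^esub>)])"
    proof (rule inj[OF Q.times_valid[OF zv v(1)] Q.times_valid[OF zv v(2)]])
      fix \<phi>' assume \<phi>': "\<phi>' \<in> V e"
      show "ev \<phi>' (Q.times (z \<phi>) [(u e, b)]) = ev \<phi>' (Q.times (z \<phi>) [(\<phi> b, \<one>\<^bsub>B\<^esub>)])"
        unfolding times[OF hom[OF \<phi>'] zv v(1)] times[OF hom[OF \<phi>'] zv v(2)] z[OF \<phi>']
        using single[OF hom[OF \<phi>']] homE[OF hom[OF \<phi>']] homE[OF hom[OF \<phi>(1)]]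
          hom1[OF hom[OF \<phi>']] b e uc by auto
    qed
    from cong[OF \<psi>(1) this] show "\<psi> b = \<phi> b"
      unfolding times[OF \<psi>(1) zv v(1)] times[OF \<psi>(1) zv v(2)] \<phi>(2)
      using single[OF \<psi>(1)] homE[OF \<psi>(1)] homE[OF hom[OF \<phi>(1)]] hom1[OF \<psi>(1)] b e uc
      by simp
  qed
  then show ?thesis using \<phi>(1) by simp
qed

end

section \<open>Natural isomorphisms, the equivalence of fixed categories, and the connected
  case\<close>

theorem theorem4p5:
  fixes K :: "'k ring"
    and R :: "('k, 'r) module"
    and G :: "'g groupoid"
    and E :: "'g \<Rightarrow> 'r set"
    and u :: "'g \<Rightarrow> 'r"
    and \<beta> :: "'g \<Rightarrow> 'r \<Rightarrow> 'r"
  assumes "cring K" and "\<one>\<^bsub>K\<^esub> \<noteq> \<zero>\<^bsub>K\<^esub>"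
    and "is_groupoid G" and "finite (arr G)"
    and "algebra K R" and "faithful_module K R"
    and "is_algebra_action G K R E \<beta>"
    and "\<forall>e\<in>idents G. has_identity R (E e) (u e)"
    and "is_direct_sum G R E"
    and "invariants G R u \<beta> = (\<lambda>k. k \<odot>\<^bsub>R\<^esub> \<one>\<^bsub>R\<^esub>) ` carrier K"
    and "has_galois_coordinates G R u \<beta>"
    and "\<forall>g\<in>arr G. faithfully_projective K (ideal_algebra R (E g) (u (grng G g)))"
  shows
    "\<comment> \<open>\<open>\<theta>\<close> and \<open>\<theta>'\<close> are contravariant functors\<close>
     contravariant_functor
       (fin_split_gsets G :: (('g, 'x) gset, 'x \<Rightarrow> 'x) cat) (split_algebras G K R E u \<beta>)
       (theta G R E u \<beta>) (theta_map G R E u \<beta>) \<and>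
     contravariant_functor
       (split_algebras G K R E u \<beta> ::
          (('k, 'b) module \<times> ('g \<Rightarrow> ('b \<Rightarrow> 'r) set), 'b \<Rightarrow> 'b) cat) (fin_split_gsets G)
       (V_gset G \<beta>) (theta'_map G) \<and>
     \<comment> \<open>\<open>\<theta>' \<circ> \<theta>\<close> is naturally isomorphic to the identity\<close>
     (\<exists>\<eta>.
       (\<forall>X \<in> Ob (fin_split_gsets G :: (('g, 'x) gset, 'x \<Rightarrow> 'x) cat).
          gset_iso G X (V_gset G \<beta> (theta G R E u \<beta> X)) (\<eta> X)) \<and>
       (\<forall>X \<in> Ob (fin_split_gsets G). \<forall>Y \<in> Ob (fin_split_gsets G).
          \<forall>h \<in> Hom (fin_split_gsets G) X Y. \<forall>x \<in> gcar X.
          theta'_map G (theta G R E u \<beta> Y) (theta G R E u \<beta> X) (theta_map G R E u \<beta> X Y h) (\<eta> X x)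
            = \<eta> Y (h x))) \<and>
     \<comment> \<open>\<open>\<theta> \<circ> \<theta>'\<close> is naturally isomorphic to the identity\<close>
     (\<exists>\<epsilon>.
       (\<forall>P \<in> Ob (split_algebras G K R E u \<beta> ::
            (('k, 'b) module \<times> ('g \<Rightarrow> ('b \<Rightarrow> 'r) set), 'b \<Rightarrow> 'b) cat).
          split_iso G K P (theta G R E u \<beta> (V_gset G \<beta> P)) (\<epsilon> P)) \<and>
       (\<forall>P \<in> Ob (split_algebras G K R E u \<beta>). \<forall>Q \<in> Ob (split_algebras G K R E u \<beta>).
          \<forall>f \<in> Hom (split_algebras G K R E u \<beta>) P Q. \<forall>b \<in> carrier (fst P).
          theta_map G R E u \<beta> (V_gset G \<beta> Q) (V_gset G \<beta> P) (theta'_map G P Q f) (\<epsilon> P b)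
            = \<epsilon> Q (f b))) \<and>
     \<comment> \<open>over a type that contains all finite sets up to bijection, \<open>\<theta>\<close> is an equivalence between
         two fixed categories\<close>
     (infinite (UNIV :: 'x set) \<longrightarrow>
       contravariant_equivalence
         (fin_split_gsets G :: (('g, 'x) gset, 'x \<Rightarrow> 'x) cat) (split_algebras G K R E u \<beta>)
         (theta G R E u \<beta>) (theta_map G R E u \<beta>)) \<and>
     \<comment> \<open>if the \<open>E e\<close> are connected, splittings are unique and every algebra homomorphism is a
         morphism of split algebras\<close>
     ((\<forall>e\<in>idents G. \<forall>x\<in>E e. x \<otimes>\<^bsub>R\<^esub> x = x \<longrightarrow> x = \<zero>\<^bsub>R\<^esub> \<or> x = u e) \<longrightarrow>
       (\<forall>(B :: ('k, 'b) module) V V'.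
          (B, V) \<in> Ob (split_algebras G K R E u \<beta>) \<longrightarrow>
          (B, V') \<in> Ob (split_algebras G K R E u \<beta>) \<longrightarrow> V = V') \<and>
       (\<forall>P \<in> Ob (split_algebras G K R E u \<beta> ::
            (('k, 'b) module \<times> ('g \<Rightarrow> ('b \<Rightarrow> 'r) set), 'b \<Rightarrow> 'b) cat).
        \<forall>Q \<in> Ob (split_algebras G K R E u \<beta>).
          Hom (split_algebras G K R E u \<beta>) P Q
            = alg_hom K (fst P) (fst Q) \<inter> extensional (carrier (fst P))))"
proof -
  interpret galois_action K R G E u \<beta>
    using assms unfolding galois_action_def galois_action_axioms_def groupoid_def faithfully_projective_def
    by (auto simp: algebra.M_cring)
  show ?thesis
  proof (intro conjI impI theta_functor V_functor)
    show "\<exists>\<eta>. (\<forall>X \<in> Ob (fin_split_gsets G :: (('g, 'x) gset, 'x \<Rightarrow> 'x) cat).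
          gset_iso G X (V_gset G \<beta> (theta G R E u \<beta> X)) (\<eta> X)) \<and>
       (\<forall>X \<in> Ob (fin_split_gsets G). \<forall>Y \<in> Ob (fin_split_gsets G).
          \<forall>h \<in> Hom (fin_split_gsets G) X Y. \<forall>x \<in> gcar X.
          theta'_map G (theta G R E u \<beta> Y) (theta G R E u \<beta> X) (theta_map G R E u \<beta> X Y h) (\<eta> X x)
            = \<eta> Y (h x))"
      unfolding fin_split_gsets_simps
      by (intro exI[of _ \<eta>]) (simp add: \<eta>_iso \<eta>_natural)
    show "\<exists>\<epsilon>. (\<forall>P \<in> Ob (split_algebras G K R E u \<beta> ::
            (('k, 'b) module \<times> ('g \<Rightarrow> ('b \<Rightarrow> 'r) set), 'b \<Rightarrow> 'b) cat).
          split_iso G K P (theta G R E u \<beta> (V_gset G \<beta> P)) (\<epsilon> P)) \<and>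
       (\<forall>P \<in> Ob (split_algebras G K R E u \<beta>). \<forall>Q \<in> Ob (split_algebras G K R E u \<beta>).
          \<forall>f \<in> Hom (split_algebras G K R E u \<beta>) P Q. \<forall>b \<in> carrier (fst P).
          theta_map G R E u \<beta> (V_gset G \<beta> Q) (V_gset G \<beta> P) (theta'_map G P Q f) (\<epsilon> P b)
            = \<epsilon> Q (f b))"
    proof (intro exI[of _ \<epsilon>] conjI ballI)
      fix P :: "('k, 'b) module \<times> ('g \<Rightarrow> ('b \<Rightarrow> 'r) set)"
      assume P: "P \<in> Ob (split_algebras G K R E u \<beta>)"
      then show "split_iso G K P (theta G R E u \<beta> (V_gset G \<beta> P)) (\<epsilon> P)"
        using \<epsilon>_iso[of "fst P" "snd P"] by (simp add: split_algebras_simps)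
      fix Q :: "('k, 'b) module \<times> ('g \<Rightarrow> ('b \<Rightarrow> 'r) set)" and f b
      assume "Q \<in> Ob (split_algebras G K R E u \<beta>)" "f \<in> Hom (split_algebras G K R E u \<beta>) P Q"
        "b \<in> carrier (fst P)"
      then show "theta_map G R E u \<beta> (V_gset G \<beta> Q) (V_gset G \<beta> P) (theta'_map G P Q f) (\<epsilon> P b)
          = \<epsilon> Q (f b)"
        using \<epsilon>_natural[of "fst P" "snd P" "fst Q" "snd Q" f b] P by (simp add: split_algebras_simps)
    qed
  next
    assume "infinite (UNIV :: 'x set)"
    then show "contravariant_equivalence
         (fin_split_gsets G :: (('g, 'x) gset, 'x \<Rightarrow> 'x) cat) (split_algebras G K R E u \<beta>)
         (theta G R E u \<beta>) (theta_map G R E u \<beta>)"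
      using theta_ess_surj theta_map_bij theta_functor
      by (auto simp: contravariant_equivalence_def split_algebras_simps fin_split_gsets_simps)
  next
    assume "\<forall>e\<in>idents G. \<forall>x\<in>E e. x \<otimes>\<^bsub>R\<^esub> x = x \<longrightarrow> x = \<zero>\<^bsub>R\<^esub> \<or> x = u e"
    \<comment> \<open>In the connected case \<open>V e\<close> consists of all extensional algebra
      homomorphisms from \<open>B\<close> to \<open>EA e\<close>. It is thus determined by
      \<open>B\<close>, and precomposition with any algebra homomorphism respects it.\<close>
    then have mem: "\<psi> \<in> V e"
      if "split_alg B V" "e \<in> idents G" "\<psi> \<in> alg_hom K B (EA e)" "\<psi> \<in> extensional (carrier B)"
      for B :: "('k, 'b) module" and V e \<psi>
      using alg_hom_mem_V[OF that(1,2) _ that(3,4)] that(2) by blast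
    show "\<forall>(B :: ('k, 'b) module) V V'.
          (B, V) \<in> Ob (split_algebras G K R E u \<beta>) \<longrightarrow>
          (B, V') \<in> Ob (split_algebras G K R E u \<beta>) \<longrightarrow> V = V'"
    proof (intro allI impI)
      fix B :: "('k, 'b) module" and V V'
      assume "(B, V) \<in> Ob (split_algebras G K R E u \<beta>)" "(B, V') \<in> Ob (split_algebras G K R E u \<beta>)"
      then have P: "split_alg B V" "split_alg B V'" by (simp_all add: split_algebras_simps)
      show "V = V'"
      proof (rule extensionalityI[OF split_algD(2)[OF P(1)] split_algD(2)[OF P(2)]])
        show "V e = V' e" if e: "e \<in> idents G" for e
          using mem[OF P(1) e] mem[OF P(2) e] split_algD(5,6)[OF P(1) e] split_algD(5,6)[OF P(2) e]
          by blast
      qed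
    qed
    show "\<forall>P \<in> Ob (split_algebras G K R E u \<beta> ::
            (('k, 'b) module \<times> ('g \<Rightarrow> ('b \<Rightarrow> 'r) set), 'b \<Rightarrow> 'b) cat).
        \<forall>Q \<in> Ob (split_algebras G K R E u \<beta>).
          Hom (split_algebras G K R E u \<beta>) P Q
            = alg_hom K (fst P) (fst Q) \<inter> extensional (carrier (fst P))"
    proof (intro ballI)
      fix P Q :: "('k, 'b) module \<times> ('g \<Rightarrow> ('b \<Rightarrow> 'r) set)"
      assume "P \<in> Ob (split_algebras G K R E u \<beta>)" "Q \<in> Ob (split_algebras G K R E u \<beta>)"
      moreover obtain B V B' V' where PQ: "P = (B, V)" "Q = (B', V')" by (cases P, cases Q)
      ultimately have P: "split_alg B V" and Q: "split_alg B' V'" by (simp_all add: split_algebras_simps)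
      have "compose (carrier B) \<phi> f \<in> V e"
        if "f \<in> alg_hom K B B'" "e \<in> idents G" "\<phi> \<in> V' e" for f e \<phi>
        using that mem[OF P that(2) alg_hom_compose[OF split_algD(1)[OF P] that(1) split_algD(5)[OF Q that(2,3)]]]
        by (simp add: compose_extensional)
      then show "Hom (split_algebras G K R E u \<beta>) P Q
          = alg_hom K (fst P) (fst Q) \<inter> extensional (carrier (fst P))"
        by (auto simp: PQ split_algebras_simps split_homs_iff)
    qed
  qed
qed

end
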